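(* Let $D$ be a $2$-dimensional regular local ring. The set of patch limit points of $Q(D)$ in $L(D)$ is precisely the set of valuation rings in $L(D)$. Consequently the patch closure of $Q(D)$ in $L(D)$ is $Q^*(D)$.
   Context: $F$ is the quotient field of $D$. $L(D)$ is the set of local rings $R$ with $D\subseteq R\subseteq F$ and $\mathfrak{m}_R\cap D=\mathfrak{m}_D$. For $x_1,\dots,x_n\in F$, $\mathcal{U}(x_1,\dots,x_n)=\{R\in L(D):x_1,\dots,x_n\in R\}$ and $\mathcal{V}(x_1,\dots,x_n)=L(D)\setminus\mathcal{U}(x_1,\dots,x_n)$. The patch topology on $L(D)$ is the topology generated by all sets $\mathcal{U}(x_1,\dots,x_n)$ and $\mathcal{V}(x_1,\dots,x_n)$. $Q(D)$ is the set of $2$-dimensional regular local rings $\alpha$ with $D\subseteq\alpha\subseteq F$, and $Q^*(D)$ is the union of $Q(D)$ and all valuation rings in $L(D)$. *)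

theory Defs
  imports "HOL-Analysis.Analysis"
begin

text \<open>Throughout, the ambient field F is the type 'a (a field); subrings of F are sets of type 'a set.\<close>

definition is_subring :: "'a::field set \<Rightarrow> bool" where
  "is_subring R \<longleftrightarrow> 0 \<in> R \<and> 1 \<in> R \<and> (\<forall>x\<in>R. \<forall>y\<in>R. x + y \<in> R \<and> x - y \<in> R \<and> x * y \<in> R)"

definition quotient_field_is_UNIV :: "'a::field set \<Rightarrow> bool" where
  "quotient_field_is_UNIV D \<longleftrightarrow> (\<forall>z. \<exists>a\<in>D. \<exists>b\<in>D. b \<noteq> 0 \<and> z = a / b)"

definition is_ideal :: "'a::field set \<Rightarrow> 'a set \<Rightarrow> bool" where
  "is_ideal R I \<longleftrightarrow> I \<subseteq> R \<and> 0 \<in> I \<and> (\<forall>x\<in>I. \<forall>y\<in>I. x + y \<in> I) \<and> (\<forall>r\<in>R. \<forall>x\<in>I. r * x \<in> I)"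

definition is_prime_ideal :: "'a::field set \<Rightarrow> 'a set \<Rightarrow> bool" where
  "is_prime_ideal R P \<longleftrightarrow> is_ideal R P \<and> P \<noteq> R \<and> (\<forall>x\<in>R. \<forall>y\<in>R. x * y \<in> P \<longrightarrow> x \<in> P \<or> y \<in> P)"

definition ideal_span :: "'a::field set \<Rightarrow> 'a set \<Rightarrow> 'a set" where
  "ideal_span R G = {\<Sum>g\<in>G. c g * g | c. \<forall>g\<in>G. c g \<in> R}"

definition noetherian :: "'a::field set \<Rightarrow> bool" where
  "noetherian R \<longleftrightarrow> (\<forall>I. is_ideal R I \<longrightarrow> (\<exists>G. finite G \<and> G \<subseteq> I \<and> I = ideal_span R G))"

text \<open>Non-units of R; for a local ring this is its maximal ideal.\<close>
definition max_ideal :: "'a::field set \<Rightarrow> 'a set" where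
  "max_ideal R = {x\<in>R. x = 0 \<or> inverse x \<notin> R}"

definition local_ring :: "'a::field set \<Rightarrow> bool" where
  "local_ring R \<longleftrightarrow> is_subring R \<and> is_ideal R (max_ideal R)"

definition prime_chain :: "'a::field set \<Rightarrow> nat \<Rightarrow> bool" where
  "prime_chain R n \<longleftrightarrow> (\<exists>P :: nat \<Rightarrow> 'a set. (\<forall>i\<le>n. is_prime_ideal R (P i)) \<and> (\<forall>i<n. P i \<subset> P (Suc i)))"

definition krull_dim_eq :: "'a::field set \<Rightarrow> nat \<Rightarrow> bool" where
  "krull_dim_eq R n \<longleftrightarrow> prime_chain R n \<and> \<not> prime_chain R (Suc n)"

definition regular_local_dim2 :: "'a::field set \<Rightarrow> bool" where
  "regular_local_dim2 R \<longleftrightarrow> local_ring R \<and> noetherian R \<and> krull_dim_eq R 2 \<and>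
     (\<exists>a\<in>R. \<exists>b\<in>R. max_ideal R = ideal_span R {a, b})"

definition valuation_ring :: "'a::field set \<Rightarrow> bool" where
  "valuation_ring V \<longleftrightarrow> is_subring V \<and> (\<forall>x. x \<noteq> 0 \<longrightarrow> x \<in> V \<or> inverse x \<in> V)"

definition LD :: "'a::field set \<Rightarrow> 'a set set" where
  "LD D = {R. local_ring R \<and> D \<subseteq> R \<and> max_ideal R \<inter> D = max_ideal D}"

definition UD :: "'a::field set \<Rightarrow> 'a list \<Rightarrow> 'a set set" where
  "UD D xs = {R \<in> LD D. set xs \<subseteq> R}"

definition VD :: "'a::field set \<Rightarrow> 'a list \<Rightarrow> 'a set set" where
  "VD D xs = LD D - UD D xs"

definition patch_topology :: "'a::field set \<Rightarrow> 'a set topology" where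
  "patch_topology D = subtopology (topology_generated_by ({UD D xs | xs. True} \<union> {VD D xs | xs. True})) (LD D)"

definition QD :: "'a::field set \<Rightarrow> 'a set set" where
  "QD D = {\<alpha>. regular_local_dim2 \<alpha> \<and> D \<subseteq> \<alpha>}"

definition QstarD :: "'a::field set \<Rightarrow> 'a set set" where
  "QstarD D = QD D \<union> {V \<in> LD D. valuation_ring V}"

end

theory Submission
  imports Defs "HOL-Computational_Algebra.Polynomial"
begin

text \<open>
  Let \<open>u, v\<close> be regular parameters of \<open>D\<close>. A regular ring \<open>\<alpha> \<noteq> D\<close> of \<open>Q(D)\<close> contains \<open>v / u\<close> or
  \<open>u / v\<close>, hence so does every patch limit \<open>R\<close> of \<open>Q(D)\<close>. If \<open>v / u \<in> R\<close>, then \<open>R\<close> is either the order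
  valuation ring of \<open>D\<close>, the localisation of \<open>D[v / u]\<close> at \<open>u D[v / u]\<close>, or it dominates a quadratic
  transform \<open>D\<^sub>1\<close> of \<open>D\<close>; in the second case the rings of \<open>Q(D)\<close> close to \<open>R\<close> contain \<open>D\<^sub>1\<close>, so \<open>R\<close> is a
  limit of \<open>Q(D\<^sub>1)\<close> and the argument repeats. The union of an infinite sequence of quadratic transforms
  is a valuation ring, by the finiteness behind the Krull--Akizuki theorem.

  Conversely the same sequence is followed along a valuation ring \<open>V\<close>. If it does not stop, \<open>V\<close> is its
  union and thus a limit of its members. If it stops, \<open>V\<close> is the order valuation ring of some \<open>\<alpha>\<close> in
  \<open>Q(D)\<close>, and it is a limit of quadratic transforms of \<open>\<alpha>\<close> because the polynomial ring over the residue
  field has vanishing Jacobson radical.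
\<close>

subsection \<open>Subrings and ideals of a field\<close>

text \<open>Dimension theory and unique factorisation are reduced to two properties of the
  parameters: \<open>u\<close> is nonzero and no power of \<open>v\<close> lies in
  \<open>u D\<close>. These pass to quadratic transforms by direct computation, make every prime
  other than zero and the maximal ideal principal, and let each fraction be written
  \<open>a / b\<close> with powers of \<open>u\<close> and \<open>v\<close> in the ideal
  \<open>(a, b)\<close>. That nearby rings contain the quadratic transform rests on the half of the
  patch topology that is not Zariski: demanding \<open>f\<close> and forbidding \<open>1 / f\<close>
  makes \<open>f\<close> a nonunit, and the prime of \<open>D[v / u]\<close> that defines the
  transform is the only one containing both \<open>u\<close> and a suitable \<open>f\<close>. The
  union of the sequence need not be noetherian. If it missed both \<open>z\<close> and
  \<open>1 / z\<close>, then \<open>z\<close> would be residually transcendental over every member,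
  so each member has a Gauss extension by \<open>z\<close>. In the first of these, with
  \<open>z = a / b\<close> reduced, \<open>b\<close> divides powers of \<open>u\<close> and
  \<open>v\<close>; this extension therefore has dimension one, and the Krull--Akizuki argument
  applies to its overrings.\<close>

lemma subring_closed:
  assumes "is_subring R"
  shows subring_zero: "0 \<in> R" and subring_one: "1 \<in> R"
    and subring_add: "\<lbrakk>x \<in> R; y \<in> R\<rbrakk> \<Longrightarrow> x + y \<in> R"
    and subring_diff: "\<lbrakk>x \<in> R; y \<in> R\<rbrakk> \<Longrightarrow> x - y \<in> R"
    and subring_mult: "\<lbrakk>x \<in> R; y \<in> R\<rbrakk> \<Longrightarrow> x * y \<in> R"
  using assms by (auto simp: is_subring_def)

lemma subring_uminus: "is_subring R \<Longrightarrow> x \<in> R \<Longrightarrow> - x \<in> R"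
  using subring_diff[of R 0 x] by (simp add: subring_zero)

lemma subring_power: "is_subring R \<Longrightarrow> x \<in> R \<Longrightarrow> x ^ n \<in> R"
  by (induction n) (auto simp: subring_closed)

lemma subring_sum: "is_subring R \<Longrightarrow> (\<And>i. i \<in> A \<Longrightarrow> f i \<in> R) \<Longrightarrow> sum f A \<in> R"
  by (induction A rule: infinite_finite_induct) (auto simp: subring_closed)

lemmas subring_intros = subring_closed subring_uminus subring_power

lemma ideal_closed:
  assumes "is_ideal R I"
  shows ideal_subset: "I \<subseteq> R" and ideal_zero: "0 \<in> I"
    and ideal_add: "\<lbrakk>x \<in> I; y \<in> I\<rbrakk> \<Longrightarrow> x + y \<in> I"
    and ideal_mult: "\<lbrakk>r \<in> R; x \<in> I\<rbrakk> \<Longrightarrow> r * x \<in> I"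
    and ideal_mult_right: "\<lbrakk>r \<in> R; x \<in> I\<rbrakk> \<Longrightarrow> x * r \<in> I"
  using assms by (auto simp: is_ideal_def mult.commute)

lemma ideal_uminus: "is_subring R \<Longrightarrow> is_ideal R I \<Longrightarrow> x \<in> I \<Longrightarrow> - x \<in> I"
  using ideal_mult[of R I "-1" x] by (simp add: subring_one subring_uminus)

lemma ideal_diff: "is_subring R \<Longrightarrow> is_ideal R I \<Longrightarrow> x \<in> I \<Longrightarrow> y \<in> I \<Longrightarrow> x - y \<in> I"
  using ideal_add[of R I x "-y"] by (simp add: ideal_uminus)

lemma ideal_sum: "is_ideal R I \<Longrightarrow> (\<And>i. i \<in> A \<Longrightarrow> f i \<in> I) \<Longrightarrow> sum f A \<in> I"
  by (induction A rule: infinite_finite_induct) (auto simp: ideal_closed)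

lemma ideal_Int: "is_ideal R I \<Longrightarrow> is_ideal R J \<Longrightarrow> is_ideal R (I \<inter> J)"
  by (auto simp: is_ideal_def)

lemma ideal_top: "is_subring R \<Longrightarrow> is_ideal R R"
  by (auto simp: is_ideal_def is_subring_def)

lemma ideal_bot: "is_subring R \<Longrightarrow> is_ideal R {0}"
  by (auto simp: is_ideal_def is_subring_def)

definition adjoin_gen :: "'a::field set \<Rightarrow> 'a set \<Rightarrow> 'a \<Rightarrow> 'a set" where
  "adjoin_gen R I x = {y + r * x | y r. y \<in> I \<and> r \<in> R}"

definition ideal_plus :: "'a::field set \<Rightarrow> 'a set \<Rightarrow> 'a set" where
  "ideal_plus I J = {x + y | x y. x \<in> I \<and> y \<in> J}"

definition multiples :: "'a::field set \<Rightarrow> 'a \<Rightarrow> 'a set" where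
  "multiples R x = {x * r | r. r \<in> R}"

definition two_gen :: "'a::field set \<Rightarrow> 'a \<Rightarrow> 'a \<Rightarrow> 'a set" where
  "two_gen R x y = {r * x + s * y | r s. r \<in> R \<and> s \<in> R}"

lemma ideal_plus_ideal:
  assumes R: "is_subring R" and I: "is_ideal R I" and J: "is_ideal R J"
  shows "is_ideal R (ideal_plus I J)"
  unfolding is_ideal_def
proof (intro conjI ballI)
  show "ideal_plus I J \<subseteq> R"
    using I J R by (auto simp: ideal_plus_def is_ideal_def subset_iff subring_add)
  show "0 \<in> ideal_plus I J"
    using I J by (force simp: ideal_plus_def is_ideal_def)
  fix x assume "x \<in> ideal_plus I J"
  then obtain a b where x: "x = a + b" "a \<in> I" "b \<in> J" by (auto simp: ideal_plus_def)
  {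
    fix y assume "y \<in> ideal_plus I J"
    then obtain c d where y: "y = c + d" "c \<in> I" "d \<in> J" by (auto simp: ideal_plus_def)
    have "x + y = (a + c) + (b + d)" using x y by simp
    then show "x + y \<in> ideal_plus I J"
      using x y I J unfolding ideal_plus_def by (blast intro: ideal_add)
  next
    fix r assume r: "r \<in> R"
    have "r * x = r * a + r * b" using x by (simp add: algebra_simps)
    then show "r * x \<in> ideal_plus I J"
      using x r I J unfolding ideal_plus_def by (blast intro: ideal_mult)
  }
qed

lemma ideal_plus_upper1: "0 \<in> J \<Longrightarrow> I \<subseteq> ideal_plus I J"
  by (force simp: ideal_plus_def)

lemma ideal_plus_upper2: "0 \<in> I \<Longrightarrow> J \<subseteq> ideal_plus I J"
  by (force simp: ideal_plus_def)

lemma multiples_ideal: 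
  assumes R: "is_subring R" and x: "x \<in> R"
  shows "is_ideal R (multiples R x)"
  unfolding is_ideal_def
proof (intro conjI ballI)
  show "multiples R x \<subseteq> R" using R x by (auto simp: multiples_def subring_mult)
  show "0 \<in> multiples R x" using subring_zero[OF R] by (force simp: multiples_def)
  fix y assume "y \<in> multiples R x"
  then obtain a where y: "y = x * a" "a \<in> R" by (auto simp: multiples_def)
  {
    fix z assume "z \<in> multiples R x"
    then obtain c where z: "z = x * c" "c \<in> R" by (auto simp: multiples_def)
    have "y + z = x * (a + c)" using y z by (simp add: algebra_simps)
    then show "y + z \<in> multiples R x"
      using y z R unfolding multiples_def by (blast intro: subring_add)
  next
    fix r assume r: "r \<in> R"
    have "r * y = x * (r * a)" using y by simp
    then show "r * y \<in> multiples R x"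
      using y r R unfolding multiples_def by (blast intro: subring_mult)
  }
qed

lemma multiples_self: "is_subring R \<Longrightarrow> x \<in> multiples R x"
  using subring_one[of R] by (force simp: multiples_def)

lemma adjoin_gen_eq_plus: "adjoin_gen R I x = ideal_plus I (multiples R x)"
proof -
  have "multiples R t = {r * t | r. r \<in> R}" for t by (simp add: multiples_def mult.commute)
  then show ?thesis by (auto simp: adjoin_gen_def ideal_plus_def)
qed

lemma two_gen_eq_plus: "two_gen R x y = ideal_plus (multiples R x) (multiples R y)"
proof -
  have "multiples R t = {r * t | r. r \<in> R}" for t by (simp add: multiples_def mult.commute)
  then show ?thesis by (auto simp: two_gen_def ideal_plus_def)
qed

lemma adjoin_gen_ideal:
  "is_subring R \<Longrightarrow> is_ideal R I \<Longrightarrow> x \<in> R \<Longrightarrow> is_ideal R (adjoin_gen R I x)"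
  by (simp add: adjoin_gen_eq_plus ideal_plus_ideal multiples_ideal)

lemma two_gen_ideal:
  "is_subring R \<Longrightarrow> x \<in> R \<Longrightarrow> y \<in> R \<Longrightarrow> is_ideal R (two_gen R x y)"
  by (simp add: two_gen_eq_plus ideal_plus_ideal multiples_ideal)

lemma adjoin_gen_upper: "is_subring R \<Longrightarrow> I \<subseteq> adjoin_gen R I x"
  using subring_zero[of R] by (force simp: adjoin_gen_def)

lemma adjoin_gen_self: "is_subring R \<Longrightarrow> 0 \<in> I \<Longrightarrow> x \<in> adjoin_gen R I x"
  using subring_one[of R] by (force simp: adjoin_gen_def)

lemma two_gen_self:
  assumes "is_subring R"
  shows "x \<in> two_gen R x y" "y \<in> two_gen R x y"
  using subring_one[OF assms] subring_zero[OF assms] by (force simp: two_gen_def)+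

lemma two_gen_commute: "two_gen R x y = two_gen R y x"
  unfolding two_gen_def by (subst add.commute) blast

lemma two_gen_least: "is_ideal R I \<Longrightarrow> x \<in> I \<Longrightarrow> y \<in> I \<Longrightarrow> two_gen R x y \<subseteq> I"
  by (auto simp: two_gen_def ideal_closed)

text \<open>The working substitute for coprimality: multiplication by \<open>a\<close> is injective
  on \<open>R / b R\<close>, so \<open>b, a\<close> behaves as a regular sequence.\<close>

definition nonzerodivisor_mod :: "'a::field set \<Rightarrow> 'a \<Rightarrow> 'a \<Rightarrow> bool" where
  "nonzerodivisor_mod R b a \<longleftrightarrow> (\<forall>c\<in>R. \<forall>e\<in>R. c * a = b * e \<longrightarrow> c \<in> multiples R b)"

lemma nonzerodivisor_mod_power:
  assumes R: "is_subring R" and a: "a \<in> R"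
    and cop: "nonzerodivisor_mod R b a"
    and c: "c \<in> R" "c * a ^ n \<in> multiples R b"
  shows "c \<in> multiples R b"
  using c
proof (induction n arbitrary: c)
  case (Suc n)
  then have "(c * a) * a ^ n \<in> multiples R b" "c * a \<in> R"
    using a subring_mult[OF R] by (auto simp: algebra_simps)
  then have "c * a \<in> multiples R b" using Suc.IH by blast
  then show ?case using cop Suc.prems(1) by (auto simp: multiples_def nonzerodivisor_mod_def)
qed simp

text \<open>Regularity passes to powers: factors \<open>b\<close> are split off \<open>e\<close> one
  at a time, and each is cancelled from the equation before the next.\<close>

lemma nonzerodivisor_mod_power_power:
  assumes R: "is_subring R" and a: "a \<in> R" and b: "b \<in> R" "b \<noteq> 0"
    and cop: "nonzerodivisor_mod R b a"
    and e: "e \<in> R" "f \<in> R" "e * a ^ j = f * b ^ k"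
  shows "e \<in> multiples R (b ^ k)"
  using e
proof (induction k arbitrary: e)
  case 0 then show ?case by (auto simp: multiples_def)
next
  case (Suc k)
  have "e * a ^ j = b * (f * b ^ k)" using Suc.prems by simp
  moreover have "f * b ^ k \<in> R" using Suc.prems b by (auto intro!: subring_intros R)
  ultimately have "e * a ^ j \<in> multiples R b" unfolding multiples_def by blast
  then have "e \<in> multiples R b" using nonzerodivisor_mod_power[OF R a cop] Suc.prems(1) by blast
  then obtain e' where e': "e = b * e'" "e' \<in> R" by (auto simp: multiples_def)
  then have "e' * a ^ j = f * b ^ k" using Suc.prems(3) b(2) by simp
  then have "e' \<in> multiples R (b ^ k)" using Suc.IH[OF e'(2) Suc.prems(2)] by blast
  then show ?case using e' by (auto simp: multiples_def algebra_simps)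
qed

lemma ideal_span_ideal:
  assumes R: "is_subring R" and G: "G \<subseteq> R"
  shows "is_ideal R (ideal_span R G)"
  unfolding is_ideal_def
proof (intro conjI ballI)
  show "ideal_span R G \<subseteq> R"
    using R G by (auto simp: ideal_span_def subset_iff intro!: subring_sum subring_mult)
  show "0 \<in> ideal_span R G"
    unfolding ideal_span_def using subring_zero[OF R]
    by (intro CollectI exI[of _ "\<lambda>_. 0"]) auto
  fix x assume "x \<in> ideal_span R G"
  then obtain c where x: "x = (\<Sum>g\<in>G. c g * g)" "\<forall>g\<in>G. c g \<in> R" by (auto simp: ideal_span_def)
  {
    fix y assume "y \<in> ideal_span R G"
    then obtain d where y: "y = (\<Sum>g\<in>G. d g * g)" "\<forall>g\<in>G. d g \<in> R" by (auto simp: ideal_span_def)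
    show "x + y \<in> ideal_span R G"
      unfolding ideal_span_def using x y R
      by (intro CollectI exI[of _ "\<lambda>g. c g + d g"])
        (auto simp: algebra_simps sum.distrib subring_add)
  next
    fix r assume r: "r \<in> R"
    show "r * x \<in> ideal_span R G"
      unfolding ideal_span_def using x r R
      by (intro CollectI exI[of _ "\<lambda>g. r * c g"])
        (auto simp: algebra_simps sum_distrib_left subring_mult)
  }
qed

lemma ideal_span_superset:
  assumes R: "is_subring R" and "finite G"
  shows "G \<subseteq> ideal_span R G"
proof
  fix x assume "x \<in> G"
  have "x = (\<Sum>g\<in>G. (if g = x then 1 else 0) * g)"
    using assms \<open>x \<in> G\<close> by (simp add: if_distrib[of "\<lambda>c. c * _"] cong: if_cong)
  then show "x \<in> ideal_span R G"
    unfolding ideal_span_def using subring_closed[OF R]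
    by (intro CollectI exI[of _ "\<lambda>g. if g = x then 1 else 0"]) auto
qed

lemma ideal_span_least: "is_ideal R I \<Longrightarrow> G \<subseteq> I \<Longrightarrow> ideal_span R G \<subseteq> I"
  by (auto simp: ideal_span_def intro!: ideal_sum ideal_mult)

lemma ideal_span_pair:
  assumes R: "is_subring R" and "a \<in> R" "b \<in> R"
  shows "ideal_span R {a, b} = two_gen R a b"
proof
  show "ideal_span R {a, b} \<subseteq> two_gen R a b"
    using assms by (intro ideal_span_least two_gen_ideal) (auto simp: two_gen_self)
  show "two_gen R a b \<subseteq> ideal_span R {a, b}"
    using assms ideal_span_superset[OF R, of "{a, b}"]
    by (intro two_gen_least ideal_span_ideal) auto
qed

text \<open>Finite generation phrased by a universal property, so that no sums of coefficients occur.\<close>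

lemma noetherian_iff:
  assumes R: "is_subring R"
  shows "noetherian R \<longleftrightarrow> (\<forall>I. is_ideal R I \<longrightarrow>
    (\<exists>G. finite G \<and> G \<subseteq> I \<and> (\<forall>K. is_ideal R K \<longrightarrow> G \<subseteq> K \<longrightarrow> I \<subseteq> K)))"
proof -
  have "I = ideal_span R G \<longleftrightarrow> (\<forall>K. is_ideal R K \<longrightarrow> G \<subseteq> K \<longrightarrow> I \<subseteq> K)"
    if "is_ideal R I" "finite G" "G \<subseteq> I" for I G
  proof
    assume "I = ideal_span R G"
    then show "\<forall>K. is_ideal R K \<longrightarrow> G \<subseteq> K \<longrightarrow> I \<subseteq> K" using ideal_span_least by metis
  next
    assume *: "\<forall>K. is_ideal R K \<longrightarrow> G \<subseteq> K \<longrightarrow> I \<subseteq> K"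
    have "G \<subseteq> R" using that ideal_subset by blast
    then have "I \<subseteq> ideal_span R G"
      using * ideal_span_ideal[OF R] ideal_span_superset[OF R \<open>finite G\<close>] by blast
    moreover have "ideal_span R G \<subseteq> I" using that ideal_span_least by blast
    ultimately show "I = ideal_span R G" by blast
  qed
  then show ?thesis unfolding noetherian_def by (intro iff_allI imp_cong refl ex_cong1 conj_cong) auto
qed

lemma noetherian_acc:
  assumes R: "is_subring R" "noetherian R"
    and I: "\<And>n. is_ideal R (I n)" and inc: "incseq I"
  shows "\<exists>n. \<forall>m\<ge>n. I m = I n"
proof -
  let ?U = "\<Union>n. I n"
  have "is_ideal R ?U"
    unfolding is_ideal_def
  proof (intro conjI ballI)
    show "?U \<subseteq> R" using I ideal_subset by blast
    show "0 \<in> ?U" using I ideal_zero by blast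
    fix x assume "x \<in> ?U"
    then obtain n where n: "x \<in> I n" by blast
    {
      fix y assume "y \<in> ?U"
      then obtain m where m: "y \<in> I m" by blast
      have "I n \<subseteq> I (max n m)" "I m \<subseteq> I (max n m)" using inc by (auto simp: incseq_def)
      then have "x + y \<in> I (max n m)" using n m by (intro ideal_add[OF I]) auto
      then show "x + y \<in> ?U" by blast
    next
      fix r assume "r \<in> R"
      then have "r * x \<in> I n" using n by (intro ideal_mult[OF I])
      then show "r * x \<in> ?U" by blast
    }
  qed
  then obtain G where G: "finite G" "G \<subseteq> ?U" "\<And>K. is_ideal R K \<Longrightarrow> G \<subseteq> K \<Longrightarrow> ?U \<subseteq> K"
    using noetherian_iff[OF R(1)] R(2) by meson
  have "\<exists>n. G \<subseteq> I n" using G(1,2)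
  proof (induction G)
    case (insert g G)
    then obtain n m where "G \<subseteq> I n" "g \<in> I m" by auto
    moreover have "I n \<subseteq> I (max n m)" "I m \<subseteq> I (max n m)" using inc by (auto simp: incseq_def)
    ultimately show ?case by (meson insert_subset subset_iff)
  qed auto
  then obtain n where "G \<subseteq> I n" by blast
  then have "?U \<subseteq> I n" using G(3) I by blast
  then show ?thesis using inc by (intro exI[of _ n]) (fastforce simp: incseq_def)
qed

lemma noetherian_maximal:
  assumes R: "is_subring R" "noetherian R"
    and X: "\<And>I. I \<in> X \<Longrightarrow> is_ideal R I" "X \<noteq> {}"
  shows "\<exists>I\<in>X. \<forall>J\<in>X. I \<subseteq> J \<longrightarrow> J = I"
proof (rule ccontr)
  assume "\<not> ?thesis"
  then have "\<forall>I\<in>X. \<exists>J\<in>X. I \<subset> J" by blast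
  then obtain h where h: "\<And>I. I \<in> X \<Longrightarrow> h I \<in> X \<and> I \<subset> h I" by metis
  from X obtain I0 where "I0 \<in> X" by blast
  have inX: "(h ^^ n) I0 \<in> X" for n
    by (induction n) (use \<open>I0 \<in> X\<close> h in auto)
  have step: "(h ^^ n) I0 \<subset> (h ^^ Suc n) I0" for n using h inX by simp
  have "incseq (\<lambda>n. (h ^^ n) I0)" using step by (intro incseq_SucI) blast
  then show False using noetherian_acc[OF R, of "\<lambda>n. (h ^^ n) I0"] inX X step
    by (metis less_irrefl le_Suc_eq order_refl)
qed

text \<open>An ideal maximal among those containing \<open>I\<close> and missing the multiplicative
  set \<open>M\<close> is prime; the noetherian condition supplies the maximal element.\<close>

lemma exists_prime_ideal:
  assumes R: "is_subring R" "noetherian R" and I: "is_ideal R I"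
    and M: "1 \<in> M" "\<And>x y. x \<in> M \<Longrightarrow> y \<in> M \<Longrightarrow> x * y \<in> M" and "I \<inter> M = {}"
  shows "\<exists>P. is_prime_ideal R P \<and> I \<subseteq> P \<and> P \<inter> M = {}"
proof -
  let ?X = "{P. is_ideal R P \<and> I \<subseteq> P \<and> P \<inter> M = {}}"
  have "?X \<noteq> {}" using assms by blast
  then obtain P where P: "P \<in> ?X" and max: "\<And>J. J \<in> ?X \<Longrightarrow> P \<subseteq> J \<Longrightarrow> J = P"
    using noetherian_maximal[OF R, of ?X] by (metis (no_types, lifting) mem_Collect_eq)
  have iP: "is_ideal R P" using P by blast
  have meets: "\<exists>s r. s \<in> P \<and> r \<in> R \<and> s + r * x \<in> M" if "x \<in> R" "x \<notin> P" for x
  proof -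
    have "adjoin_gen R P x \<noteq> P" using that adjoin_gen_self[OF R(1), of P x] ideal_zero[OF iP] by auto
    then have "adjoin_gen R P x \<notin> ?X"
      using max adjoin_gen_upper[OF R(1), of P x] by blast
    then have "adjoin_gen R P x \<inter> M \<noteq> {}"
      using P adjoin_gen_upper[OF R(1), of P x] adjoin_gen_ideal[OF R(1) iP that(1)] by blast
    then show ?thesis by (auto simp: adjoin_gen_def)
  qed
  have "x \<in> P \<or> y \<in> P" if xy: "x \<in> R" "y \<in> R" "x * y \<in> P" for x y
  proof (rule ccontr)
    assume "\<not> ?thesis"
    then obtain s r s' r' where *: "s \<in> P" "r \<in> R" "s + r * x \<in> M" "s' \<in> P" "r' \<in> R" "s' + r' * y \<in> M"
      using meets xy by metis
    have "(s + r * x) * (s' + r' * y) = (s' + r' * y) * s + (r * x * s' + r * r' * (x * y))"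
      by (simp add: algebra_simps)
    moreover have "\<dots> \<in> P"
    proof (intro ideal_add[OF iP])
      show "(s' + r' * y) * s \<in> P"
        using * xy R ideal_subset[OF iP] by (intro ideal_mult[OF iP]) (auto intro!: subring_intros)
      show "r * x * s' \<in> P" "r * r' * (x * y) \<in> P"
        using * xy subring_mult[OF R(1)] ideal_mult[OF iP] by blast+
    qed
    ultimately show False using M(2) * P by (metis (lifting) Int_iff empty_iff mem_Collect_eq)
  qed
  moreover have "P \<noteq> R" using P M(1) subring_one[OF R(1)] by blast
  ultimately have "is_prime_ideal R P" using iP unfolding is_prime_ideal_def by blast
  then show ?thesis using P by blast
qed

subsection \<open>Local rings\<close>

lemma local_subring: "local_ring R \<Longrightarrow> is_subring R"
  by (simp add: local_ring_def)

lemma local_max_ideal: "local_ring R \<Longrightarrow> is_ideal R (max_ideal R)"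
  by (simp add: local_ring_def)

lemma max_ideal_subset: "max_ideal R \<subseteq> R"
  by (auto simp: max_ideal_def)

lemma one_notin_max_ideal: "1 \<in> R \<Longrightarrow> 1 \<notin> max_ideal R"
  by (auto simp: max_ideal_def)

lemma inverse_in: "x \<in> R \<Longrightarrow> x \<notin> max_ideal R \<Longrightarrow> inverse x \<in> R \<and> x \<noteq> 0"
  by (auto simp: max_ideal_def)

lemma not_in_max_ideal: "x \<noteq> 0 \<Longrightarrow> inverse x \<in> R \<Longrightarrow> x \<notin> max_ideal R"
  by (auto simp: max_ideal_def)

lemma max_ideal_no_inverse: "x \<in> max_ideal R \<Longrightarrow> y \<in> R \<Longrightarrow> x * y \<noteq> 1"
  by (auto simp: max_ideal_def) (metis inverse_unique)

lemma max_ideal_prime: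
  assumes "local_ring R" "x \<in> R" "y \<in> R" "x * y \<in> max_ideal R"
  shows "x \<in> max_ideal R \<or> y \<in> max_ideal R"
proof (rule ccontr)
  assume "\<not> ?thesis"
  then have "inverse x \<in> R" "inverse y \<in> R" "x \<noteq> 0" "y \<noteq> 0" using assms inverse_in by blast+
  then have "inverse (x * y) \<in> R" using assms by (simp add: subring_mult local_subring)
  then show False using assms not_in_max_ideal \<open>x \<noteq> 0\<close> \<open>y \<noteq> 0\<close> by (metis mult_eq_0_iff)
qed

lemma one_minus_unit:
  assumes R: "local_ring R" and x: "x \<in> max_ideal R"
  shows "1 - x \<noteq> 0" "inverse (1 - x) \<in> R"
proof -
  have "1 - x \<notin> max_ideal R"
    using ideal_add[OF local_max_ideal[OF R], of "1 - x" x] x one_notin_max_ideal[of R]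
      subring_one[OF local_subring[OF R]] by auto
  moreover have "1 - x \<in> R"
    using x max_ideal_subset[of R] R by (auto intro!: subring_diff subring_one local_subring)
  ultimately show "1 - x \<noteq> 0" "inverse (1 - x) \<in> R" using inverse_in by blast+
qed

lemma proper_ideal_subset_max: 
  assumes "is_ideal R I" "1 \<notin> I"
  shows "I \<subseteq> max_ideal R"
proof
  fix x assume x: "x \<in> I"
  then have "x \<in> R" using assms ideal_subset by blast
  show "x \<in> max_ideal R"
  proof (rule ccontr)
    assume "x \<notin> max_ideal R"
    then have "inverse x * x \<in> I" "x \<noteq> 0" using \<open>x \<in> R\<close> inverse_in x assms(1) ideal_mult by metis+
    then show False using assms(2) by simp
  qed
qed

lemma prime_ideal_one: "is_prime_ideal R P \<Longrightarrow> 1 \<notin> P"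
  unfolding is_prime_ideal_def is_ideal_def by (metis mult.right_neutral subsetI subset_antisym)

lemma prime_ideal_ideal: "is_prime_ideal R P \<Longrightarrow> is_ideal R P"
  by (simp add: is_prime_ideal_def)

lemma prime_ideal_disj: "is_prime_ideal R P \<Longrightarrow> x \<in> R \<Longrightarrow> y \<in> R \<Longrightarrow> x * y \<in> P \<Longrightarrow> x \<in> P \<or> y \<in> P"
  by (simp add: is_prime_ideal_def)

lemma prime_ideal_power:
  assumes "is_subring R" "is_prime_ideal R P" "x \<in> R" "x ^ n \<in> P"
  shows "x \<in> P"
  using assms(4)
proof (induction n)
  case 0 then show ?case using prime_ideal_one[OF assms(2)] by simp
next
  case (Suc n)
  then show ?case using prime_ideal_disj[OF assms(2,3), of "x ^ n"] assms
    by (auto simp: subring_power)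
qed

text \<open>A form of Nakayama's lemma: writing \<open>x\<^sub>0 \<in> J + u x\<^sub>1\<close>, \<open>x\<^sub>1 \<in> J + u x\<^sub>2\<close>, \dots, the ideals
  \<open>J + (x\<^sub>n)\<close> ascend, and where they stabilise \<open>x\<^sub>n\<close> is absorbed by \<open>J\<close>.\<close>

lemma local_descent:
  assumes R: "local_ring R" "noetherian R" and J: "is_ideal R J" and I: "I \<subseteq> R"
    and u: "u \<in> max_ideal R" and step: "\<And>x. x \<in> I \<Longrightarrow> \<exists>y\<in>I. x - u * y \<in> J"
  shows "I \<subseteq> J"
proof
  fix x0 assume x0: "x0 \<in> I"
  note sR = local_subring[OF R(1)]
  have uR: "u \<in> R" using u max_ideal_subset by blast
  obtain h where h: "\<And>x. x \<in> I \<Longrightarrow> h x \<in> I \<and> x - u * h x \<in> J" using step by metis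
  define x where "x n = (h ^^ n) x0" for n
  have xI: "x n \<in> I" for n unfolding x_def by (induction n) (use x0 h in auto)
  then have xR: "x n \<in> R" for n using I by blast
  have xs: "x n - u * x (Suc n) \<in> J" for n using h[OF xI[of n]] by (simp add: x_def)
  have in_next: "x n \<in> adjoin_gen R J (x (Suc n))" for n
  proof -
    have "x n = (x n - u * x (Suc n)) + u * x (Suc n)" by simp
    then show ?thesis using xs uR unfolding adjoin_gen_def by blast
  qed
  have "incseq (\<lambda>n. adjoin_gen R J (x n))"
  proof (rule incseq_SucI)
    fix n
    have id: "is_ideal R (adjoin_gen R J (x (Suc n)))" using adjoin_gen_ideal sR J xR by blast
    show "adjoin_gen R J (x n) \<subseteq> adjoin_gen R J (x (Suc n))"
    proof
      fix y assume "y \<in> adjoin_gen R J (x n)"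
      then obtain j r where y: "y = j + r * x n" "j \<in> J" "r \<in> R" by (auto simp: adjoin_gen_def)
      then show "y \<in> adjoin_gen R J (x (Suc n))"
        using id in_next adjoin_gen_upper[OF sR, of J] ideal_add ideal_mult by blast
    qed
  qed
  then obtain n where "adjoin_gen R J (x (Suc n)) = adjoin_gen R J (x n)"
    using noetherian_acc[OF sR R(2)] adjoin_gen_ideal[OF sR J xR] by (metis Suc_n_not_le_n nat_le_linear)
  then have "x (Suc n) \<in> adjoin_gen R J (x n)" 
    using adjoin_gen_self[OF sR ideal_zero[OF J]] by metis
  then obtain j r where jr: "x (Suc n) = j + r * x n" "j \<in> J" "r \<in> R" by (auto simp: adjoin_gen_def)
  \<comment> \<open>Replacing \<open>x n\<close> by \<open>u * x (Suc n)\<close> modulo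
    \<open>J\<close> gives \<open>x (Suc n)\<close> a coefficient \<open>1 - r * u\<close>, a unit
    because \<open>u\<close> is not. Membership in \<open>J\<close> is then carried back from
    \<open>Suc n\<close> to 0.\<close>
  have "(1 - r * u) * x (Suc n) = j + r * (x n - u * x (Suc n))"
    using jr(1) by (simp add: algebra_simps)
  moreover have "\<dots> \<in> J" using jr(2,3) xs by (intro ideal_add[OF J] ideal_mult[OF J])
  ultimately have *: "(1 - r * u) * x (Suc n) \<in> J" by simp
  have "r * u \<in> max_ideal R" using u jr local_max_ideal[OF R(1)] ideal_mult by blast
  then have "1 - r * u \<noteq> 0" "inverse (1 - r * u) \<in> R" using one_minus_unit[OF R(1)] by blast+
  then have "x (Suc n) \<in> J" using ideal_mult[OF J _ *, of "inverse (1 - r * u)"] 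
    by (simp add: mult.assoc[symmetric])
  have prev: "x (Suc m) \<in> J \<Longrightarrow> x m \<in> J" for m
  proof -
    assume "x (Suc m) \<in> J"
    then have "(x m - u * x (Suc m)) + u * x (Suc m) \<in> J" using xs uR J ideal_add ideal_mult by blast
    then show "x m \<in> J" by simp
  qed
  have "x m \<in> J \<Longrightarrow> x 0 \<in> J" for m by (induction m) (use prev in auto)
  then have "x 0 \<in> J" using \<open>x (Suc n) \<in> J\<close> by blast
  then show "x0 \<in> J" by (simp add: x_def)
qed

subsection \<open>Finite length and its consequences\<close>

text \<open>A substitute for the statement that \<open>M / M'\<close> has finite length.\<close>

definition stabilising :: "'a::field set \<Rightarrow> 'a set \<Rightarrow> 'a set \<Rightarrow> bool" where
  "stabilising R M' M \<longleftrightarrow> (\<forall>I :: nat \<Rightarrow> 'a set.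
     (\<forall>n. is_ideal R (I n) \<and> M' \<subseteq> I n \<and> I n \<subseteq> M) \<longrightarrow> decseq I \<longrightarrow>
     (\<exists>n. \<forall>m\<ge>n. I m = I n))"

text \<open>The modular law: nested ideals with the same trace on \<open>M\<close> and the same sum
  with \<open>M\<close> coincide.\<close>

lemma ideal_modular:
  assumes "is_subring R" "is_ideal R I" "is_ideal R J" "I \<subseteq> J"
    and "I \<inter> M = J \<inter> M" "ideal_plus I M = ideal_plus J M" "0 \<in> M"
  shows "I = J"
proof -
  have "x \<in> I" if "x \<in> J" for x
  proof -
    have "x \<in> ideal_plus I M" using that ideal_plus_upper1[of M J] assms by blast
    then obtain y z where x: "x = y + z" "y \<in> I" "z \<in> M" by (auto simp: ideal_plus_def)
    have "z \<in> J" using ideal_diff[OF assms(1,3) that, of y] x assms(4) by auto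
    then have "z \<in> I" using x assms(5) by blast
    then show "x \<in> I" using x ideal_add[OF assms(2)] by blast
  qed
  then show ?thesis using assms(4) by blast
qed

lemma stabilising_decseq:
  assumes "stabilising R M' M" "\<And>n. is_ideal R (I n) \<and> M' \<subseteq> I n \<and> I n \<subseteq> M" "decseq I"
  obtains n where "\<And>m. m \<ge> n \<Longrightarrow> I m = I n"
  using assms unfolding stabilising_def by meson

lemma stabilising_refl: "stabilising R M M"
  unfolding stabilising_def by (metis subset_antisym)

text \<open>Finite length is inherited by extensions: a descending chain is intersected with
  \<open>M1\<close> and added to \<open>M1\<close>. Once both derived chains are constant, so is the
  original, by the modular law.\<close>

lemma stabilising_trans:
  assumes R: "is_subring R" and M1: "is_ideal R M1" and M: "is_ideal R M" and sub: "M' \<subseteq> M1" "M1 \<subseteq> M"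
    and s: "stabilising R M' M1" "stabilising R M1 M"
  shows "stabilising R M' M"
  unfolding stabilising_def
proof (intro allI impI)
  fix I :: "nat \<Rightarrow> 'a set"
  assume I: "\<forall>n. is_ideal R (I n) \<and> M' \<subseteq> I n \<and> I n \<subseteq> M" and dec: "decseq I"
  have "0 \<in> M1" using M1 ideal_zero by blast
  have "decseq (\<lambda>n. I n \<inter> M1)" using dec by (auto simp: decseq_def)
  moreover have "\<forall>n. is_ideal R (I n \<inter> M1) \<and> M' \<subseteq> I n \<inter> M1 \<and> I n \<inter> M1 \<subseteq> M1"
    using I M1 sub ideal_Int by blast
  ultimately obtain n1 where n1: "\<And>m. m \<ge> n1 \<Longrightarrow> I m \<inter> M1 = I n1 \<inter> M1"
    using s(1) unfolding stabilising_def by meson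
  have "decseq (\<lambda>n. ideal_plus (I n) M1)"
    using dec unfolding decseq_def ideal_plus_def by blast
  moreover have "\<forall>n. is_ideal R (ideal_plus (I n) M1) \<and> M1 \<subseteq> ideal_plus (I n) M1 \<and> ideal_plus (I n) M1 \<subseteq> M"
  proof (intro allI conjI)
    fix n
    show "is_ideal R (ideal_plus (I n) M1)" using ideal_plus_ideal R I M1 by blast
    show "M1 \<subseteq> ideal_plus (I n) M1" using ideal_plus_upper2 ideal_zero I by blast
    show "ideal_plus (I n) M1 \<subseteq> M" using I sub by (auto simp: ideal_plus_def intro!: ideal_add[OF M])
  qed
  ultimately obtain n2 where n2: "\<And>m. m \<ge> n2 \<Longrightarrow> ideal_plus (I m) M1 = ideal_plus (I n2) M1"
    using s(2) unfolding stabilising_def by meson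
  have "I m = I (max n1 n2)" if m: "m \<ge> max n1 n2" for m
  proof -
    have a: "I m \<inter> M1 = I (max n1 n2) \<inter> M1" using n1[of m] n1[of "max n1 n2"] m by simp
    have b: "ideal_plus (I m) M1 = ideal_plus (I (max n1 n2)) M1"
      using n2[of m] n2[of "max n1 n2"] m by simp
    show ?thesis using ideal_modular[OF R _ _ decseqD[OF dec m] a b] I \<open>0 \<in> M1\<close> by blast
  qed
  then show "\<exists>n. \<forall>m\<ge>n. I m = I n" by blast
qed

text \<open>The quotient of the larger ideal by \<open>M\<close> is generated by \<open>g\<close>
  and killed by the maximal ideal, so it is a residue field space of dimension at most one, and only
  two ideals lie between.\<close>

lemma stabilising_simple:
  assumes R: "local_ring R" and m: "max_ideal R = two_gen R u v" and M: "is_ideal R M"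
    and g: "u * g \<in> M" "v * g \<in> M"
  shows "stabilising R M (adjoin_gen R M g)"
  unfolding stabilising_def
proof (intro allI impI)
  fix I :: "nat \<Rightarrow> 'a set"
  assume I: "\<forall>n. is_ideal R (I n) \<and> M \<subseteq> I n \<and> I n \<subseteq> adjoin_gen R M g" and dec: "decseq I"
  note sR = local_subring[OF R]
  have mg: "c * g \<in> M" if c: "c \<in> max_ideal R" for c
  proof -
    obtain r s where "c = r * u + s * v" "r \<in> R" "s \<in> R" using c unfolding m two_gen_def by blast
    then have "c * g = r * (u * g) + s * (v * g)" by (simp add: algebra_simps)
    then show ?thesis using g \<open>r \<in> R\<close> \<open>s \<in> R\<close> ideal_add[OF M] ideal_mult[OF M] by metis
  qed
  have two: "I n = M \<or> I n = adjoin_gen R M g" for n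
  proof (cases "I n = M")
    case False
    then obtain x where x: "x \<in> I n" "x \<notin> M" using I by blast
    then obtain y r where y: "x = y + r * g" "y \<in> M" "r \<in> R" using I unfolding adjoin_gen_def by blast
    have "r \<notin> max_ideal R" using x y mg ideal_add[OF M] by blast
    then have r: "inverse r \<in> R" "r \<noteq> 0" using inverse_in y by blast+
    have iI: "is_ideal R (I n)" using I by blast
    have "r * g \<in> I n" using ideal_diff[OF sR iI x(1), of y] y I by auto
    then have "inverse r * (r * g) \<in> I n" using r ideal_mult[OF iI] by blast
    then have "g \<in> I n" using r by (simp add: mult.assoc[symmetric])
    then have "adjoin_gen R M g \<subseteq> I n"
      using I iI unfolding adjoin_gen_def by (auto intro!: ideal_add[OF iI] ideal_mult[OF iI])
    then show ?thesis using I by blast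
  qed simp
  show "\<exists>n. \<forall>m\<ge>n. I m = I n"
  proof (cases "\<exists>n k. n \<le> k \<and> I n \<noteq> I k")
    case True
    then obtain n k where nk: "n \<le> k" "I n \<noteq> I k" by blast
    have "I m = I k" if "m \<ge> k" for m
    proof (rule ccontr)
      assume "I m \<noteq> I k"
      then have "I m = I n" using two[of m] two[of n] two[of k] nk by metis
      then show False using decseqD[OF dec nk(1)] decseqD[OF dec that] nk by blast
    qed
    then show ?thesis by blast
  qed auto
qed

text \<open>The way from \<open>R\<close> down to \<open>I\<close> passes through monomials:
  \<open>N i\<close> is \<open>I\<close> with \<open>u ^ i\<close> added, and between
  \<open>N i\<close> and \<open>N (Suc i)\<close> lie the ideals \<open>N2 i j\<close>, in which
  \<open>u ^ i * v ^ j\<close> is added to \<open>N (Suc i)\<close>. Each step loses one monomial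
  that both \<open>u\<close> and \<open>v\<close> push into the smaller ideal, so it is simple or
  trivial.\<close>

lemma stabilising_top:
  assumes R: "local_ring R" and m: "max_ideal R = two_gen R u v" and I: "is_ideal R I"
    and uv: "u ^ k \<in> I" "v ^ k \<in> I"
  shows "stabilising R I R"
proof -
  note sR = local_subring[OF R]
  have uvR: "u \<in> R" "v \<in> R" using m two_gen_self[OF sR] max_ideal_subset by blast+
  define N where "N i = adjoin_gen R I (u ^ i)" for i
  define N2 where "N2 i j = adjoin_gen R (N (Suc i)) (u ^ i * v ^ j)" for i j
  have idN: "is_ideal R (N i)" for i
    unfolding N_def using adjoin_gen_ideal[OF sR I] subring_power[OF sR] uvR by blast
  have idN2: "is_ideal R (N2 i j)" for i j
    unfolding N2_def using adjoin_gen_ideal[OF sR idN] subring_power[OF sR] subring_mult[OF sR] uvR by blast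
  have IN: "I \<subseteq> N i" for i unfolding N_def by (rule adjoin_gen_upper[OF sR])
  have uN: "u ^ i \<in> N i" for i unfolding N_def using adjoin_gen_self[OF sR ideal_zero[OF I]] .
  have least: "adjoin_gen R J x \<subseteq> K" if "is_ideal R K" "J \<subseteq> K" "x \<in> K" for J K x
    using that by (auto simp: adjoin_gen_def intro!: ideal_add[OF that(1)] ideal_mult[OF that(1)])
  have up: "N (Suc i) \<subseteq> N2 i j" "u ^ i * v ^ j \<in> N2 i j" for i j
    unfolding N2_def using adjoin_gen_upper[OF sR] adjoin_gen_self[OF sR ideal_zero[OF idN]] by blast+
  have step: "stabilising R (N2 i (Suc j)) (N2 i j) \<and> N2 i (Suc j) \<subseteq> N2 i j" for i j
  proof -
    have "u ^ i * v ^ Suc j = v * (u ^ i * v ^ j)" by simp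
    then have "u ^ i * v ^ Suc j \<in> N2 i j" using up(2) ideal_mult[OF idN2] uvR by metis
    then have sub: "N2 i (Suc j) \<subseteq> N2 i j"
      using least[OF idN2 up(1)] unfolding N2_def[of i "Suc j"] by blast
    have g: "v * (u ^ i * v ^ j) \<in> N2 i (Suc j)" using up(2)[of i "Suc j"] by (simp add: algebra_simps)
    have "v ^ j * u ^ Suc i \<in> N2 i (Suc j)"
      using subsetD[OF up(1) uN] subring_power[OF sR uvR(2)] by (rule ideal_mult[OF idN2, rotated])
    then have g': "u * (u ^ i * v ^ j) \<in> N2 i (Suc j)" by (simp add: algebra_simps)
    have "N2 i j \<subseteq> adjoin_gen R (N2 i (Suc j)) (u ^ i * v ^ j)"
      unfolding N2_def[of i j] using up(1)[of i "Suc j"] by (auto simp: adjoin_gen_def)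
    moreover have "adjoin_gen R (N2 i (Suc j)) (u ^ i * v ^ j) \<subseteq> N2 i j"
      using least[OF idN2 sub up(2)] .
    ultimately have "adjoin_gen R (N2 i (Suc j)) (u ^ i * v ^ j) = N2 i j" by blast
    then show ?thesis using stabilising_simple[OF R m idN2 g' g] sub by simp
  qed
  have "stabilising R (N2 i j) (N2 i 0) \<and> N2 i j \<subseteq> N2 i 0" for i j
  proof (induction j)
    case 0
    show ?case using stabilising_refl by blast
  next
    case (Suc j)
    then show ?case using step[of i j] stabilising_trans[OF sR idN2 idN2] by blast
  qed
  moreover have "N2 i k = N (Suc i)" for i
  proof -
    have "u ^ i * v ^ k \<in> N (Suc i)"
      using subsetD[OF IN uv(2)] subring_power[OF sR uvR(1)] by (rule ideal_mult[OF idN, rotated])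
    then show ?thesis using least[OF idN order_refl, of "u ^ i * v ^ k" "Suc i"] up(1)
      unfolding N2_def by blast
  qed
  moreover have "N2 i 0 = N i" for i
  proof -
    have "u ^ Suc i \<in> N i" using uN[of i] ideal_mult[OF idN] uvR by simp
    then have "N (Suc i) \<subseteq> N i" using least[OF idN IN] unfolding N_def[of "Suc i"] by blast
    then have "N2 i 0 \<subseteq> N i" using least[OF idN, of "N (Suc i)" i "u ^ i * v ^ 0"] uN[of i]
      unfolding N2_def by simp
    moreover have "N i \<subseteq> N2 i 0"
      using least[OF idN2, of I i 0 "u ^ i"] IN[of "Suc i"] up(1)[of i 0] up(2)[of i 0]
      unfolding N_def[of i] by auto
    ultimately show ?thesis by blast
  qed
  ultimately have stepN: "stabilising R (N (Suc i)) (N i) \<and> N (Suc i) \<subseteq> N i" for i by metis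
  have "stabilising R (N i) (N 0) \<and> N i \<subseteq> N 0" for i
  proof (induction i)
    case 0
    show ?case using stabilising_refl by blast
  next
    case (Suc i)
    then show ?case using stepN[of i] stabilising_trans[OF sR idN idN] by blast
  qed
  moreover have "N k = I" using least[OF I order_refl uv(1)] IN[of k] unfolding N_def by blast
  moreover have "N 0 = R"
  proof -
    have "x \<in> N 0" if "x \<in> R" for x using ideal_mult[OF idN that uN[of 0]] by simp
    then show ?thesis using ideal_subset[OF idN] by blast
  qed
  ultimately show ?thesis by metis
qed

text \<open>Krull's principal ideal theorem, in the form that a ring with a principal ideal primary to its
  maximal ideal has dimension at most one.\<close>

lemma power_in_multiples:
  assumes R: "local_ring R" "noetherian R" and m: "max_ideal R = two_gen R u v"
    and b: "b \<in> max_ideal R" "u ^ k \<in> multiples R b" "v ^ k \<in> multiples R b"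
    and d: "d \<in> R" "d \<noteq> 0"
  shows "\<exists>n. b ^ n \<in> multiples R d"
proof -
  note sR = local_subring[OF R(1)]
  have bR: "b \<in> R" using b max_ideal_subset by blast
  \<comment> \<open>\<open>J n\<close> is the saturation of \<open>d ^ n R\<close> by the powers of
    \<open>b\<close>. The aim is \<open>J n = J (Suc n)\<close> for some \<open>n\<close>.\<close>
  define J where "J n = {x \<in> R. \<exists>k. b ^ k * x \<in> multiples R (d ^ n)}" for n
  have pid: "is_ideal R (multiples R (d ^ n))" for n using multiples_ideal[OF sR] subring_power[OF sR] d by blast
  have idJ: "is_ideal R (J n)" for n
    unfolding is_ideal_def
  proof (intro conjI ballI)
    show "J n \<subseteq> R" by (auto simp: J_def)
    show "0 \<in> J n" using ideal_zero[OF pid] subring_zero[OF sR] by (auto simp: J_def)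
    fix x assume "x \<in> J n"
    then obtain k1 where x: "x \<in> R" "b ^ k1 * x \<in> multiples R (d ^ n)" by (auto simp: J_def)
    {
      fix y assume "y \<in> J n"
      then obtain k2 where y: "y \<in> R" "b ^ k2 * y \<in> multiples R (d ^ n)" by (auto simp: J_def)
      have "b ^ (k1 + k2) * (x + y) = b ^ k2 * (b ^ k1 * x) + b ^ k1 * (b ^ k2 * y)"
        by (simp add: algebra_simps power_add)
      also have "\<dots> \<in> multiples R (d ^ n)"
        using x(2) y(2) subring_power[OF sR bR] by (intro ideal_add[OF pid] ideal_mult[OF pid _ x(2)] ideal_mult[OF pid _ y(2)])
      finally show "x + y \<in> J n" using x y subring_add[OF sR] by (auto simp: J_def)
    next
      fix r assume r: "r \<in> R"
      have "r * (b ^ k1 * x) \<in> multiples R (d ^ n)" using x r ideal_mult[OF pid] by blast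
      then have "b ^ k1 * (r * x) \<in> multiples R (d ^ n)" by (simp add: algebra_simps)
      then show "r * x \<in> J n" using x r subring_mult[OF sR] by (auto simp: J_def)
    }
  qed
  have decJ: "J (Suc n) \<subseteq> J n" for n
  proof
    fix x assume "x \<in> J (Suc n)"
    then obtain k r where x: "x \<in> R" "b ^ k * x = d ^ Suc n * r" "r \<in> R"
      by (auto simp: J_def multiples_def)
    then have "b ^ k * x = d ^ n * (d * r)" by simp
    then have "b ^ k * x \<in> multiples R (d ^ n)"
      using d x subring_mult[OF sR] unfolding multiples_def by blast
    then show "x \<in> J n" using x(1) unfolding J_def by blast
  qed
  let ?K = "\<lambda>n. ideal_plus (J n) (multiples R b)"
  have idb: "is_ideal R (multiples R b)" using multiples_ideal[OF sR bR] .
  have dec: "decseq ?K" using decJ by (intro decseq_SucI) (auto simp: ideal_plus_def)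
  have mid: "is_ideal R (?K n) \<and> multiples R b \<subseteq> ?K n \<and> ?K n \<subseteq> R" for n
  proof -
    have "is_ideal R (?K n)" using ideal_plus_ideal[OF sR idJ idb] .
    then show ?thesis using ideal_plus_upper2[OF ideal_zero[OF idJ]] ideal_subset by blast
  qed
  have stab: "stabilising R (multiples R b) R" using stabilising_top[OF R(1) m idb b(2,3)] .
  obtain n where "\<And>m. m \<ge> n \<Longrightarrow> ?K m = ?K n"
    using stabilising_decseq[OF stab mid dec] by blast
  from this[of "Suc n"] have n: "?K (Suc n) = ?K n" by simp
  \<comment> \<open>Finite length modulo \<open>b\<close> gives equality only up to
    \<open>b R\<close>. Saturation improves the error term \<open>b * c\<close> to one with
    \<open>c\<close> in \<open>J n\<close> itself, and the descent removes it.\<close>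
  have "J n \<subseteq> J (Suc n)"
  proof (rule local_descent[OF R idJ _ b(1)])
    show "J n \<subseteq> R" by (auto simp: J_def)
    fix x assume x: "x \<in> J n"
    then have "x \<in> ?K (Suc n)" using n ideal_plus_upper1[OF ideal_zero[OF idb]] by blast
    then obtain e c where e: "x = e + b * c" "e \<in> J (Suc n)" "c \<in> R"
      by (auto simp: ideal_plus_def multiples_def)
    then have "b * c \<in> J n" using ideal_diff[OF sR idJ x, of e] decJ by auto
    then obtain k where "b ^ k * (b * c) \<in> multiples R (d ^ n)" by (auto simp: J_def)
    then have "b ^ Suc k * c \<in> multiples R (d ^ n)" by (simp add: algebra_simps)
    then have "c \<in> J n" using e unfolding J_def by blast
    then show "\<exists>y\<in>J n. x - b * y \<in> J (Suc n)" using e by (intro bexI[of _ c]) auto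
  qed
  moreover have "d ^ n \<in> J n"
  proof -
    have "b ^ 0 * d ^ n \<in> multiples R (d ^ n)" using multiples_self[OF sR] by simp
    then show ?thesis unfolding J_def using subring_power[OF sR d(1)] by blast
  qed
  ultimately have "d ^ n \<in> J (Suc n)" by blast
  \<comment> \<open>Cancelling \<open>d ^ n\<close> leaves a power of \<open>b\<close> divisible by
    \<open>d\<close>.\<close>
  then obtain k r where "b ^ k * d ^ n = d ^ Suc n * r" "r \<in> R"
    unfolding J_def multiples_def by blast
  then have "b ^ k = d * r" using d(2) by simp
  then show ?thesis using \<open>r \<in> R\<close> by (auto simp: multiples_def)
qed

text \<open>The finiteness statement behind the Krull--Akizuki theorem.\<close>

lemma overring_acc:
  assumes R: "local_ring R" "noetherian R" and m: "max_ideal R = two_gen R u v"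
    and b: "b \<in> max_ideal R" "u ^ k \<in> multiples R b" "v ^ k \<in> multiples R b" "b \<noteq> 0"
    and F: "quotient_field_is_UNIV R"
    and S: "is_subring S" "R \<subseteq> S"
    and K: "\<And>n. is_ideal S (K n)" "\<And>n. b \<in> K n" "incseq K"
  shows "\<exists>n. K (Suc n) = K n"
proof -
  note sR = local_subring[OF R(1)]
  have bR: "b \<in> R" using b max_ideal_subset by blast
  have bS: "b \<in> S" using bR S by blast
  have scale: "is_ideal R {x \<in> R. \<exists>s\<in>A. x = b ^ n * s}" if A: "is_ideal S A" for A n
    unfolding is_ideal_def
  proof (intro conjI ballI)
    let ?X = "{x \<in> R. \<exists>s\<in>A. x = b ^ n * s}"
    show "?X \<subseteq> R" by auto
    show "0 \<in> ?X" using subring_zero[OF sR] ideal_zero[OF A] by force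
    fix x assume "x \<in> ?X"
    then obtain s where x: "x \<in> R" "s \<in> A" "x = b ^ n * s" by blast
    {
      fix y assume "y \<in> ?X"
      then obtain s' where y: "y \<in> R" "s' \<in> A" "y = b ^ n * s'" by blast
      have "x + y = b ^ n * (s + s')" using x y by (simp add: algebra_simps)
      then show "x + y \<in> ?X" using x(1,2) y(1,2) subring_add[OF sR] ideal_add[OF A] by blast
    next
      fix r assume r: "r \<in> R"
      have "r * x = b ^ n * (r * s)" using x by (simp add: algebra_simps)
      then show "r * x \<in> ?X" using x(1,2) r S subring_mult[OF sR] ideal_mult[OF A] by blast
    }
  qed
  \<comment> \<open>The trace of \<open>b ^ n S\<close> on \<open>R\<close>. Modulo
    \<open>b R\<close> these traces become constant from some \<open>n0\<close> on, which bounds the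
    denominators needed modulo \<open>b S\<close>.\<close>
  define J where "J n = {x \<in> R. \<exists>s\<in>S. x = b ^ n * s}" for n
  have idJ: "is_ideal R (J n)" for n unfolding J_def using scale ideal_top[OF S(1)] .
  let ?L = "\<lambda>n. ideal_plus (J n) (multiples R b)"
  have idb: "is_ideal R (multiples R b)" using multiples_ideal[OF sR bR] .
  have "J (Suc n) \<subseteq> J n" for n
  proof
    fix x assume "x \<in> J (Suc n)"
    then obtain s where "x \<in> R" "s \<in> S" "x = b ^ Suc n * s" by (auto simp: J_def)
    then have "x = b ^ n * (b * s)" by simp
    then show "x \<in> J n" using \<open>x \<in> R\<close> \<open>s \<in> S\<close> bS subring_mult[OF S(1)] unfolding J_def by blast
  qed
  then have dec: "decseq ?L" by (intro decseq_SucI) (auto simp: ideal_plus_def)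
  have mid: "is_ideal R (?L n) \<and> multiples R b \<subseteq> ?L n \<and> ?L n \<subseteq> R" for n
  proof -
    have "is_ideal R (?L n)" using ideal_plus_ideal[OF sR idJ idb] .
    then show ?thesis using ideal_plus_upper2[OF ideal_zero[OF idJ]] ideal_subset by blast
  qed
  have stab: "stabilising R (multiples R b) R" using stabilising_top[OF R(1) m idb b(2,3)] .
  obtain n0 where n0: "\<And>m. m \<ge> n0 \<Longrightarrow> ?L m = ?L n0"
    using stabilising_decseq[OF stab mid dec] by blast
  \<comment> \<open>A denominator \<open>b ^ (n0 + M)\<close> is lowered one power at a time, at the
    cost of changing \<open>s\<close> by an element of \<open>b S\<close>.\<close>
  have reduce: "s \<in> S \<Longrightarrow> b ^ (n0 + M) * s \<in> R \<Longrightarrow> \<exists>s'\<in>S. b ^ n0 * (s - b * s') \<in> R" for M s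
  proof (induction M arbitrary: s)
    case 0
    then show ?case using subring_zero[OF S(1)] by (intro bexI[of _ 0]) auto
  next
    case (Suc M)
    let ?x = "b ^ (n0 + Suc M) * s"
    have "?x \<in> J (n0 + Suc M)" using Suc.prems unfolding J_def by blast
    then have "?x \<in> ?L (n0 + Suc M)" using ideal_plus_upper1[OF ideal_zero[OF idb]] by blast
    then have "?x \<in> ?L (Suc (n0 + Suc M))" using n0[of "n0 + Suc M"] n0[of "Suc (n0 + Suc M)"] by simp
    then obtain s1 t where st: "?x = b ^ Suc (n0 + Suc M) * s1 + b * t" "s1 \<in> S" "t \<in> R"
      by (auto simp: ideal_plus_def multiples_def J_def)
    then have "b * (b ^ (n0 + M) * (s - b * s1)) = b * t" by (simp add: algebra_simps)
    then have "b ^ (n0 + M) * (s - b * s1) \<in> R" using b(4) st by simp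
    moreover have "s - b * s1 \<in> S" using Suc.prems st bS S by (auto intro!: subring_closed)
    ultimately obtain s2 where s2: "s2 \<in> S" "b ^ n0 * (s - b * s1 - b * s2) \<in> R" using Suc.IH by blast
    then have "b ^ n0 * (s - b * (s1 + s2)) \<in> R" by (simp add: algebra_simps)
    then show ?case using st s2 subring_add[OF S(1)] by blast
  qed
  \<comment> \<open>Every element of \<open>S\<close> has a power of \<open>b\<close> as denominator
    over \<open>R\<close>, so \<open>S\<close> equals its part in \<open>R / b ^ n0\<close> plus
    \<open>b S\<close>.\<close>
  have red: "\<exists>s'\<in>S. b ^ n0 * (s - b * s') \<in> R" if "s \<in> S" for s
  proof -
    obtain c d where cd: "c \<in> R" "d \<in> R" "d \<noteq> 0" "s = c / d"
      using F unfolding quotient_field_is_UNIV_def by blast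
    obtain M e where e: "b ^ M = d * e" "e \<in> R"
      using power_in_multiples[OF R m b(1-3) cd(2,3)] by (auto simp: multiples_def)
    have "b ^ (n0 + M) * s = b ^ n0 * (c * e)" using e cd by (simp add: power_add)
    then have "b ^ (n0 + M) * s \<in> R" using cd e bR by (auto intro!: subring_intros sR)
    then show ?thesis using reduce that by blast
  qed
  \<comment> \<open>Each \<open>K n\<close> contains \<open>b S\<close>, so by the previous
    reduction it is determined by this trace, and the traces form a chain in the noetherian ring
    \<open>R\<close>.\<close>
  define I where "I n = {x \<in> R. \<exists>s\<in>K n. x = b ^ n0 * s}" for n
  have "is_ideal R (I n)" for n unfolding I_def using scale K by blast
  moreover have "incseq I" using K(3) by (auto simp: incseq_def I_def)
  ultimately obtain n where "\<forall>m\<ge>n. I m = I n" using noetherian_acc[OF sR R(2)] by blast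
  then have n: "I (Suc n) = I n" by (metis le_SucI order_refl)
  have "K (Suc n) \<subseteq> K n"
  proof
    fix s assume s: "s \<in> K (Suc n)"
    then have "s \<in> S" using K(1) ideal_subset by blast
    then obtain s' where s': "s' \<in> S" "b ^ n0 * (s - b * s') \<in> R" using red by blast
    have bs: "b * s' \<in> K m" for m using K(1,2) s' ideal_mult_right by blast
    have "s - b * s' \<in> K (Suc n)" using ideal_diff[OF S(1) K(1) s bs] .
    then have "b ^ n0 * (s - b * s') \<in> I (Suc n)" using s' by (auto simp: I_def)
    then obtain s3 where "s3 \<in> K n" "b ^ n0 * (s - b * s') = b ^ n0 * s3" unfolding n by (auto simp: I_def)
    then have "s - b * s' \<in> K n" using b(4) by simp
    then have "(s - b * s') + b * s' \<in> K n" using bs ideal_add[OF K(1)] by blast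
    then show "s \<in> K n" by simp
  qed
  then show ?thesis using K(3) by (auto simp: incseq_Suc_iff)
qed

subsection \<open>Simple extensions and localisations\<close>

definition polys :: "'a::field set \<Rightarrow> 'a poly set" where
  "polys A = {p. \<forall>i. coeff p i \<in> A}"

definition adjoin :: "'a::field set \<Rightarrow> 'a \<Rightarrow> 'a set" where
  "adjoin R z = {poly p z | p. p \<in> polys R}"

lemma polys_zero: "0 \<in> A \<Longrightarrow> 0 \<in> polys A"
  by (simp add: polys_def)

lemma polys_pCons: "pCons a p \<in> polys A \<longleftrightarrow> a \<in> A \<and> p \<in> polys A"
proof
  assume "pCons a p \<in> polys A"
  then have "coeff (pCons a p) i \<in> A" for i by (simp add: polys_def)
  from this[of 0] this[of "Suc _"] show "a \<in> A \<and> p \<in> polys A" by (simp add: polys_def)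
next
  assume "a \<in> A \<and> p \<in> polys A"
  then show "pCons a p \<in> polys A" by (auto simp: polys_def coeff_pCons split: nat.split)
qed

lemma polys_monom: "0 \<in> A \<Longrightarrow> a \<in> A \<Longrightarrow> monom a n \<in> polys A"
  by (simp add: polys_def)

lemma polys_closed:
  assumes "is_subring R"
  shows polys_one: "1 \<in> polys R"
    and polys_add: "\<lbrakk>p \<in> polys R; q \<in> polys R\<rbrakk> \<Longrightarrow> p + q \<in> polys R"
    and polys_diff: "\<lbrakk>p \<in> polys R; q \<in> polys R\<rbrakk> \<Longrightarrow> p - q \<in> polys R"
    and polys_mult: "\<lbrakk>p \<in> polys R; q \<in> polys R\<rbrakk> \<Longrightarrow> p * q \<in> polys R"
    and polys_smult: "\<lbrakk>a \<in> R; q \<in> polys R\<rbrakk> \<Longrightarrow> smult a q \<in> polys R"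
  using assms
  by (auto simp: polys_def subring_closed coeff_mult coeff_1 intro!: subring_sum subring_mult)

lemma polys_ideal:
  assumes "is_subring R" "is_ideal R I"
  shows polys_ideal_add: "\<lbrakk>p \<in> polys I; q \<in> polys I\<rbrakk> \<Longrightarrow> p + q \<in> polys I"
    and polys_ideal_mult: "\<lbrakk>p \<in> polys R; q \<in> polys I\<rbrakk> \<Longrightarrow> p * q \<in> polys I"
  using assms
  by (auto simp: polys_def coeff_mult ideal_add ideal_diff ideal_mult intro!: ideal_sum[OF assms(2)])

lemma polys_mono: "A \<subseteq> B \<Longrightarrow> polys A \<subseteq> polys B"
  by (auto simp: polys_def)

lemma poly_in_adjoin: "p \<in> polys R \<Longrightarrow> poly p z \<in> adjoin R z"
  by (auto simp: adjoin_def)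

lemma adjoin_subring:
  assumes "is_subring R"
  shows "is_subring (adjoin R z)"
  unfolding is_subring_def
proof (intro conjI ballI)
  show "0 \<in> adjoin R z" using poly_in_adjoin[OF polys_zero[OF subring_zero[OF assms]], of z] by simp
  show "1 \<in> adjoin R z" using poly_in_adjoin[OF polys_one[OF assms], of z] by simp
  fix x y assume "x \<in> adjoin R z" "y \<in> adjoin R z"
  then obtain p q where pq: "x = poly p z" "y = poly q z" "p \<in> polys R" "q \<in> polys R"
    by (auto simp: adjoin_def)
  show "x + y \<in> adjoin R z" using poly_in_adjoin[OF polys_add[OF assms pq(3,4)], of z] pq by simp
  show "x - y \<in> adjoin R z" using poly_in_adjoin[OF polys_diff[OF assms pq(3,4)], of z] pq by simp
  show "x * y \<in> adjoin R z" using poly_in_adjoin[OF polys_mult[OF assms pq(3,4)], of z] pq by simp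
qed

lemma adjoin_superset: assumes "is_subring R" shows "R \<subseteq> adjoin R z" "z \<in> adjoin R z"
proof -
  note r = subring_zero[OF assms] subring_one[OF assms]
  show "R \<subseteq> adjoin R z"
  proof
    fix x assume "x \<in> R"
    then show "x \<in> adjoin R z" using poly_in_adjoin[of "[:x:]" R z] r by (simp add: polys_pCons polys_zero)
  qed
  show "z \<in> adjoin R z" using poly_in_adjoin[of "[:0, 1:]" R z] r by (simp add: polys_pCons polys_zero)
qed

lemma poly_in_overring:
  assumes "is_subring S" "p \<in> polys S" "z \<in> S"
  shows "poly p z \<in> S"
  using assms(2) by (induction p) (auto simp: assms polys_pCons subring_closed)

lemma adjoin_least: "is_subring S \<Longrightarrow> R \<subseteq> S \<Longrightarrow> z \<in> S \<Longrightarrow> adjoin R z \<subseteq> S"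
  using polys_mono[of R S] by (auto simp: adjoin_def intro!: poly_in_overring)

text \<open>Hilbert's basis theorem, run on polynomial representatives because an element of
  \<open>adjoin R z\<close> may have several. \<open>L I n\<close> collects the coefficients at
  \<open>n\<close> of representatives of degree at most \<open>n\<close>; allowing smaller degree
  makes it an ideal.\<close>

lemma noetherian_adjoin:
  assumes R: "is_subring R" "noetherian R"
  shows "noetherian (adjoin R z)"
proof -
  let ?A = "adjoin R z"
  note sA = adjoin_subring[OF R(1), of z]
  note R0 = subring_zero[OF R(1)]
  define L where "L I n = {coeff p n | p. p \<in> polys R \<and> degree p \<le> n \<and> poly p z \<in> I}" for I n
  have L_ideal: "is_ideal R (L I n)" if I: "is_ideal ?A I" for I n
    unfolding is_ideal_def
  proof (intro conjI ballI)
    show "L I n \<subseteq> R" by (auto simp: L_def polys_def)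
    show "0 \<in> L I n" unfolding L_def using ideal_zero[OF I] R0
      by (intro CollectI exI[of _ 0]) (auto simp: polys_zero)
    fix x assume "x \<in> L I n"
    then obtain p where p: "x = coeff p n" "p \<in> polys R" "degree p \<le> n" "poly p z \<in> I" by (auto simp: L_def)
    {
      fix y assume "y \<in> L I n"
      then obtain q where q: "y = coeff q n" "q \<in> polys R" "degree q \<le> n" "poly q z \<in> I" by (auto simp: L_def)
      show "x + y \<in> L I n" unfolding L_def using p q
        by (intro CollectI exI[of _ "p + q"])
          (auto simp: polys_add[OF R(1)] ideal_add[OF I] degree_add_le)
    next
      fix r assume r: "r \<in> R"
      then have "r \<in> ?A" using adjoin_superset[OF R(1)] by blast
      then show "r * x \<in> L I n" unfolding L_def using p r
        by (intro CollectI exI[of _ "smult r p"])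
          (auto simp: polys_smult[OF R(1)] ideal_mult[OF I] intro: order_trans[OF degree_smult_le])
    }
  qed
  have L_mono: "incseq (L I)" if I: "is_ideal ?A I" for I
  proof (intro incseq_SucI subsetI)
    fix n x assume "x \<in> L I n"
    then obtain p where p: "x = coeff p n" "p \<in> polys R" "degree p \<le> n" "poly p z \<in> I" by (auto simp: L_def)
    show "x \<in> L I (Suc n)" unfolding L_def using p R0 ideal_mult[OF I adjoin_superset(2)[OF R(1)] p(4)]
      by (intro CollectI exI[of _ "pCons 0 p"]) (auto simp: polys_pCons)
  qed
  show ?thesis unfolding noetherian_iff[OF sA]
  proof (intro allI impI)
    fix I assume I: "is_ideal ?A I"
    obtain N where N: "\<And>m. m \<ge> N \<Longrightarrow> L I m = L I N"
      using noetherian_acc[OF R L_ideal[OF I] L_mono[OF I]] by blast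
    have "\<exists>G. finite G \<and> G \<subseteq> L I n \<and> (\<forall>K. is_ideal R K \<longrightarrow> G \<subseteq> K \<longrightarrow> L I n \<subseteq> K)" for n
      using noetherian_iff[OF R(1)] R(2) L_ideal[OF I] by blast
    then obtain C where C: "\<And>n. finite (C n)" "\<And>n. C n \<subseteq> L I n"
      "\<And>n K. is_ideal R K \<Longrightarrow> C n \<subseteq> K \<Longrightarrow> L I n \<subseteq> K" by metis
    have "\<exists>p. c = coeff p n \<and> p \<in> polys R \<and> degree p \<le> n \<and> poly p z \<in> I" if "c \<in> C n" for c n
      using subsetD[OF C(2) that] by (auto simp: L_def)
    then obtain P where P: "\<And>c n. c \<in> C n \<Longrightarrow> c = coeff (P c n) n \<and> P c n \<in> polys R \<and>
        degree (P c n) \<le> n \<and> poly (P c n) z \<in> I" by metis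
    define G where "G = (\<Union>n\<le>N. (\<lambda>c. poly (P c n) z) ` C n)"
    have "finite G" using C(1) by (auto simp: G_def)
    moreover have "G \<subseteq> I" using P by (auto simp: G_def)
    moreover have "I \<subseteq> K" if K: "is_ideal ?A K" "G \<subseteq> K" for K
    proof -
      \<comment> \<open>The chain is compared for \<open>I\<close> and \<open>I \<inter> K\<close>
        instead of \<open>I\<close> and \<open>K\<close>, so that a polynomial matching a leading
        coefficient can be subtracted without leaving \<open>I\<close>.\<close>
      have IK: "is_ideal ?A (I \<inter> K)" using ideal_Int[OF I K(1)] .
      have low: "L I n \<subseteq> L (I \<inter> K) n" if "n \<le> N" for n
      proof (rule C(3)[OF L_ideal[OF IK]], rule subsetI)
        fix c assume c: "c \<in> C n"
        then have "poly (P c n) z \<in> I \<inter> K" using K(2) that P unfolding G_def by blast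
        then show "c \<in> L (I \<inter> K) n" unfolding L_def using P[OF c] by blast
      qed
      have sub: "L I n \<subseteq> L (I \<inter> K) n" for n
      proof (cases "n \<le> N")
        case False
        then have "L I n = L I N" using N[of n] by linarith
        moreover have "L (I \<inter> K) N \<subseteq> L (I \<inter> K) n"
          using incseqD[OF L_mono[OF IK], of N n] False by linarith
        ultimately show ?thesis using low[of N] by blast
      qed (use low in blast)
      have "degree p < n \<Longrightarrow> p \<in> polys R \<Longrightarrow> poly p z \<in> I \<Longrightarrow> poly p z \<in> K" for p n
      proof (induction n arbitrary: p)
        case (Suc n)
        have "coeff p n \<in> L I n" unfolding L_def using Suc.prems by auto
        then obtain q where q: "coeff p n = coeff q n" "q \<in> polys R" "degree q \<le> n" "poly q z \<in> I" "poly q z \<in> K"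
          using sub[of n] by (auto simp: L_def)
        have deg: "degree (p - q) \<le> n" using Suc.prems q by (intro degree_diff_le) auto
        have pq: "p - q \<in> polys R" "poly (p - q) z \<in> I"
          using Suc.prems q polys_diff[OF R(1)] ideal_diff[OF sA I] by auto
        have "poly (p - q) z \<in> K"
        proof (cases "p - q = 0")
          case True
          then show ?thesis using ideal_zero[OF K(1)] by simp
        next
          case False
          then have "degree (p - q) \<noteq> n" using q(1) by (metis coeff_diff eq_iff_diff_eq_0 leading_coeff_0_iff)
          then show ?thesis using Suc.IH[OF _ pq] deg by simp
        qed
        then show ?case using q(5) ideal_add[OF K(1), of "poly (p - q) z" "poly q z"] by simp
      qed simp
      then show ?thesis using ideal_subset[OF I] unfolding adjoin_def by blast
    qed
    ultimately show "\<exists>G. finite G \<and> G \<subseteq> I \<and> (\<forall>K. is_ideal ?A K \<longrightarrow> G \<subseteq> K \<longrightarrow> I \<subseteq> K)" by blast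
  qed
qed

section \<open>Localisation at a prime ideal\<close>

definition localise :: "'a::field set \<Rightarrow> 'a set \<Rightarrow> 'a set" where
  "localise A P = {x / y | x y. x \<in> A \<and> y \<in> A \<and> y \<notin> P}"

lemma localise_cases:
  assumes "is_prime_ideal A P" "c \<in> localise A P"
  obtains x y where "c = x / y" "x \<in> A" "y \<in> A" "y \<notin> P" "y \<noteq> 0"
  using assms ideal_zero[OF prime_ideal_ideal[OF assms(1)]] unfolding localise_def by blast

lemma localise_superset:
  assumes "is_subring A" "is_prime_ideal A P"
  shows "A \<subseteq> localise A P"
proof
  fix x assume "x \<in> A"
  moreover have "x = x / 1" by simp
  ultimately show "x \<in> localise A P"
    unfolding localise_def using subring_one[OF assms(1)] prime_ideal_one[OF assms(2)] by blast
qed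

lemma localise_subring:
  assumes A: "is_subring A" and P: "is_prime_ideal A P"
  shows "is_subring (localise A P)"
  unfolding is_subring_def[of "localise A P"]
proof (intro conjI ballI)
  show "0 \<in> localise A P" "1 \<in> localise A P"
    using localise_superset[OF A P] subring_zero[OF A] subring_one[OF A] by blast+
  fix c d assume c: "c \<in> localise A P" and d: "d \<in> localise A P"
  obtain x y where xy: "c = x / y" "x \<in> A" "y \<in> A" "y \<notin> P" "y \<noteq> 0" using localise_cases[OF P c] .
  obtain z t where zt: "d = z / t" "z \<in> A" "t \<in> A" "t \<notin> P" "t \<noteq> 0" using localise_cases[OF P d] .
  have yt: "y * t \<in> A" "y * t \<notin> P"
    using xy zt subring_mult[OF A] prime_ideal_disj[OF P] by blast+
  have "c + d = (x * t + z * y) / (y * t)" "c - d = (x * t - z * y) / (y * t)" "c * d = (x * z) / (y * t)"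
    using xy zt by (auto simp: field_simps)
  moreover have "x * t + z * y \<in> A" "x * t - z * y \<in> A" "x * z \<in> A"
    using xy zt A by (auto intro!: subring_closed)
  ultimately show "c + d \<in> localise A P" "c - d \<in> localise A P" "c * d \<in> localise A P"
    using yt unfolding localise_def by blast+
qed

lemma max_ideal_localise:
  assumes A: "is_subring A" and P: "is_prime_ideal A P"
  shows "max_ideal (localise A P) = {x / y | x y. x \<in> P \<and> y \<in> A \<and> y \<notin> P}"
proof (intro equalityI subsetI)
  note iP = prime_ideal_ideal[OF P]
  fix c assume c: "c \<in> max_ideal (localise A P)"
  then obtain x y where xy: "c = x / y" "x \<in> A" "y \<in> A" "y \<notin> P" "y \<noteq> 0"
    using localise_cases[OF P, of c] max_ideal_subset by blast
  have "x \<in> P"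
  proof (rule ccontr)
    assume "x \<notin> P"
    then have "c \<noteq> 0" using xy ideal_zero[OF iP] by auto
    have "inverse c = y / x" using xy by simp
    then have "inverse c \<in> localise A P" using xy \<open>x \<notin> P\<close> unfolding localise_def by blast
    then show False using c \<open>c \<noteq> 0\<close> not_in_max_ideal by blast
  qed
  then show "c \<in> {x / y | x y. x \<in> P \<and> y \<in> A \<and> y \<notin> P}" using xy by blast
next
  note iP = prime_ideal_ideal[OF P]
  fix c assume "c \<in> {x / y | x y. x \<in> P \<and> y \<in> A \<and> y \<notin> P}"
  then obtain x y where xy: "c = x / y" "x \<in> P" "y \<in> A" "y \<notin> P" by blast
  have c: "c \<in> localise A P" using xy ideal_subset[OF iP] unfolding localise_def by blast
  have "y \<noteq> 0" using xy ideal_zero[OF iP] by blast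
  have "inverse c \<notin> localise A P" if "c \<noteq> 0"
  proof
    assume "inverse c \<in> localise A P"
    then obtain z t where zt: "inverse c = z / t" "z \<in> A" "t \<in> A" "t \<notin> P" "t \<noteq> 0"
      using localise_cases[OF P] by metis
    have "(x / y) * (z / t) = 1" using xy(1) zt(1) \<open>c \<noteq> 0\<close> by (metis right_inverse)
    then have "y * t = z * x" using \<open>y \<noteq> 0\<close> zt(5) by (simp add: field_simps)
    then show False using prime_ideal_disj[OF P, of y t] xy zt ideal_mult[OF iP] by metis
  qed
  then show "c \<in> max_ideal (localise A P)" using c by (auto simp: max_ideal_def)
qed

lemma localise_local:
  assumes A: "is_subring A" and P: "is_prime_ideal A P"
  shows "local_ring (localise A P)"
  unfolding local_ring_def
proof
  note iP = prime_ideal_ideal[OF P]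
  show sub: "is_subring (localise A P)" using localise_subring[OF A P] .
  show "is_ideal (localise A P) (max_ideal (localise A P))"
    unfolding is_ideal_def
  proof (intro conjI ballI)
    let ?M = "max_ideal (localise A P)"
    show "?M \<subseteq> localise A P" by (rule max_ideal_subset)
    show "0 \<in> ?M" using subring_zero[OF sub] by (simp add: max_ideal_def)
    fix c assume "c \<in> ?M"
    then obtain x y where xy: "c = x / y" "x \<in> P" "y \<in> A" "y \<notin> P"
      using max_ideal_localise[OF A P] by auto
    then have "y \<noteq> 0" using ideal_zero[OF iP] by blast
    {
      fix d assume "d \<in> ?M"
      then obtain z t where zt: "d = z / t" "z \<in> P" "t \<in> A" "t \<notin> P"
        using max_ideal_localise[OF A P] by auto
      then have "t \<noteq> 0" using ideal_zero[OF iP] by blast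
      have "c + d = (x * t + z * y) / (y * t)" using xy zt \<open>y \<noteq> 0\<close> \<open>t \<noteq> 0\<close> by (simp add: field_simps)
      moreover have "x * t + z * y \<in> P"
        using xy zt by (intro ideal_add[OF iP] ideal_mult_right[OF iP])
      moreover have "y * t \<in> A" "y * t \<notin> P"
        using xy zt subring_mult[OF A] prime_ideal_disj[OF P] by blast+
      ultimately show "c + d \<in> ?M" unfolding max_ideal_localise[OF A P] by blast
    next
      fix r assume "r \<in> localise A P"
      then obtain z t where zt: "r = z / t" "z \<in> A" "t \<in> A" "t \<notin> P" "t \<noteq> 0" using localise_cases[OF P] by metis
      have "r * c = (z * x) / (t * y)" using xy zt by simp
      moreover have "z * x \<in> P" using xy zt ideal_mult[OF iP] by blast
      moreover have "t * y \<in> A" "t * y \<notin> P"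
        using xy zt subring_mult[OF A] prime_ideal_disj[OF P] by blast+
      ultimately show "r * c \<in> ?M" unfolding max_ideal_localise[OF A P] by blast
    }
  qed
qed

lemma noetherian_localise:
  assumes A: "is_subring A" "noetherian A" and P: "is_prime_ideal A P"
  shows "noetherian (localise A P)"
  unfolding noetherian_iff[OF localise_subring[OF A(1) P]]
proof (intro allI impI)
  let ?L = "localise A P"
  note AL = localise_superset[OF A(1) P]
  fix I assume I: "is_ideal ?L I"
  have restrict: "is_ideal A (K \<inter> A)" if K: "is_ideal ?L K" for K
    unfolding is_ideal_def
    using ideal_zero[OF K] subring_zero[OF A(1)] ideal_add[OF K] subring_add[OF A(1)]
      ideal_mult[OF K] subring_mult[OF A(1)] AL by auto
  obtain G where G: "finite G" "G \<subseteq> I \<inter> A" "\<And>K. is_ideal A K \<Longrightarrow> G \<subseteq> K \<Longrightarrow> I \<inter> A \<subseteq> K"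
    using noetherian_iff[OF A(1)] A(2) restrict[OF I] by meson
  have "I \<subseteq> K" if K: "is_ideal ?L K" "G \<subseteq> K" for K
  proof
    fix c assume c: "c \<in> I"
    then obtain x y where xy: "c = x / y" "x \<in> A" "y \<in> A" "y \<notin> P" "y \<noteq> 0"
      using localise_cases[OF P, of c] ideal_subset[OF I] by blast
    have "y * c \<in> I" using ideal_mult[OF I _ c] xy AL by blast
    then have "x \<in> I \<inter> A" using xy by simp
    then have "x \<in> K" using G(3)[OF restrict[OF K(1)]] G(2) K(2) by blast
    moreover have "1 / y \<in> ?L" using xy subring_one[OF A(1)] unfolding localise_def by blast
    ultimately have "1 / y * x \<in> K" using ideal_mult[OF K(1)] by blast
    then show "c \<in> K" using xy by simp
  qed
  then show "\<exists>G. finite G \<and> G \<subseteq> I \<and> (\<forall>K. is_ideal ?L K \<longrightarrow> G \<subseteq> K \<longrightarrow> I \<subseteq> K)" using G by blast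
qed

section \<open>Residual transcendence and Gauss extensions\<close>

lemma polys_max_prime:
  assumes R: "local_ring R" and fg: "f \<in> polys R" "g \<in> polys R" "f * g \<in> polys (max_ideal R)"
  shows "f \<in> polys (max_ideal R) \<or> g \<in> polys (max_ideal R)"
proof (rule ccontr)
  let ?m = "max_ideal R"
  note im = local_max_ideal[OF R] and sR = local_subring[OF R]
  assume "\<not> ?thesis"
  then have ex: "\<exists>i. coeff f i \<notin> ?m" "\<exists>j. coeff g j \<notin> ?m" by (auto simp: polys_def)
  \<comment> \<open>As in Gauss's lemma, the first coefficients outside the maximal ideal are
    multiplied; every other contribution to the coefficient at \<open>i + j\<close> lies
    inside.\<close>
  define i where "i = (LEAST i. coeff f i \<notin> ?m)"
  define j where "j = (LEAST j. coeff g j \<notin> ?m)"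
  have i: "coeff f i \<notin> ?m" "\<And>k. k < i \<Longrightarrow> coeff f k \<in> ?m"
    unfolding i_def using LeastI_ex[OF ex(1)] not_less_Least by blast+
  have j: "coeff g j \<notin> ?m" "\<And>k. k < j \<Longrightarrow> coeff g k \<in> ?m"
    unfolding j_def using LeastI_ex[OF ex(2)] not_less_Least by blast+
  have c: "coeff f k \<in> R" "coeff g k \<in> R" for k using fg by (auto simp: polys_def)
  have "coeff (f * g) (i + j) = coeff f i * coeff g j + (\<Sum>k\<in>{..i+j}-{i}. coeff f k * coeff g (i + j - k))"
    unfolding coeff_mult by (subst sum.remove[of _ i]) auto
  moreover have "(\<Sum>k\<in>{..i+j}-{i}. coeff f k * coeff g (i + j - k)) \<in> ?m"
  proof (rule ideal_sum[OF im])
    fix k assume "k \<in> {..i+j} - {i}"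
    then consider "k < i" | "i + j - k < j" by fastforce
    then show "coeff f k * coeff g (i + j - k) \<in> ?m"
      using i(2) j(2) c ideal_mult[OF im] ideal_mult_right[OF im] by cases blast+
  qed
  moreover have "coeff (f * g) (i + j) \<in> ?m" using fg(3) by (auto simp: polys_def)
  ultimately have "coeff f i * coeff g j \<in> ?m" using ideal_diff[OF sR im] by (metis add_diff_cancel_right')
  then show False using max_ideal_prime[OF R c(1) c(2)] i(1) j(1) by blast
qed

lemma monic_notin_polys_max:
  assumes "is_subring R" "lead_coeff f = 1"
  shows "f \<notin> polys (max_ideal R)"
  using assms(2) one_notin_max_ideal[OF subring_one[OF assms(1)]]
  unfolding polys_def by (metis (mono_tags, lifting) mem_Collect_eq)

text \<open>Equivalently, \<open>m R[z]\<close> is prime and the residue of \<open>z\<close> modulo it is transcendental over \<open>R / m\<close>.\<close>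

definition residually_transcendental :: "'a::field set \<Rightarrow> 'a \<Rightarrow> bool" where
  "residually_transcendental R z \<longleftrightarrow>
     (\<forall>p\<in>polys R. poly p z = 0 \<longrightarrow> p \<in> polys (max_ideal R))"

definition extended_max :: "'a::field set \<Rightarrow> 'a \<Rightarrow> 'a set" where
  "extended_max R z = {poly p z | p. p \<in> polys (max_ideal R)}"

text \<open>This is an image of the Nagata ring \<open>R(X)\<close>. For \<open>D\<close> regular
  and \<open>z = v / u\<close> it is the order valuation ring of \<open>D\<close>.\<close>

definition gauss :: "'a::field set \<Rightarrow> 'a \<Rightarrow> 'a set" where
  "gauss R z = localise (adjoin R z) (extended_max R z)"

text \<open>Representatives of one value differ by a polynomial vanishing at \<open>z\<close>, whose
  coefficients are nonunits by residual transcendence; so any representative decides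
  membership.\<close>

lemma extended_max_iff:
  assumes R: "local_ring R" and z: "residually_transcendental R z" and p: "p \<in> polys R"
  shows "poly p z \<in> extended_max R z \<longleftrightarrow> p \<in> polys (max_ideal R)"
proof
  assume "poly p z \<in> extended_max R z"
  then obtain q where q: "poly p z = poly q z" "q \<in> polys (max_ideal R)" by (auto simp: extended_max_def)
  have "q \<in> polys R" using q polys_mono[OF max_ideal_subset] by blast
  then have "p - q \<in> polys (max_ideal R)"
    using z q p polys_diff[OF local_subring[OF R]] by (auto simp: residually_transcendental_def)
  then have "p - q + q \<in> polys (max_ideal R)"
    using q polys_ideal_add[OF local_subring[OF R] local_max_ideal[OF R]] by blast
  then show "p \<in> polys (max_ideal R)" by simp
qed (auto simp: extended_max_def)

lemma extended_max_prime:
  assumes R: "local_ring R" and z: "residually_transcendental R z"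
  shows "is_prime_ideal (adjoin R z) (extended_max R z)"
  unfolding is_prime_ideal_def is_ideal_def
proof (intro conjI ballI impI)
  let ?m = "max_ideal R"
  note im = local_max_ideal[OF R] and sR = local_subring[OF R]
  show "extended_max R z \<subseteq> adjoin R z"
    unfolding extended_max_def adjoin_def using polys_mono[OF max_ideal_subset[of R]] by blast
  show "0 \<in> extended_max R z"
    using polys_zero[OF ideal_zero[OF im]] by (auto simp: extended_max_def intro: exI[of _ 0])
  have "1 \<notin> polys ?m" using monic_notin_polys_max[OF sR] by simp
  then have "1 \<notin> extended_max R z" using extended_max_iff[OF R z polys_one[OF sR]] by simp
  then show "extended_max R z \<noteq> adjoin R z" using subring_one[OF adjoin_subring[OF sR]] by blast
  {
    fix x y assume "x \<in> extended_max R z" "y \<in> extended_max R z"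
    then obtain p q where "x = poly p z" "y = poly q z" "p \<in> polys ?m" "q \<in> polys ?m"
      by (auto simp: extended_max_def)
    then have "x + y = poly (p + q) z" "p + q \<in> polys ?m" using polys_ideal_add[OF sR im] by auto
    then show "x + y \<in> extended_max R z" unfolding extended_max_def by blast
  next
    fix x y assume "x \<in> adjoin R z" "y \<in> extended_max R z"
    then obtain p q where "x = poly p z" "y = poly q z" "p \<in> polys R" "q \<in> polys ?m"
      by (auto simp: extended_max_def adjoin_def)
    then have "x * y = poly (p * q) z" "p * q \<in> polys ?m" using polys_ideal_mult[OF sR im] by auto
    then show "x * y \<in> extended_max R z" unfolding extended_max_def by blast
  next
    fix x y assume xy: "x \<in> adjoin R z" "y \<in> adjoin R z" "x * y \<in> extended_max R z"
    then obtain p q where pq: "x = poly p z" "y = poly q z" "p \<in> polys R" "q \<in> polys R"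
      by (auto simp: adjoin_def)
    then have "poly (p * q) z \<in> extended_max R z" using xy by simp
    then have "p * q \<in> polys ?m" using extended_max_iff[OF R z] polys_mult[OF sR] pq by blast
    then show "x \<in> extended_max R z \<or> y \<in> extended_max R z"
      using polys_max_prime[OF R] pq by (auto simp: extended_max_def)
  }
qed

lemma gauss_superset:
  assumes "local_ring R" "residually_transcendental R z"
  shows "adjoin R z \<subseteq> gauss R z" "R \<subseteq> gauss R z" "z \<in> gauss R z"
  using localise_superset[OF adjoin_subring extended_max_prime] adjoin_superset[of R z]
    assms local_subring[OF assms(1)] unfolding gauss_def by blast+

lemma gauss_local:
  assumes "local_ring R" "residually_transcendental R z"
  shows "local_ring (gauss R z)"
  unfolding gauss_def
  using localise_local[OF adjoin_subring[OF local_subring] extended_max_prime] assms by blast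

lemma gauss_noetherian:
  assumes "local_ring R" "noetherian R" "residually_transcendental R z"
  shows "noetherian (gauss R z)"
  unfolding gauss_def
  using noetherian_localise[OF adjoin_subring noetherian_adjoin extended_max_prime]
    assms local_subring by blast

lemma gauss_cases:
  assumes R: "local_ring R" "residually_transcendental R z" and "c \<in> gauss R z"
  obtains f g where "c = poly f z / poly g z" "f \<in> polys R" "g \<in> polys R" "g \<notin> polys (max_ideal R)" "poly g z \<noteq> 0"
proof -
  obtain x y where xy: "c = x / y" "x \<in> adjoin R z" "y \<in> adjoin R z" "y \<notin> extended_max R z" "y \<noteq> 0"
    using localise_cases[OF extended_max_prime[OF R]] assms(3) unfolding gauss_def by metis
  then obtain f g where "x = poly f z" "y = poly g z" "f \<in> polys R" "g \<in> polys R" by (auto simp: adjoin_def)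
  then show thesis using that xy extended_max_iff[OF R] by blast
qed

lemma gauss_intro:
  assumes R: "local_ring R" "residually_transcendental R z"
    and "f \<in> polys R" "g \<in> polys R" "g \<notin> polys (max_ideal R)"
  shows "poly f z / poly g z \<in> gauss R z"
  unfolding gauss_def localise_def using assms extended_max_iff[OF R] poly_in_adjoin by blast

lemma max_ideal_gauss_inter:
  assumes R: "local_ring R" "residually_transcendental R z" and x: "x \<in> adjoin R z"
  shows "x \<in> max_ideal (gauss R z) \<longleftrightarrow> x \<in> extended_max R z"
proof -
  note P = extended_max_prime[OF R] and A = adjoin_subring[OF local_subring[OF R(1)], of z]
  note iP = prime_ideal_ideal[OF P]
  show ?thesis
  proof
    assume "x \<in> max_ideal (gauss R z)"
    then obtain a y where ay: "x = a / y" "a \<in> extended_max R z" "y \<in> adjoin R z" "y \<notin> extended_max R z"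
      unfolding gauss_def max_ideal_localise[OF A P] by blast
    then have "y \<noteq> 0" using ideal_zero[OF iP] by blast
    then have "x * y = a" using ay by simp
    then show "x \<in> extended_max R z" using prime_ideal_disj[OF P x ay(3)] ay by blast
  next
    assume "x \<in> extended_max R z"
    moreover have "x = x / 1" by simp
    ultimately show "x \<in> max_ideal (gauss R z)"
      unfolding gauss_def max_ideal_localise[OF A P] using subring_one[OF A] prime_ideal_one[OF P] by blast
  qed
qed

lemma max_ideal_gauss_poly:
  assumes R: "local_ring R" "residually_transcendental R z" and p: "p \<in> polys R"
  shows "poly p z \<in> max_ideal (gauss R z) \<longleftrightarrow> p \<in> polys (max_ideal R)"
  using max_ideal_gauss_inter[OF R poly_in_adjoin[OF p]] extended_max_iff[OF R p] by simp

lemma max_ideal_gauss_base: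
  assumes R: "local_ring R" "residually_transcendental R z" and x: "x \<in> R"
  shows "x \<in> max_ideal (gauss R z) \<longleftrightarrow> x \<in> max_ideal R"
proof -
  have "[:x:] \<in> polys R" using x subring_zero[OF local_subring[OF R(1)]] by (simp add: polys_pCons polys_zero)
  then show ?thesis using max_ideal_gauss_poly[OF R, of "[:x:]"] ideal_zero[OF local_max_ideal[OF R(1)]]
    by (simp add: polys_pCons polys_zero)
qed

lemma polys_two_gen:
  assumes R: "is_subring R" and "p \<in> polys (two_gen R u v)"
  shows "\<exists>r\<in>polys R. \<exists>s\<in>polys R. p = smult u r + smult v s"
  using assms(2)
proof (induction p)
  case 0
  then show ?case using polys_zero[OF subring_zero[OF R]] by (intro bexI[of _ 0]) auto
next
  case (pCons a p)
  then obtain r s where rs: "r \<in> polys R" "s \<in> polys R" "p = smult u r + smult v s" by (auto simp: polys_pCons)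
  have "a \<in> two_gen R u v" using pCons.prems by (simp add: polys_pCons)
  then obtain b c where "a = b * u + c * v" "b \<in> R" "c \<in> R" by (auto simp: two_gen_def)
  then show ?case using rs
    by (intro bexI[of _ "pCons b r"] bexI[of _ "pCons c s"]) (auto simp: polys_pCons algebra_simps)
qed

lemma extended_max_two_gen:
  assumes R: "local_ring R" and m: "max_ideal R = two_gen R u v"
  shows "extended_max R z = two_gen (adjoin R z) u v"
proof (intro equalityI subsetI)
  note sR = local_subring[OF R]
  fix x assume "x \<in> extended_max R z"
  then obtain p where p: "x = poly p z" "p \<in> polys (two_gen R u v)" by (auto simp: extended_max_def m)
  obtain r s where "r \<in> polys R" "s \<in> polys R" "p = smult u r + smult v s"
    using polys_two_gen[OF sR p(2)] by blast
  then have "x = poly r z * u + poly s z * v" using p by simp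
  then show "x \<in> two_gen (adjoin R z) u v"
    using \<open>r \<in> polys R\<close> \<open>s \<in> polys R\<close> poly_in_adjoin unfolding two_gen_def by blast
next
  note sR = local_subring[OF R]
  fix x assume "x \<in> two_gen (adjoin R z) u v"
  then obtain r s where x: "x = poly r z * u + poly s z * v" "r \<in> polys R" "s \<in> polys R"
    by (auto simp: two_gen_def adjoin_def)
  have "u \<in> max_ideal R" "v \<in> max_ideal R" using two_gen_self[OF sR] m by auto
  then have "[:u:] \<in> polys (max_ideal R)" "[:v:] \<in> polys (max_ideal R)"
    using ideal_zero[OF local_max_ideal[OF R]] by (auto simp: polys_pCons polys_zero)
  then have "r * [:u:] + s * [:v:] \<in> polys (max_ideal R)"
    using x polys_ideal_mult[OF sR local_max_ideal[OF R]] polys_ideal_add[OF sR local_max_ideal[OF R]] by blast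
  moreover have "x = poly (r * [:u:] + s * [:v:]) z" using x by simp
  ultimately show "x \<in> extended_max R z" unfolding extended_max_def by blast
qed

lemma max_ideal_gauss:
  assumes R: "local_ring R" "residually_transcendental R z" and m: "max_ideal R = two_gen R u v"
  shows "max_ideal (gauss R z) = two_gen (gauss R z) u v"
proof
  note P = extended_max_prime[OF R] and A = adjoin_subring[OF local_subring[OF R(1)], of z]
  note sR = local_subring[OF R(1)]
  show "max_ideal (gauss R z) \<subseteq> two_gen (gauss R z) u v"
  proof
    fix x assume "x \<in> max_ideal (gauss R z)"
    then obtain a y where ay: "x = a / y" "a \<in> extended_max R z" "y \<in> adjoin R z" "y \<notin> extended_max R z"
      unfolding gauss_def max_ideal_localise[OF A P] by blast
    then obtain r s where rs: "a = r * u + s * v" "r \<in> adjoin R z" "s \<in> adjoin R z"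
      using extended_max_two_gen[OF R(1) m] by (auto simp: two_gen_def)
    have "x = r / y * u + s / y * v" using rs ay by (simp add: add_divide_distrib)
    moreover have "r / y \<in> gauss R z" "s / y \<in> gauss R z"
      unfolding gauss_def localise_def using rs ay by blast+
    ultimately show "x \<in> two_gen (gauss R z) u v" unfolding two_gen_def by blast
  qed
  have "u \<in> max_ideal R" "v \<in> max_ideal R" using two_gen_self[OF sR] m by auto
  then have "u \<in> max_ideal (gauss R z)" "v \<in> max_ideal (gauss R z)"
    using max_ideal_gauss_base[OF R] max_ideal_subset by blast+
  then show "two_gen (gauss R z) u v \<subseteq> max_ideal (gauss R z)"
    using two_gen_least[OF local_max_ideal[OF gauss_local[OF R]]] by blast
qed

text \<open>Clearing denominators in a relation for \<open>a / b\<close> shows that \<open>b\<close>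
  divides the top coefficient times a power of \<open>a\<close>, hence the top coefficient. A
  multiple of \<open>b X - a\<close> then removes it, and the degree drops.\<close>

lemma residually_transcendental_quotient:
  assumes R: "local_ring R" and ab: "a \<in> max_ideal R" "b \<in> max_ideal R" "b \<noteq> 0"
    and cop: "nonzerodivisor_mod R b a"
  shows "residually_transcendental R (a / b)"
proof -
  let ?m = "max_ideal R" and ?z = "a / b"
  note im = local_max_ideal[OF R] and sR = local_subring[OF R]
  have abR: "a \<in> R" "b \<in> R" using ab max_ideal_subset by blast+
  have "degree p < n \<Longrightarrow> p \<in> polys R \<Longrightarrow> poly p ?z = 0 \<Longrightarrow> p \<in> polys ?m" for p n
  proof (induction n arbitrary: p)
    case (Suc n)
    have pR: "coeff p i \<in> R" for i using Suc.prems by (auto simp: polys_def)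
    show ?case
    proof (cases n)
      case 0
      then obtain c where "p = [:c:]" using Suc.prems(1) by (auto elim: degree_eq_zeroE)
      then have "p = 0" using Suc.prems(3) by simp
      then show ?thesis using polys_zero[OF ideal_zero[OF im]] by simp
    next
      case (Suc k)
      have "poly p ?z = (\<Sum>i\<le>n. coeff p i * ?z ^ i)"
        unfolding poly_altdef using Suc.prems(1)
        by (intro sum.mono_neutral_left) (auto simp: coeff_eq_0)
      also have "\<dots> = (\<Sum>i<n. coeff p i * ?z ^ i) + coeff p n * ?z ^ n"
        by (simp add: lessThan_Suc_atMost[symmetric])
      finally have "coeff p n * ?z ^ n * b ^ n = - (\<Sum>i<n. coeff p i * ?z ^ i) * b ^ n"
        using Suc.prems(3) by (simp add: eq_neg_iff_add_eq_0 add.commute flip: distrib_right)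
      also have "\<dots> = b * - (\<Sum>i<n. coeff p i * (?z ^ i * b ^ k))"
        using Suc by (simp add: sum_distrib_left sum_distrib_right algebra_simps)
      also have "(\<Sum>i<n. coeff p i * (?z ^ i * b ^ k)) = (\<Sum>i<n. coeff p i * (a ^ i * b ^ (k - i)))"
      proof (rule sum.cong[OF refl])
        fix i assume "i \<in> {..<n}"
        then have "b ^ k = b ^ i * b ^ (k - i)" using Suc by (simp flip: power_add)
        then show "coeff p i * (?z ^ i * b ^ k) = coeff p i * (a ^ i * b ^ (k - i))"
          using ab(3) by (simp add: power_divide)
      qed
      finally have "coeff p n * a ^ n = b * - (\<Sum>i<n. coeff p i * (a ^ i * b ^ (k - i)))"
        using ab(3) by (simp add: power_divide)
      moreover have "- (\<Sum>i<n. coeff p i * (a ^ i * b ^ (k - i))) \<in> R"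
        using pR abR by (intro subring_uminus[OF sR] subring_sum[OF sR] subring_mult[OF sR] subring_power[OF sR]) auto
      ultimately have "coeff p n * a ^ n \<in> multiples R b" unfolding multiples_def by blast
      then have "coeff p n \<in> multiples R b" using nonzerodivisor_mod_power[OF sR abR(1) cop pR] by blast
      then obtain e where e: "coeff p n = b * e" "e \<in> R" by (auto simp: multiples_def)
      \<comment> \<open>This polynomial vanishes at \<open>a / b\<close>, has all coefficients in
        the maximal ideal and agrees with \<open>p\<close> in degree
        \<open>n = k + 1\<close>.\<close>
      define q where "q = monom e k * [:-a, b:]"
      have qm: "q \<in> polys ?m"
      proof -
        have "[:-a, b:] \<in> polys ?m"
          using ab ideal_uminus[OF sR im] ideal_zero[OF im] by (auto simp: polys_pCons polys_zero)
        then show ?thesis unfolding q_def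
          using polys_monom[OF subring_zero[OF sR] e(2)] polys_ideal_mult[OF sR im] by blast
      qed
      have q0: "poly q ?z = 0" using ab(3) by (simp add: q_def)
      have qn: "coeff q n = b * e" using Suc by (simp add: q_def coeff_monom_mult)
      have "degree q \<le> n"
        unfolding q_def using Suc degree_mult_le[of "monom e k" "[:-a, b:]"] degree_monom_le[of e k]
        by (auto intro: order_trans)
      then have deg: "degree (p - q) \<le> n" using Suc.prems(1) by (intro degree_diff_le) auto
      have pq: "p - q \<in> polys R"
        using Suc.prems qm polys_mono[OF max_ideal_subset[of R]] polys_diff[OF sR] by blast
      have "p - q \<in> polys ?m"
      proof (cases "p - q = 0")
        case True
        then show ?thesis using polys_zero[OF ideal_zero[OF im]] by simp
      next
        case False
        have "coeff (p - q) n = 0" using e qn by simp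
        then have "degree (p - q) \<noteq> n" using False leading_coeff_0_iff by metis
        then show ?thesis using Suc.IH[of "p - q"] deg pq Suc.prems(3) q0 by simp
      qed
      then have "p - q + q \<in> polys ?m" using qm polys_ideal_add[OF sR im] by blast
      then show ?thesis by simp
    qed
  qed simp
  then show ?thesis by (auto simp: residually_transcendental_def)
qed

subsection \<open>Discrete valuation rings and two-dimensional regular local rings\<close>

text \<open>An element without such a factorisation is \<open>t\<close> times another one of this
  kind; \<open>local_descent\<close> over the zero ideal forces it to be 0.\<close>

lemma unique_factor_dvr:
  assumes T: "local_ring T" "noetherian T" and m: "max_ideal T = multiples T t"
    and x: "x \<in> T" "x \<noteq> 0"
  shows "\<exists>k c. x = t ^ k * c \<and> c \<in> T \<and> c \<noteq> 0 \<and> inverse c \<in> T"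
proof -
  note sT = local_subring[OF T(1)]
  let ?I = "{x \<in> T. \<nexists>k c. x = t ^ k * c \<and> c \<in> T \<and> c \<noteq> 0 \<and> inverse c \<in> T}"
  have "?I \<subseteq> {0}"
  proof (rule local_descent[OF T ideal_bot[OF sT]])
    show "?I \<subseteq> T" by auto
    show "t \<in> max_ideal T" using m multiples_self[OF sT] by auto
    fix x assume x: "x \<in> ?I"
    have "x \<in> max_ideal T"
    proof (rule ccontr)
      assume "x \<notin> max_ideal T"
      then have "x = t ^ 0 * x \<and> x \<in> T \<and> x \<noteq> 0 \<and> inverse x \<in> T" using x inverse_in by auto
      then show False using x by blast
    qed
    then obtain y where y: "x = t * y" "y \<in> T" using m by (auto simp: multiples_def)
    have "y \<in> ?I"
    proof (rule ccontr)
      assume "y \<notin> ?I"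
      then obtain k c where "y = t ^ k * c" "c \<in> T" "c \<noteq> 0" "inverse c \<in> T" using y by blast
      then have "x = t ^ Suc k * c \<and> c \<in> T \<and> c \<noteq> 0 \<and> inverse c \<in> T" using y by simp
      then show False using x by blast
    qed
    then show "\<exists>y\<in>?I. x - t * y \<in> {0}" using y by (intro bexI[of _ y]) auto
  qed
  then show ?thesis using x by blast
qed

lemma dvr_fraction:
  assumes T: "local_ring T" "noetherian T" and m: "max_ideal T = multiples T t"
    and F: "quotient_field_is_UNIV T" and x: "x \<noteq> 0"
  shows "\<exists>k c. c \<in> T \<and> c \<noteq> 0 \<and> inverse c \<in> T \<and> (x = t ^ k * c \<or> inverse x = t ^ k * c)"
proof -
  note sT = local_subring[OF T(1)]
  obtain a b where ab: "a \<in> T" "b \<in> T" "b \<noteq> 0" "x = a / b"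
    using F unfolding quotient_field_is_UNIV_def by blast
  then have "a \<noteq> 0" using x by auto
  obtain i c where c: "a = t ^ i * c" "c \<in> T" "c \<noteq> 0" "inverse c \<in> T"
    using unique_factor_dvr[OF T m ab(1) \<open>a \<noteq> 0\<close>] by blast
  obtain j d where d: "b = t ^ j * d" "d \<in> T" "d \<noteq> 0" "inverse d \<in> T"
    using unique_factor_dvr[OF T m ab(2,3)] by blast
  have t: "t ^ i \<noteq> 0" "t ^ j \<noteq> 0" using c(1) d(1) ab(3) \<open>a \<noteq> 0\<close> by auto
  have cd: "c * inverse d \<in> T" "inverse (c * inverse d) \<in> T" "d * inverse c \<in> T" "inverse (d * inverse c) \<in> T"
    using c d subring_mult[OF sT] by auto
  show ?thesis
  proof (cases "j \<le> i")
    case True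
    have "t ^ i = t ^ (i - j) * t ^ j" using True by (simp flip: power_add)
    then have "x = t ^ (i - j) * (c * inverse d)"
      unfolding ab(4) c(1) d(1) using t d(3) by (simp add: divide_inverse)
    then show ?thesis using cd c(3) d(3) by (intro exI[of _ "i - j"] exI[of _ "c * inverse d"]) auto
  next
    case False
    have "t ^ j = t ^ (j - i) * t ^ i" using False by (simp flip: power_add)
    then have "inverse x = t ^ (j - i) * (d * inverse c)"
      unfolding ab(4) c(1) d(1) using t c(3) by (simp add: divide_inverse)
    then show ?thesis using cd c(3) d(3) by (intro exI[of _ "j - i"] exI[of _ "d * inverse c"]) auto
  qed
qed

text \<open>An element outside \<open>T\<close> is the inverse of \<open>t ^ k * c\<close> with
  \<open>c\<close> a unit and \<open>k\<close> positive, so adjoining it would make \<open>t\<close>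
  invertible.\<close>

lemma overring_of_dvr:
  assumes T: "local_ring T" "noetherian T" and m: "max_ideal T = multiples T t"
    and F: "quotient_field_is_UNIV T"
    and R: "is_subring R" "T \<subseteq> R" "t \<noteq> 0 \<Longrightarrow> inverse t \<notin> R"
  shows "R = T"
proof
  note sT = local_subring[OF T(1)]
  have tT: "t \<in> T" using m multiples_self[OF sT] max_ideal_subset by blast
  show "R \<subseteq> T"
  proof
    fix x assume x: "x \<in> R"
    show "x \<in> T"
    proof (cases "x = 0")
      case True then show ?thesis using subring_zero[OF sT] by simp
    next
      case False
      then obtain k c where c: "c \<in> T" "c \<noteq> 0" "inverse c \<in> T" "x = t ^ k * c \<or> inverse x = t ^ k * c"
        using dvr_fraction[OF T m F] by blast
      show ?thesis
      proof (cases "x = t ^ k * c")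
        case True then show ?thesis using tT c by (auto intro!: subring_intros sT)
      next
        case nx: False
        then have ix: "inverse x = t ^ k * c" using c by blast
        show ?thesis
        proof (cases k)
          case 0
          then have "x = inverse c" using ix by (metis inverse_inverse_eq mult_1 power_0)
          then show ?thesis using c by simp
        next
          case (Suc l)
          have "t \<noteq> 0" using ix False Suc by auto
          have "x * inverse x = 1" using False by simp
          then have "t * (x * (t ^ l * c)) = 1" unfolding ix Suc by (simp add: algebra_simps)
          then have "inverse t = x * (t ^ l * c)" by (rule inverse_unique)
          moreover have "x * (t ^ l * c) \<in> R"
            using x tT c R(2) by (intro subring_mult[OF R(1)] subring_power[OF R(1)]) auto
          ultimately show ?thesis using R(3) \<open>t \<noteq> 0\<close> by simp
        qed
      qed
    qed
  qed
qed (use R in blast)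

lemma dvr_valuation:
  assumes T: "local_ring T" "noetherian T" and m: "max_ideal T = multiples T t"
    and F: "quotient_field_is_UNIV T"
  shows "valuation_ring T"
  unfolding valuation_ring_def
proof (intro conjI allI impI)
  note sT = local_subring[OF T(1)]
  show "is_subring T" by fact
  have tT: "t \<in> T" using m multiples_self[OF sT] max_ideal_subset by blast
  fix x :: 'a assume "x \<noteq> 0"
  then obtain k c where "c \<in> T" "x = t ^ k * c \<or> inverse x = t ^ k * c"
    using dvr_fraction[OF T m F] by blast
  moreover from this have "t ^ k * c \<in> T" using tT by (auto intro!: subring_intros sT)
  ultimately show "x \<in> T \<or> inverse x \<in> T" by metis
qed

lemma quotient_field_mono: "quotient_field_is_UNIV D \<Longrightarrow> D \<subseteq> E \<Longrightarrow> quotient_field_is_UNIV E"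
  unfolding quotient_field_is_UNIV_def by (meson subsetD)

text \<open>Regular local rings of dimension two, the condition on the dimension being replaced by the last
  two assumptions, which say that \<open>u D\<close> is neither zero nor primary to the maximal ideal.\<close>

locale regular2 =
  fixes D :: "'a::field set" and u v :: 'a
  assumes loc: "local_ring D" and noeth: "noetherian D"
    and max_eq: "max_ideal D = two_gen D u v"
    and u_nonzero: "u \<noteq> 0" and v_power: "v ^ k \<notin> multiples D u"
begin

lemma sub: "is_subring D"
  using local_subring[OF loc] .

lemma im: "is_ideal D (max_ideal D)"
  using local_max_ideal[OF loc] .

lemma params: "u \<in> max_ideal D" "v \<in> max_ideal D" "u \<in> D" "v \<in> D"
  using two_gen_self[OF sub] max_eq max_ideal_subset by blast+

text \<open>The normal form of a nonzero element of the discrete valuation ring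
  \<open>D / u D\<close> with uniformiser \<open>v\<close>, obtained by the descent of
  \<open>unique_factor_dvr\<close> relative to \<open>u D\<close>.\<close>

lemma v_adic:
  assumes "f \<in> D" "f \<notin> multiples D u"
  shows "\<exists>k c e. f = v ^ k * c + u * e \<and> c \<in> D \<and> c \<noteq> 0 \<and> inverse c \<in> D \<and> e \<in> D"
proof -
  let ?I = "{f \<in> D. \<nexists>k c e. f = v ^ k * c + u * e \<and> c \<in> D \<and> c \<noteq> 0 \<and> inverse c \<in> D \<and> e \<in> D}"
  have "?I \<subseteq> multiples D u"
  proof (rule local_descent[OF loc noeth multiples_ideal[OF sub params(3)] _ params(2)])
    show "?I \<subseteq> D" by auto
    fix x assume x: "x \<in> ?I"
    have "x \<in> max_ideal D"
    proof (rule ccontr)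
      assume "x \<notin> max_ideal D"
      then have "x = v ^ 0 * x + u * 0 \<and> x \<in> D \<and> x \<noteq> 0 \<and> inverse x \<in> D \<and> 0 \<in> D"
        using x inverse_in subring_zero[OF sub] by auto
      then show False using x by blast
    qed
    then obtain r s where rs: "x = r * u + s * v" "r \<in> D" "s \<in> D" unfolding max_eq two_gen_def by blast
    have "s \<in> ?I"
    proof (rule ccontr)
      assume "s \<notin> ?I"
      then obtain k c e where "s = v ^ k * c + u * e" "c \<in> D" "c \<noteq> 0" "inverse c \<in> D" "e \<in> D" using rs by blast
      moreover from this have "x = v ^ Suc k * c + u * (r + v * e)" using rs by (simp add: algebra_simps)
      moreover have "r + v * e \<in> D" using rs params \<open>e \<in> D\<close> by (auto intro!: subring_intros sub)
      ultimately show False using x by blast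
    qed
    moreover have "x - v * s \<in> multiples D u" using rs by (auto simp: multiples_def algebra_simps)
    ultimately show "\<exists>y\<in>?I. x - v * y \<in> multiples D u" by blast
  qed
  then show ?thesis using assms by blast
qed

text \<open>Two elements outside \<open>u D\<close> are units times powers of \<open>v\<close>
  modulo \<open>u\<close>. If their product were in \<open>u D\<close>, so would be a power of
  \<open>v\<close>.\<close>

lemma u_prime:
  assumes "f \<in> D" "g \<in> D" "f * g \<in> multiples D u"
  shows "f \<in> multiples D u \<or> g \<in> multiples D u"
proof (rule ccontr)
  assume "\<not> ?thesis"
  then obtain k c e k' c' e' where
    f: "f = v ^ k * c + u * e" "c \<in> D" "c \<noteq> 0" "inverse c \<in> D" "e \<in> D" and
    g: "g = v ^ k' * c' + u * e'" "c' \<in> D" "c' \<noteq> 0" "inverse c' \<in> D" "e' \<in> D"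
    using v_adic assms by meson
  obtain h where h: "f * g = u * h" "h \<in> D" using assms by (auto simp: multiples_def)
  have "v ^ (k + k') * (c * c') = f * g - u * (e * g + v ^ k * c * e')"
    unfolding f(1) g(1) by (simp add: algebra_simps power_add)
  also have "\<dots> = u * (h - (e * g + v ^ k * c * e'))" using h by (simp add: algebra_simps)
  finally have "v ^ (k + k') = u * ((h - (e * g + v ^ k * c * e')) * (inverse c * inverse c'))"
    using f(3) g(3) by (simp add: field_simps)
  moreover have "(h - (e * g + v ^ k * c * e')) * (inverse c * inverse c') \<in> D"
    using f g h assms params by (auto intro!: subring_intros sub)
  ultimately show False using v_power[of "k + k'"] unfolding multiples_def by blast
qed

lemma v_notin: "v \<notin> multiples D u"
  using v_power[of 1] by simp

text \<open>Neither parameter divides the other, since \<open>u D\<close> is prime and does not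
  contain \<open>v\<close>.\<close>

lemma not_valuation: "\<not> valuation_ring D"
proof
  assume V: "valuation_ring D"
  have "v \<noteq> 0" using v_notin subring_zero[OF sub] by (force simp: multiples_def)
  then have "v / u \<noteq> 0" using u_nonzero by simp
  then have "v / u \<in> D \<or> inverse (v / u) \<in> D" using V unfolding valuation_ring_def by blast
  then show False
  proof
    assume "v / u \<in> D"
    then have "u * (v / u) \<in> multiples D u" unfolding multiples_def by blast
    then show False using v_notin u_nonzero by simp
  next
    assume *: "inverse (v / u) \<in> D"
    then have "u = v * inverse (v / u)" using \<open>v \<noteq> 0\<close> by simp
    then have "v * inverse (v / u) \<in> multiples D u" using multiples_self[OF sub] by metis
    then have "inverse (v / u) \<in> multiples D u" using u_prime[OF params(4) *] v_notin by blast
    then obtain r where "r \<in> D" "inverse (v / u) = u * r" by (auto simp: multiples_def)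
    then have "v * r = 1" using u_nonzero \<open>v \<noteq> 0\<close> by (simp add: field_simps)
    then show False using max_ideal_no_inverse[OF params(2) \<open>r \<in> D\<close>] by blast
  qed
qed

text \<open>This takes the place of unique factorisation. If \<open>u\<close> lies in
  \<open>P\<close>, then \<open>P = u D\<close>, as an element outside \<open>u D\<close> would
  bring \<open>v\<close> into \<open>P\<close>. Otherwise an element of least \<open>v\<close>-order
  modulo \<open>u\<close> generates: it clears any \<open>x\<close> in \<open>P\<close> modulo
  \<open>u\<close>, the remainder is divisible by \<open>u\<close> inside \<open>P\<close>, and the
  descent finishes.\<close>

lemma prime_principal:
  assumes P: "is_prime_ideal D P" "P \<noteq> {0}" "P \<noteq> max_ideal D"
  shows "\<exists>\<pi>\<in>D. P = multiples D \<pi>"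
proof -
  note iP = prime_ideal_ideal[OF P(1)]
  have Pm: "P \<subseteq> max_ideal D" using proper_ideal_subset_max[OF iP prime_ideal_one[OF P(1)]] .
  have notboth: "\<not> (u \<in> P \<and> v \<in> P)"
    using two_gen_least[OF iP, of u v] max_eq Pm P(3) by blast
  have uid: "is_ideal D (multiples D u)" using multiples_ideal[OF sub params(3)] .
  show ?thesis
  proof (cases "u \<in> P")
    case True
    have "x \<in> multiples D u" if x: "x \<in> P" for x
    proof (rule ccontr)
      assume "x \<notin> multiples D u"
      then obtain k c e where *: "x = v ^ k * c + u * e" "c \<in> D" "c \<noteq> 0" "inverse c \<in> D" "e \<in> D"
        using v_adic x ideal_subset[OF iP] by blast
      then have "v ^ k = inverse c * x - inverse c * e * u" by (simp add: field_simps)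
      moreover have "inverse c * x - inverse c * e * u \<in> P"
        using * x True by (intro ideal_diff[OF sub iP] ideal_mult[OF iP] subring_mult[OF sub])
      ultimately have "v \<in> P" using prime_ideal_power[OF sub P(1) params(4)] by metis
      then show False using notboth True by blast
    qed
    moreover have "multiples D u \<subseteq> P" using True ideal_mult_right[OF iP] by (auto simp: multiples_def)
    ultimately show ?thesis using params by blast
  next
    case False
    have cancel: "y \<in> P" if "u * y \<in> P" "y \<in> D" for y
      using prime_ideal_disj[OF P(1) params(3)] that False by blast
    \<comment> \<open>Otherwise every element of \<open>P\<close> could be divided by
      \<open>u\<close> inside \<open>P\<close> indefinitely, and \<open>P\<close> would be
      zero.\<close>
    have "\<not> P \<subseteq> multiples D u"
    proof
      assume "P \<subseteq> multiples D u"
      have "P \<subseteq> {0}"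
      proof (rule local_descent[OF loc noeth ideal_bot[OF sub] ideal_subset[OF iP] params(1)])
        fix x assume "x \<in> P"
        then obtain y where "x = u * y" "y \<in> D" using \<open>P \<subseteq> multiples D u\<close> by (auto simp: multiples_def)
        then show "\<exists>y\<in>P. x - u * y \<in> {0}" using cancel \<open>x \<in> P\<close> by (intro bexI[of _ y]) auto
      qed
      then show False using P(2) ideal_zero[OF iP] by blast
    qed
    then obtain f0 where "f0 \<in> P" "f0 \<notin> multiples D u" by blast
    define rep where "rep x k \<longleftrightarrow> (\<exists>c e. x = v ^ k * c + u * e \<and> c \<in> D \<and> c \<noteq> 0 \<and> inverse c \<in> D \<and> e \<in> D)" for x k
    have ex: "\<exists>k. \<exists>f\<in>P. rep f k"
      using v_adic[of f0] \<open>f0 \<in> P\<close> \<open>f0 \<notin> multiples D u\<close> ideal_subset[OF iP] unfolding rep_def by blast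
    define k where "k = (LEAST k. \<exists>f\<in>P. rep f k)"
    obtain f where f: "f \<in> P" "rep f k" using LeastI_ex[OF ex] unfolding k_def by blast
    have least: "k \<le> l" if "x \<in> P" "rep x l" for x l
      unfolding k_def using that by (intro Least_le) blast
    obtain c e where ce: "f = v ^ k * c + u * e" "c \<in> D" "c \<noteq> 0" "inverse c \<in> D" "e \<in> D"
      using f(2) unfolding rep_def by blast
    have fD: "f \<in> D" using f ideal_subset[OF iP] by blast
    have "P \<subseteq> multiples D f"
    proof (rule local_descent[OF loc noeth multiples_ideal[OF sub fD] ideal_subset[OF iP] params(1)])
      fix x assume x: "x \<in> P"
      have "\<exists>r\<in>D. x - f * r \<in> multiples D u"
      proof (cases "x \<in> multiples D u")
        case True then show ?thesis using subring_zero[OF sub] by (intro bexI[of _ 0]) auto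
      next
        case False
        then obtain l c' e' where x': "x = v ^ l * c' + u * e'" "c' \<in> D" "c' \<noteq> 0" "inverse c' \<in> D" "e' \<in> D"
          using v_adic x ideal_subset[OF iP] by blast
        then have "k \<le> l" using least[OF x] unfolding rep_def by blast
        let ?r = "v ^ (l - k) * (c' * inverse c)"
        have "v ^ l = v ^ k * v ^ (l - k)" using \<open>k \<le> l\<close> by (simp flip: power_add)
        then have "x - f * ?r = u * (e' - e * ?r)" unfolding x'(1) ce(1) using ce(3) by (simp add: field_simps)
        moreover have "?r \<in> D" using ce x' params by (auto intro!: subring_intros sub)
        moreover from this have "e' - e * ?r \<in> D" using ce x' by (auto intro!: subring_intros sub)
        ultimately show ?thesis unfolding multiples_def by blast
      qed
      then obtain r y where r: "r \<in> D" "x - f * r = u * y" "y \<in> D" by (auto simp: multiples_def)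
      have "f * r \<in> P" using ideal_mult_right[OF iP r(1) f(1)] .
      then have "y \<in> P" using cancel r ideal_diff[OF sub iP x] by metis
      moreover have "x - u * y = f * r" using r(2) by (simp add: algebra_simps)
      ultimately show "\<exists>y\<in>P. x - u * y \<in> multiples D f" using r(1) by (auto simp: multiples_def)
    qed
    moreover have "multiples D f \<subseteq> P" using f ideal_mult_right[OF iP] by (auto simp: multiples_def)
    ultimately show ?thesis using fD by blast
  qed
qed

lemma nonzerodivisor_mod_uv: "nonzerodivisor_mod D u v"
  unfolding nonzerodivisor_mod_def
proof (intro ballI impI)
  fix c e assume "c \<in> D" "e \<in> D" "c * v = u * e"
  then have "c * v \<in> multiples D u" unfolding multiples_def by blast
  then show "c \<in> multiples D u" using u_prime[OF \<open>c \<in> D\<close> params(4)] v_notin by blast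
qed

text \<open>Regularity is transferred from the parameters. From \<open>c * a = b * e\<close>, both
  \<open>c * u ^ k\<close> and \<open>c * v ^ k\<close> are multiples of \<open>b\<close>; comparing
  them makes \<open>u ^ k\<close> divide the first cofactor, and it cancels.\<close>

lemma coprime_nonzerodivisor_mod:
  assumes ab: "a \<in> D" "b \<in> D" "b \<noteq> 0" "u ^ k \<in> two_gen D a b" "v ^ k \<in> two_gen D a b"
  shows "nonzerodivisor_mod D b a"
  unfolding nonzerodivisor_mod_def
proof (intro ballI impI)
  fix c e assume c: "c \<in> D" "e \<in> D" "c * a = b * e"
  have *: "\<exists>d\<in>D. c * x = b * d" if x: "x \<in> two_gen D a b" for x
  proof -
    obtain r s where rs: "x = r * a + s * b" "r \<in> D" "s \<in> D" using x unfolding two_gen_def by blast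
    then have "c * x = r * (c * a) + b * (s * c)" by (simp add: algebra_simps)
    also have "\<dots> = b * (r * e + s * c)" unfolding c(3) by (simp add: algebra_simps)
    finally show ?thesis using rs c by (intro bexI[of _ "r * e + s * c"]) (auto intro!: subring_intros sub)
  qed
  obtain d d' where d: "c * u ^ k = b * d" "c * v ^ k = b * d'" "d \<in> D" "d' \<in> D"
    using *[OF ab(4)] *[OF ab(5)] by blast
  have "b * (d * v ^ k) = (c * u ^ k) * v ^ k" unfolding d(1) by simp
  also have "\<dots> = (c * v ^ k) * u ^ k" by simp
  also have "\<dots> = b * (d' * u ^ k)" unfolding d(2) by simp
  finally have "d * v ^ k = d' * u ^ k" using ab(3) by simp
  then have "d \<in> multiples D (u ^ k)" 
    using nonzerodivisor_mod_power_power[OF sub params(4,3) u_nonzero nonzerodivisor_mod_uv] d by blast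
  then obtain g where "d = u ^ k * g" "g \<in> D" by (auto simp: multiples_def)
  then have "c = b * g" using d(1) u_nonzero by simp
  then show "c \<in> multiples D b" using \<open>g \<in> D\<close> by (auto simp: multiples_def)
qed

text \<open>Lowest terms: the denominator \<open>b\<close> is chosen with \<open>b D\<close>
  maximal. If no power of \<open>u\<close>, or none of \<open>v\<close>, lay in
  \<open>(a, b)\<close>, a prime avoiding these powers would contain \<open>(a, b)\<close>; being
  principal, it would supply a common factor to cancel.\<close>

lemma coprime_fraction:
  assumes F: "quotient_field_is_UNIV D"
  shows "\<exists>a b k. a \<in> D \<and> b \<in> D \<and> b \<noteq> 0 \<and> z = a / b \<and> u ^ k \<in> two_gen D a b \<and> v ^ k \<in> two_gen D a b"
proof -
  let ?X = "{multiples D b | b. b \<in> D \<and> b \<noteq> 0 \<and> z * b \<in> D}"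
  have "?X \<noteq> {}"
  proof -
    obtain a b where "a \<in> D" "b \<in> D" "b \<noteq> 0" "z = a / b"
      using F unfolding quotient_field_is_UNIV_def by blast
    then have "z * b \<in> D" by simp
    then show ?thesis using \<open>b \<in> D\<close> \<open>b \<noteq> 0\<close> by blast
  qed
  moreover have "is_ideal D I" if "I \<in> ?X" for I using that multiples_ideal[OF sub] by blast
  ultimately obtain I where I: "I \<in> ?X" "\<And>J. J \<in> ?X \<Longrightarrow> I \<subseteq> J \<Longrightarrow> J = I"
    using noetherian_maximal[OF sub noeth, of ?X] by (metis (no_types, lifting))
  then obtain b where b: "I = multiples D b" "b \<in> D" "b \<noteq> 0" "z * b \<in> D" by blast
  let ?a = "z * b" and ?T = "two_gen D (z * b) b"
  have iT: "is_ideal D ?T" using two_gen_ideal[OF sub b(4,2)] .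
  have pow: "\<exists>k. x ^ k \<in> ?T" if x: "x = u \<or> x = v" for x
  proof (rule ccontr)
    assume no: "\<nexists>k. x ^ k \<in> ?T"
    have xm: "x \<in> max_ideal D" "x \<in> D" using x params by auto
    have "1 \<in> range ((^) x)" by (metis power_0 rangeI)
    moreover have "y * y' \<in> range ((^) x)" if "y \<in> range ((^) x)" "y' \<in> range ((^) x)" for y y'
      using that by (auto simp flip: power_add)
    ultimately obtain P where P: "is_prime_ideal D P" "?T \<subseteq> P" "P \<inter> range ((^) x) = {}"
      using exists_prime_ideal[OF sub noeth iT, of "range ((^) x)"] no by blast
    have "x \<notin> P" using P(3) by (metis disjoint_iff power_one_right rangeI)
    then have "P \<noteq> max_ideal D" using xm by blast
    moreover have "b \<in> P" using P(2) two_gen_self[OF sub] by blast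
    ultimately obtain \<pi> where \<pi>: "\<pi> \<in> D" "P = multiples D \<pi>" using prime_principal[OF P(1)] b(3) by blast
    obtain b' where b': "b = \<pi> * b'" "b' \<in> D" using \<open>b \<in> P\<close> \<pi> by (auto simp: multiples_def)
    have "z * b \<in> P" using P(2) two_gen_self[OF sub] by blast
    then obtain a' where a': "z * b = \<pi> * a'" "a' \<in> D" using \<pi> by (auto simp: multiples_def)
    have "\<pi> \<noteq> 0" "b' \<noteq> 0" using b' b(3) by auto
    then have "z * b' = a'" using a' b' by simp
    then have "multiples D b' \<in> ?X" using b' a' \<open>b' \<noteq> 0\<close> by blast
    moreover have "I \<subseteq> multiples D b'"
    proof
      fix y assume "y \<in> I"
      then obtain r where "y = b * r" "r \<in> D" using b by (auto simp: multiples_def)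
      then have "y = b' * (\<pi> * r)" "\<pi> * r \<in> D" using b' \<pi> subring_mult[OF sub] by auto
      then show "y \<in> multiples D b'" unfolding multiples_def by blast
    qed
    ultimately have "b' \<in> multiples D b" using I(2) b(1) multiples_self[OF sub] by blast
    then obtain r where "b' = b * r" "r \<in> D" by (auto simp: multiples_def)
    then have "b' = (\<pi> * b') * r" using b'(1) by simp
    then have "b' * (\<pi> * r) = b' * 1" by (simp add: ac_simps)
    then have "\<pi> * r = 1" using \<open>b' \<noteq> 0\<close> by simp
    then have "1 \<in> P" using \<pi> \<open>r \<in> D\<close> by (force simp: multiples_def)
    then show False using prime_ideal_one[OF P(1)] by blast
  qed
  obtain k l where kl: "u ^ k \<in> ?T" "v ^ l \<in> ?T" using pow by blast
  have "u ^ (k + l) \<in> ?T" "v ^ (k + l) \<in> ?T"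
    using ideal_mult[OF iT subring_power[OF sub params(3), of l] kl(1)]
      ideal_mult[OF iT subring_power[OF sub params(4), of k] kl(2)]
    by (auto simp: power_add mult.commute)
  moreover have "z = z * b / b" using b(3) by simp
  ultimately show ?thesis using b by blast
qed

text \<open>A unit as numerator or denominator of the reduced fraction would put
  \<open>inverse z\<close> or \<open>z\<close> into \<open>D\<close>.\<close>

lemma bad_residually_transcendental:
  assumes F: "quotient_field_is_UNIV D" and z: "z \<notin> D" "inverse z \<notin> D"
  obtains a b k where "a \<in> max_ideal D" "b \<in> max_ideal D" "b \<noteq> 0" "z = a / b"
    "u ^ k \<in> two_gen D a b" "v ^ k \<in> two_gen D a b" "residually_transcendental D z"
    "nonzerodivisor_mod D b a"
proof -
  obtain a b k where ab: "a \<in> D" "b \<in> D" "b \<noteq> 0" "z = a / b" "u ^ k \<in> two_gen D a b" "v ^ k \<in> two_gen D a b"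
    using coprime_fraction[OF F] by blast
  have "b \<in> max_ideal D"
  proof (rule ccontr)
    assume "b \<notin> max_ideal D"
    then have "a * inverse b \<in> D" using ab inverse_in subring_mult[OF sub] by blast
    then show False using z ab by (simp add: field_simps)
  qed
  moreover have "a \<in> max_ideal D"
  proof (rule ccontr)
    assume "a \<notin> max_ideal D"
    then have "b * inverse a \<in> D" using ab inverse_in subring_mult[OF sub] by blast
    then show False using z ab by (simp add: field_simps)
  qed
  moreover have "nonzerodivisor_mod D b a" using coprime_nonzerodivisor_mod[OF ab(1,2,3,5,6)] .
  ultimately show thesis
    using that ab residually_transcendental_quotient[OF loc _ _ ab(3)] by blast
qed

text \<open>The chain through \<open>u D\<close> has length two. In a longer one, two of the primes
  are nested, nonzero and nonmaximal, so both are principal; a generator of the smaller divided by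
  one of the larger falls back into the smaller, which makes the larger contain 1.\<close>

lemma regular_local_dim2: "regular_local_dim2 D"
proof -
  have pu: "is_prime_ideal D (multiples D u)"
    unfolding is_prime_ideal_def
    using multiples_ideal[OF sub params(3)] u_prime v_notin params by blast
  have p0: "is_prime_ideal D {0}"
    unfolding is_prime_ideal_def using ideal_bot[OF sub] subring_one[OF sub] by auto
  have pm: "is_prime_ideal D (max_ideal D)"
    unfolding is_prime_ideal_def
    using im max_ideal_prime[OF loc] subring_one[OF sub] one_notin_max_ideal[of D] by blast
  have "prime_chain D 2"
    unfolding prime_chain_def
  proof (intro exI[of _ "\<lambda>i::nat. if i = 0 then {0} else if i = 1 then multiples D u else max_ideal D"] conjI allI impI)
    fix i :: nat assume "i < 2"
    then consider "i = 0" | "i = 1" by linarith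
    then show "(if i = 0 then {0} else if i = 1 then multiples D u else max_ideal D) \<subset>
        (if Suc i = 0 then {0} else if Suc i = 1 then multiples D u else max_ideal D)"
    proof cases
      case 1
      have "0 \<in> multiples D u" "u \<in> multiples D u"
        using ideal_zero[OF multiples_ideal[OF sub params(3)]] multiples_self[OF sub] by blast+
      then show ?thesis using 1 u_nonzero by auto
    next
      case 2
      have "multiples D u \<subseteq> max_ideal D" using params ideal_mult_right[OF im] by (auto simp: multiples_def)
      then show ?thesis using 2 v_notin params by auto
    qed
  qed (use pu p0 pm in auto)
  moreover have "\<not> prime_chain D (Suc 2)"
  proof
    assume "prime_chain D (Suc 2)"
    then obtain P :: "nat \<Rightarrow> 'a set" where P: "\<And>i. i \<le> 3 \<Longrightarrow> is_prime_ideal D (P i)"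
      "\<And>i. i < 3 \<Longrightarrow> P i \<subset> P (Suc i)" unfolding prime_chain_def by auto
    have c: "P 0 \<subset> P 1" "P 1 \<subset> P 2" "P 2 \<subset> P 3" using P(2)[of 0] P(2)[of 1] P(2)[of 2]
      by (auto simp: numeral_2_eq_2 numeral_3_eq_3)
    have p: "is_prime_ideal D (P i)" "0 \<in> P i" "P i \<subseteq> max_ideal D" if "i \<le> 3" for i
      using P(1)[OF that] ideal_zero[OF prime_ideal_ideal]
        proper_ideal_subset_max[OF prime_ideal_ideal prime_ideal_one] by blast+
    have "P 1 \<noteq> {0}" "P 1 \<noteq> max_ideal D" "P 2 \<noteq> {0}" "P 2 \<noteq> max_ideal D"
      using c p[of 0] p[of 1] p[of 2] p[of 3] by auto
    then obtain x y where x: "x \<in> D" "P 1 = multiples D x" and y: "y \<in> D" "P 2 = multiples D y"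
      using prime_principal[OF p(1)[of 1]] prime_principal[OF p(1)[of 2]] by auto
    have "x \<in> P 2" using c(2) x multiples_self[OF sub] by blast
    then obtain r where r: "x = y * r" "r \<in> D" using y by (auto simp: multiples_def)
    have "y \<notin> P 1"
    proof
      assume "y \<in> P 1"
      then have "multiples D y \<subseteq> P 1"
        using ideal_mult_right[OF prime_ideal_ideal[OF p(1)]] by (auto simp: multiples_def)
      then show False using c(2) y by blast
    qed
    then have "r \<in> P 1" using prime_ideal_disj[OF p(1)[of 1] y(1) r(2)] r x multiples_self[OF sub] by force
    then obtain s where s: "r = x * s" "s \<in> D" using x by (auto simp: multiples_def)
    have "x \<noteq> 0" using x \<open>P 1 \<noteq> {0}\<close> subring_zero[OF sub] by (auto simp: multiples_def)
    have "x = y * (x * s)" using r s by simp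
    then have "x * (y * s) = x * 1" by (simp add: ac_simps)
    then have "y * s = 1" using \<open>x \<noteq> 0\<close> by simp
    then have "1 \<in> P 2" using y s by (force simp: multiples_def)
    then show False using prime_ideal_one[OF p(1)] by force
  qed
  moreover have "max_ideal D = ideal_span D {u, v}" using ideal_span_pair[OF sub params(3,4)] max_eq by simp
  ultimately show ?thesis unfolding regular_local_dim2_def krull_dim_eq_def
    using loc noeth params by blast
qed

end

text \<open>A principal ideal \<open>b D\<close> containing powers of both parameters is impossible:
  some power of \<open>b\<close> would lie in \<open>d D\<close> for a nonzero \<open>d\<close> of
  the middle prime \<open>P 1\<close>, and \<open>P 1\<close> would be maximal. This is applied to
  \<open>b = v\<close> if \<open>u = 0\<close>, and to \<open>b = u\<close> if a power of
  \<open>v\<close> lies in \<open>u D\<close>.\<close>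

lemma regular2_of_regular_local_dim2:
  assumes D: "regular_local_dim2 D" and m: "max_ideal D = two_gen D u v"
  shows "regular2 D u v"
proof -
  have loc: "local_ring D" and noeth: "noetherian D" and chain: "prime_chain D 2"
    using D by (auto simp: regular_local_dim2_def krull_dim_eq_def)
  note sub = local_subring[OF loc]
  have uv: "u \<in> max_ideal D" "v \<in> max_ideal D" "u \<in> D" "v \<in> D"
    using two_gen_self[OF sub] m max_ideal_subset by blast+
  obtain P :: "nat \<Rightarrow> 'a set" where P: "\<And>i. i \<le> 2 \<Longrightarrow> is_prime_ideal D (P i)"
    "\<And>i. i < 2 \<Longrightarrow> P i \<subset> P (Suc i)" using chain unfolding prime_chain_def by auto
  have c: "P 0 \<subset> P 1" "P 1 \<subset> P 2" using P(2)[of 0] P(2)[of 1] by (auto simp: numeral_2_eq_2)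
  have p1: "is_prime_ideal D (P 1)" using P(1) by simp
  have "0 \<in> P 0" using P(1)[of 0] ideal_zero[OF prime_ideal_ideal] by simp
  then obtain d where d: "d \<in> P 1" "d \<noteq> 0" using c by blast
  have dD: "d \<in> D" using d ideal_subset[OF prime_ideal_ideal[OF p1]] by blast
  have "P 2 \<subseteq> max_ideal D"
    using P(1)[of 2] proper_ideal_subset_max[OF prime_ideal_ideal prime_ideal_one] by simp
  then have "\<not> max_ideal D \<subseteq> P 1" using c by blast
  have key: False if b: "b \<in> max_ideal D" "u ^ k \<in> multiples D b" "v ^ k \<in> multiples D b" for b k
  proof -
    have bD: "b \<in> D" using b max_ideal_subset by blast
    obtain n r where n: "b ^ n = d * r" "r \<in> D"
      using power_in_multiples[OF loc noeth m b dD d(2)] by (auto simp: multiples_def)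
    then have "b ^ n \<in> P 1" using d ideal_mult_right[OF prime_ideal_ideal[OF p1]] by simp
    then have "b \<in> P 1" using prime_ideal_power[OF sub p1 bD] by blast
    then have "multiples D b \<subseteq> P 1"
      using ideal_mult_right[OF prime_ideal_ideal[OF p1]] by (auto simp: multiples_def)
    then have "u \<in> P 1" "v \<in> P 1" using b prime_ideal_power[OF sub p1] uv by blast+
    then have "max_ideal D \<subseteq> P 1" unfolding m using two_gen_least[OF prime_ideal_ideal[OF p1]] by blast
    then show False using \<open>\<not> max_ideal D \<subseteq> P 1\<close> by blast
  qed
  have "u \<noteq> 0"
  proof
    assume "u = 0"
    then have "u ^ 1 \<in> multiples D v" using subring_zero[OF sub] by (force simp: multiples_def)
    moreover have "v ^ 1 \<in> multiples D v" using multiples_self[OF sub] by simp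
    ultimately show False using key[OF uv(2)] by blast
  qed
  moreover have "v ^ k \<notin> multiples D u" for k
  proof
    assume k: "v ^ k \<in> multiples D u"
    have mu: "is_ideal D (multiples D u)" using multiples_ideal[OF sub uv(3)] .
    \<comment> \<open>The exponent is raised by one because \<open>k\<close> may be 0, and only
      positive powers of \<open>u\<close> are evidently multiples of \<open>u\<close>.\<close>
    have "v * v ^ k \<in> multiples D u" using k uv ideal_mult[OF mu] by blast
    moreover have "u ^ k * u \<in> multiples D u"
      using multiples_self[OF sub] uv subring_power[OF sub] ideal_mult[OF mu] by blast
    ultimately show False using key[OF uv(1), of "Suc k"] by (simp add: mult.commute)
  qed
  ultimately show ?thesis by unfold_locales (use loc noeth m in auto)
qed

lemma regular_local_dim2_params:
  assumes "regular_local_dim2 D"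
  obtains u v where "regular2 D u v"
proof -
  obtain a b where "a \<in> D" "b \<in> D" "max_ideal D = ideal_span D {a, b}"
    using assms unfolding regular_local_dim2_def by blast
  moreover have "is_subring D" using assms by (simp add: regular_local_dim2_def local_ring_def)
  ultimately have "max_ideal D = two_gen D a b" using ideal_span_pair by metis
  then show thesis using that regular2_of_regular_local_dim2[OF assms] by blast
qed

text \<open>The conditions of \<open>regular2\<close> single out \<open>u\<close>; the symmetry
  comes from passing through the intrinsic notion of regularity.\<close>

lemma regular2_commute: "regular2 D u v \<Longrightarrow> regular2 D v u"
  using regular2_of_regular_local_dim2 regular2.regular_local_dim2 regular2.max_eq two_gen_commute by metis

lemma regular_not_valuation: "regular_local_dim2 D \<Longrightarrow> \<not> valuation_ring D"
  using regular_local_dim2_params regular2.not_valuation by metis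

subsection \<open>Quadratic transforms\<close>

text \<open>Over the residue field \<open>g\<close> becomes a nonzero polynomial, whose monic
  associate is lifted. Top terms with coefficients in the maximal ideal are stripped off until the
  leading coefficient is a unit, which is \<open>c\<close>.\<close>

lemma monic_reduction:
  assumes R: "local_ring R" and g: "g \<in> polys R" "g \<notin> polys (max_ideal R)"
  shows "\<exists>f c. f \<in> polys R \<and> lead_coeff f = 1 \<and> degree f \<le> degree g \<and> c \<in> R \<and> c \<noteq> 0 \<and> inverse c \<in> R \<and>
    g - smult c f \<in> polys (max_ideal R)"
proof -
  note im = local_max_ideal[OF R] and sR = local_subring[OF R]
  have "degree g < n \<Longrightarrow> g \<in> polys R \<Longrightarrow> g \<notin> polys (max_ideal R) \<Longrightarrow>
    \<exists>f c. f \<in> polys R \<and> lead_coeff f = 1 \<and> degree f \<le> degree g \<and> c \<in> R \<and> c \<noteq> 0 \<and> inverse c \<in> R \<and>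
    g - smult c f \<in> polys (max_ideal R)" for n g
  proof (induction n arbitrary: g)
    case (Suc n)
    let ?l = "lead_coeff g"
    have lR: "?l \<in> R" using Suc.prems(2) by (simp add: polys_def)
    show ?case
    proof (cases "?l \<in> max_ideal R")
      case False
      then have l: "inverse ?l \<in> R" "?l \<noteq> 0" using inverse_in lR by blast+
      have "smult (inverse ?l) g \<in> polys R" using polys_smult[OF sR l(1) Suc.prems(2)] .
      moreover have "g - smult ?l (smult (inverse ?l) g) \<in> polys (max_ideal R)"
        using l polys_zero[OF ideal_zero[OF im]] by simp
      ultimately show ?thesis using l lR
        by (intro exI[of _ "smult (inverse ?l) g"] exI[of _ ?l]) auto
    next
      case True
      let ?t = "monom ?l (degree g)"
      have tm: "?t \<in> polys (max_ideal R)" using polys_monom[OF ideal_zero[OF im] True] .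
      have gt: "g - ?t \<in> polys R"
        using Suc.prems(2) tm polys_mono[OF max_ideal_subset[of R]] polys_diff[OF sR] by blast
      have nm: "g - ?t \<notin> polys (max_ideal R)"
        using polys_ideal_add[OF sR im _ tm, of "g - ?t"] Suc.prems(3) by auto
      then have "g - ?t \<noteq> 0" using polys_zero[OF ideal_zero[OF im]] by metis
      moreover have "coeff (g - ?t) (degree g) = 0" by simp
      ultimately have "degree (g - ?t) \<noteq> degree g" using leading_coeff_0_iff by metis
      moreover have le: "degree (g - ?t) \<le> degree g"
        by (intro degree_diff_le order_refl degree_monom_le)
      ultimately obtain f c where fc: "f \<in> polys R" "lead_coeff f = 1" "degree f \<le> degree (g - ?t)"
        "c \<in> R" "c \<noteq> 0" "inverse c \<in> R" "g - ?t - smult c f \<in> polys (max_ideal R)"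
        using Suc.IH[OF _ gt nm] Suc.prems(1) by auto
      have "(g - ?t - smult c f) + ?t \<in> polys (max_ideal R)"
        using polys_ideal_add[OF sR im fc(7) tm] .
      then show ?thesis using fc le
        by (intro exI[of _ f] exI[of _ c]) (auto simp: algebra_simps)
    qed
  qed simp
  then show ?thesis using g by blast
qed

text \<open>Modulo \<open>extended_max R z\<close> the ring is a polynomial ring over the residue
  field, hence principal; \<open>f\<close> is a monic lift of a generator of the image of
  \<open>q\<close>.\<close>

lemma prime_over_extended_max:
  assumes R: "local_ring R" "residually_transcendental R z"
    and q: "is_prime_ideal (adjoin R z) q" "extended_max R z \<subset> q"
  obtains f where "f \<in> polys R" "lead_coeff f = 1" "poly f z \<in> q"
    "\<And>g. g \<in> polys R \<Longrightarrow> poly g z \<in> q \<Longrightarrow> \<exists>h\<in>polys R. g - h * f \<in> polys (max_ideal R)"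
proof -
  note im = local_max_ideal[OF R(1)] and sR = local_subring[OF R(1)]
  note sA = adjoin_subring[OF sR, of z] and iq = prime_ideal_ideal[OF q(1)]
  have small: "poly p z \<in> q" if "p \<in> polys (max_ideal R)" for p
    using q(2) that by (auto simp: extended_max_def)
  let ?Q = "\<lambda>n. \<exists>f\<in>polys R. lead_coeff f = 1 \<and> poly f z \<in> q \<and> degree f = n"
  have monic: "\<exists>n\<le>degree g. ?Q n" if g: "g \<in> polys R" "poly g z \<in> q" "g \<notin> polys (max_ideal R)" for g
  proof -
    obtain f c where f: "f \<in> polys R" "lead_coeff f = 1" "degree f \<le> degree g"
      "c \<in> R" "c \<noteq> 0" "inverse c \<in> R" "g - smult c f \<in> polys (max_ideal R)"
      using monic_reduction[OF R(1) g(1,3)] by blast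
    have "poly g z - poly (g - smult c f) z \<in> q" using ideal_diff[OF sA iq g(2) small[OF f(7)]] .
    then have "c * poly f z \<in> q" by simp
    then have "inverse c * (c * poly f z) \<in> q"
      using ideal_mult[OF iq] f(6) adjoin_superset(1)[OF sR] by blast
    then have "poly f z \<in> q" using f(5) by (simp flip: mult.assoc)
    then show ?thesis using f by blast
  qed
  obtain x where "x \<in> q" "x \<notin> extended_max R z" using q(2) by blast
  moreover from this obtain g where "x = poly g z" "g \<in> polys R"
    using ideal_subset[OF iq] by (auto simp: adjoin_def)
  ultimately have ex: "\<exists>n. ?Q n" using monic[of g] extended_max_iff[OF R] by blast
  define n where "n = (LEAST n. ?Q n)"
  obtain f where f: "f \<in> polys R" "lead_coeff f = 1" "poly f z \<in> q" "degree f = n"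
    using LeastI_ex[OF ex] unfolding n_def by blast
  have least: "n \<le> k" if "?Q k" for k unfolding n_def using Least_le[of ?Q k] that by blast
  have "degree g < N \<Longrightarrow> g \<in> polys R \<Longrightarrow> poly g z \<in> q \<Longrightarrow> \<exists>h\<in>polys R. g - h * f \<in> polys (max_ideal R)" for g N
  proof (induction N arbitrary: g)
    case (Suc N)
    show ?case
    proof (cases "g \<in> polys (max_ideal R)")
      case True
      then show ?thesis using polys_zero[OF subring_zero[OF sR]] by (intro bexI[of _ 0]) auto
    next
      case False
      then have nd: "n \<le> degree g" using monic[OF Suc.prems(2,3)] least by (meson order_trans)
      let ?h = "monom (lead_coeff g) (degree g - n)"
      have hR: "?h \<in> polys R"
        using Suc.prems(2) polys_monom[OF subring_zero[OF sR]] by (auto simp: polys_def)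
      have deg: "degree (?h * f) \<le> degree g"
        using degree_mult_le[of ?h f] degree_monom_le[of "lead_coeff g" "degree g - n"] f(4) nd by linarith
      have "coeff (?h * f) (degree g) = lead_coeff g"
        using f(2,4) nd by (simp add: coeff_monom_mult)
      then have c0: "coeff (g - ?h * f) (degree g) = 0" by simp
      have d1: "degree (g - ?h * f) \<le> degree g" using deg by (intro degree_diff_le) auto
      have g1: "g - ?h * f \<in> polys R" using polys_diff[OF sR Suc.prems(2) polys_mult[OF sR hR f(1)]] .
      have "poly ?h z * poly f z \<in> q" using ideal_mult[OF iq poly_in_adjoin[OF hR] f(3)] .
      then have g2: "poly (g - ?h * f) z \<in> q" using ideal_diff[OF sA iq Suc.prems(3)] by simp
      show ?thesis
      proof (cases "g - ?h * f = 0")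
        case True
        then show ?thesis using hR polys_zero[OF ideal_zero[OF im]] by (intro bexI[of _ ?h]) auto
      next
        case False
        then have "degree (g - ?h * f) \<noteq> degree g" using c0 leading_coeff_0_iff by metis
        then obtain h where h: "h \<in> polys R" "g - ?h * f - h * f \<in> polys (max_ideal R)"
          using Suc.IH[OF _ g1 g2] d1 Suc.prems(1) by auto
        have "g - (?h + h) * f \<in> polys (max_ideal R)" using h(2) by (simp add: algebra_simps)
        then show ?thesis using polys_add[OF sR hR h(1)] by blast
      qed
    qed
  qed simp
  then show thesis using that f by blast
qed

text \<open>Nonzero primes of a polynomial ring over a field are maximal. The generator
  \<open>f'\<close> of the larger prime divides \<open>f\<close>, so \<open>q\<close> contains
  \<open>f'\<close> or the cofactor \<open>h\<close>; in the latter case cancelling \<open>f\<close>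
  makes \<open>f'\<close> a unit modulo the maximal ideal.\<close>

lemma prime_over_extended_max_maximal:
  assumes R: "local_ring R" "residually_transcendental R z"
    and q: "is_prime_ideal (adjoin R z) q" "extended_max R z \<subset> q"
    and q': "is_prime_ideal (adjoin R z) q'" "q \<subseteq> q'"
  shows "q' = q"
proof
  note im = local_max_ideal[OF R(1)] and sR = local_subring[OF R(1)]
  note sA = adjoin_subring[OF sR, of z] and iq = prime_ideal_ideal[OF q(1)] and iq' = prime_ideal_ideal[OF q'(1)]
  let ?m = "polys (max_ideal R)"
  have small: "poly p z \<in> q" if "p \<in> ?m" for p
    using q(2) that by (auto simp: extended_max_def)
  obtain f where f: "f \<in> polys R" "lead_coeff f = 1" "poly f z \<in> q"
    "\<And>g. g \<in> polys R \<Longrightarrow> poly g z \<in> q \<Longrightarrow> \<exists>h\<in>polys R. g - h * f \<in> ?m"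
    using prime_over_extended_max[OF R q] by blast
  obtain f' where f': "f' \<in> polys R" "lead_coeff f' = 1" "poly f' z \<in> q'"
    "\<And>g. g \<in> polys R \<Longrightarrow> poly g z \<in> q' \<Longrightarrow> \<exists>h\<in>polys R. g - h * f' \<in> ?m"
    using prime_over_extended_max[OF R q'(1)] q(2) q'(2) by blast
  obtain h where h: "h \<in> polys R" "f - h * f' \<in> ?m" using f'(4)[OF f(1)] f(3) q'(2) by blast
  have "poly f z - poly (f - h * f') z \<in> q" using ideal_diff[OF sA iq f(3) small[OF h(2)]] .
  then have "poly h z * poly f' z \<in> q" by simp
  then consider "poly f' z \<in> q" | "poly h z \<in> q"
    using prime_ideal_disj[OF q(1) poly_in_adjoin[OF h(1)] poly_in_adjoin[OF f'(1)]] by blast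
  then show "q' \<subseteq> q"
  proof cases
    case 1
    show ?thesis
    proof
      fix x assume x: "x \<in> q'"
      then obtain g where g: "x = poly g z" "g \<in> polys R" using ideal_subset[OF iq'] by (auto simp: adjoin_def)
      then obtain k where k: "k \<in> polys R" "g - k * f' \<in> ?m" using f'(4) x by blast
      have "poly (g - k * f') z + poly k z * poly f' z \<in> q"
        using small[OF k(2)] ideal_mult[OF iq poly_in_adjoin[OF k(1)] 1] ideal_add[OF iq] by blast
      then show "x \<in> q" using g by simp
    qed
  next
    case 2
    then obtain k where k: "k \<in> polys R" "h - k * f \<in> ?m" using f(4) h(1) by blast
    have "(f - h * f') + (h - k * f) * f' \<in> ?m"
      using polys_ideal_add[OF sR im h(2) polys_ideal_mult[OF sR im f'(1) k(2)]] by (simp only: mult.commute)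
    moreover have "(f - h * f') + (h - k * f) * f' = f * (1 - k * f')" by (simp add: algebra_simps)
    ultimately have fm: "f * (1 - k * f') \<in> ?m" by simp
    have one: "1 - k * f' \<in> polys R"
      using polys_diff[OF sR polys_one[OF sR] polys_mult[OF sR k(1) f'(1)]] .
    have "f \<notin> ?m" using monic_notin_polys_max[OF sR f(2)] .
    then have "1 - k * f' \<in> ?m" using polys_max_prime[OF R(1) f(1) one fm] by blast
    then have "poly (1 - k * f') z \<in> q'" using small q'(2) by blast
    moreover have "poly k z * poly f' z \<in> q'" using ideal_mult[OF iq' poly_in_adjoin[OF k(1)] f'(3)] .
    ultimately have "poly (1 - k * f') z + poly k z * poly f' z \<in> q'" using ideal_add[OF iq'] by blast
    then have "1 \<in> q'" by simp
    then show ?thesis using prime_ideal_one[OF q'(1)] by blast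
  qed
qed (use q' in blast)

lemma two_gen_collapse:
  assumes A: "is_subring A" and w: "w \<in> A" "v = u * w"
  shows "two_gen A u v = multiples A u"
proof (intro equalityI subsetI)
  fix x assume "x \<in> two_gen A u v"
  then obtain r s where "x = r * u + s * v" "r \<in> A" "s \<in> A" by (auto simp: two_gen_def)
  then have "x = u * (r + s * w)" "r + s * w \<in> A" using w A by (auto simp: algebra_simps intro!: subring_closed)
  then show "x \<in> multiples A u" unfolding multiples_def by blast
next
  fix x assume "x \<in> multiples A u"
  then obtain r where "x = u * r" "r \<in> A" by (auto simp: multiples_def)
  then have "x = r * u + 0 * v" by simp
  then show "x \<in> two_gen A u v" using subring_zero[OF A] \<open>r \<in> A\<close> unfolding two_gen_def by blast
qed

section \<open>Domination and centres\<close>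

definition dominates :: "'a::field set \<Rightarrow> 'a set \<Rightarrow> bool" where
  "dominates R D \<longleftrightarrow> D \<subseteq> R \<and> max_ideal D \<subseteq> max_ideal R"

text \<open>A nonunit of \<open>R\<close> that lies in \<open>D\<close> is a nonunit of
  \<open>D\<close>, since an inverse in \<open>D\<close> would lie in \<open>R\<close>.\<close>

lemma dominates_iff: "R \<in> LD D \<longleftrightarrow> local_ring R \<and> dominates R D"
proof -
  have "x \<in> max_ideal D" if "D \<subseteq> R" "x \<in> max_ideal R" "x \<in> D" for x
    using that by (auto simp: max_ideal_def)
  then show ?thesis using max_ideal_subset unfolding LD_def dominates_def by blast
qed

lemma dominates_inter: "dominates R D \<Longrightarrow> x \<in> D \<Longrightarrow> x \<in> max_ideal R \<longleftrightarrow> x \<in> max_ideal D"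
  unfolding dominates_def max_ideal_def by auto

lemma dominates_trans: "dominates R E \<Longrightarrow> dominates E D \<Longrightarrow> dominates R D"
  unfolding dominates_def by blast

text \<open>Domination keeps a coefficient outside the maximal ideal, so admissible denominators
  stay admissible.\<close>

lemma gauss_mono:
  assumes R: "local_ring R" "residually_transcendental R z"
    and S: "local_ring S" "residually_transcendental S z" and dom: "dominates S R"
  shows "gauss R z \<subseteq> gauss S z"
proof
  fix c assume "c \<in> gauss R z"
  then obtain f g where fg: "c = poly f z / poly g z" "f \<in> polys R" "g \<in> polys R" "g \<notin> polys (max_ideal R)"
    using gauss_cases[OF R] by metis
  have "g \<notin> polys (max_ideal S)"
    using fg(3,4) dominates_inter[OF dom] by (auto simp: polys_def)
  moreover have "polys R \<subseteq> polys S" using dom by (intro polys_mono) (simp add: dominates_def)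
  ultimately show "c \<in> gauss S z"
    unfolding fg(1) using fg(2,3) by (intro gauss_intro[OF S]) auto
qed

lemma center_prime:
  assumes R: "local_ring R" and A: "is_subring A" "A \<subseteq> R"
  shows "is_prime_ideal A (max_ideal R \<inter> A)"
  unfolding is_prime_ideal_def is_ideal_def
proof (intro conjI ballI impI)
  note im = local_max_ideal[OF R]
  show "max_ideal R \<inter> A \<subseteq> A" by blast
  show "0 \<in> max_ideal R \<inter> A" using ideal_zero[OF im] subring_zero[OF A(1)] by blast
  show "max_ideal R \<inter> A \<noteq> A" using one_notin_max_ideal[of R] subring_one[OF A(1)] A(2) by blast
next
  fix x y assume "x \<in> max_ideal R \<inter> A" "y \<in> max_ideal R \<inter> A"
  then show "x + y \<in> max_ideal R \<inter> A"
    using ideal_add[OF local_max_ideal[OF R]] subring_add[OF A(1)] by blast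
next
  fix r x assume "r \<in> A" "x \<in> max_ideal R \<inter> A"
  then show "r * x \<in> max_ideal R \<inter> A"
    using ideal_mult[OF local_max_ideal[OF R]] subring_mult[OF A(1)] A(2) by blast
next
  fix x y assume "x \<in> A" "y \<in> A" "x * y \<in> max_ideal R \<inter> A"
  then show "x \<in> max_ideal R \<inter> A \<or> y \<in> max_ideal R \<inter> A"
    using max_ideal_prime[OF R] A(2) by blast
qed

lemma localise_center:
  assumes R: "local_ring R" and A: "is_subring A" "A \<subseteq> R"
  shows "dominates R (localise A (max_ideal R \<inter> A))"
proof -
  let ?q = "max_ideal R \<inter> A"
  note q = center_prime[OF R A] and sR = local_subring[OF R]
  have inv: "inverse y \<in> R" "y \<noteq> 0" if "y \<in> A" "y \<notin> ?q" for y
    using that A(2) inverse_in by blast+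
  have "c \<in> R" if c: "c \<in> localise A ?q" for c
  proof -
    obtain x y where "c = x / y" "x \<in> A" "y \<in> A" "y \<notin> ?q" using localise_cases[OF q c] by metis
    then show ?thesis using inv A(2) subring_mult[OF sR] by (auto simp: divide_inverse)
  qed
  moreover have "c \<in> max_ideal R" if c: "c \<in> max_ideal (localise A ?q)" for c
  proof -
    obtain x y where xy: "c = x / y" "x \<in> ?q" "y \<in> A" "y \<notin> ?q"
      using c unfolding max_ideal_localise[OF A(1) q] by blast
    then have "x * inverse y \<in> max_ideal R"
      using inv(1) ideal_mult_right[OF local_max_ideal[OF R]] by blast
    then show ?thesis using xy by (simp add: divide_inverse)
  qed
  ultimately show ?thesis unfolding dominates_def by blast
qed

section \<open>The chart D[v / u] of the blow-up\<close>

context regular2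
begin

abbreviation "w \<equiv> v / u"
abbreviation "A \<equiv> adjoin D w"

lemma sub_A: "is_subring A"
  using adjoin_subring[OF sub] .

lemma v_eq: "v = u * w"
  using u_nonzero by simp

lemma w_transcendental: "residually_transcendental D w"
  using residually_transcendental_quotient[OF loc params(2,1) u_nonzero nonzerodivisor_mod_uv] .

lemma extended_max_w: "extended_max D w = multiples A u"
  using extended_max_two_gen[OF loc max_eq, of w] two_gen_collapse[OF sub_A adjoin_superset(2)[OF sub] v_eq] by simp

lemmas gauss_w = gauss_local[OF loc w_transcendental] gauss_noetherian[OF loc noeth w_transcendental]

lemma max_gauss_w: "max_ideal (gauss D w) = multiples (gauss D w) u"
  using max_ideal_gauss[OF loc w_transcendental max_eq]
    two_gen_collapse[OF local_subring[OF gauss_w(1)] gauss_superset(3)[OF loc w_transcendental] v_eq] by simp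

lemma gauss_w_valuation:
  assumes "quotient_field_is_UNIV D"
  shows "valuation_ring (gauss D w)"
  using dvr_valuation[OF gauss_w max_gauss_w quotient_field_mono[OF assms gauss_superset(2)[OF loc w_transcendental]]] .

lemma gauss_w_overring:
  assumes "quotient_field_is_UNIV D" "is_subring R" "gauss D w \<subseteq> R" "inverse u \<notin> R"
  shows "R = gauss D w"
  using overring_of_dvr[OF gauss_w max_gauss_w quotient_field_mono[OF assms(1) gauss_superset(2)[OF loc w_transcendental]] assms(2,3)] assms(4) by blast

text \<open>The prime \<open>q\<close> is a closed point of the exceptional fibre, and
  \<open>f\<close> lifts its equation over the residue field. The last conclusion lets
  \<open>u\<close> and \<open>f\<close> alone identify \<open>q\<close> as the centre of other
  rings.\<close>

lemma quadratic_regular: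
  assumes q: "is_prime_ideal A q" "u \<in> q" "q \<noteq> extended_max D w"
  obtains f where "f \<in> q" "regular2 (localise A q) u f"
    "\<And>q'. is_prime_ideal A q' \<Longrightarrow> u \<in> q' \<Longrightarrow> f \<in> q' \<Longrightarrow> q' = q"
proof -
  note iq = prime_ideal_ideal[OF q(1)]
  have "multiples A u \<subseteq> q" using q(2) ideal_mult_right[OF iq] by (auto simp: multiples_def)
  then have sub_q: "extended_max D w \<subset> q" using extended_max_w q(3) by blast
  obtain f where f: "f \<in> polys D" "lead_coeff f = 1" "poly f w \<in> q"
    "\<And>g. g \<in> polys D \<Longrightarrow> poly g w \<in> q \<Longrightarrow> \<exists>h\<in>polys D. g - h * f \<in> polys (max_ideal D)"
    using prime_over_extended_max[OF loc w_transcendental q(1) sub_q] by blast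
  let ?f = "poly f w" and ?L = "localise A q"
  have gen: "q \<subseteq> two_gen A u ?f"
  proof
    fix x assume x: "x \<in> q"
    then obtain g where g: "x = poly g w" "g \<in> polys D" using ideal_subset[OF iq] by (auto simp: adjoin_def)
    then obtain h where h: "h \<in> polys D" "g - h * f \<in> polys (max_ideal D)" using f(4) x by blast
    have "poly (g - h * f) w \<in> multiples A u"
      using h(2) unfolding extended_max_w[symmetric] extended_max_def by blast
    then obtain r where r: "poly (g - h * f) w = u * r" "r \<in> A" by (auto simp: multiples_def)
    then have "x = r * u + poly h w * ?f" using g by (simp add: algebra_simps)
    then show "x \<in> two_gen A u ?f" using r h poly_in_adjoin unfolding two_gen_def by blast
  qed
  have AL: "A \<subseteq> ?L" using localise_superset[OF sub_A q(1)] .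
  have LL: "local_ring ?L" using localise_local[OF sub_A q(1)] .
  have max: "max_ideal ?L = two_gen ?L u ?f"
  proof
    show "max_ideal ?L \<subseteq> two_gen ?L u ?f"
    proof
      fix c assume "c \<in> max_ideal ?L"
      then obtain x y where xy: "c = x / y" "x \<in> q" "y \<in> A" "y \<notin> q"
        unfolding max_ideal_localise[OF sub_A q(1)] by blast
      then obtain r s where rs: "x = r * u + s * ?f" "r \<in> A" "s \<in> A" using gen unfolding two_gen_def by blast
      have "c = r / y * u + s / y * ?f" using rs xy by (simp add: add_divide_distrib)
      moreover have "r / y \<in> ?L" "s / y \<in> ?L" unfolding localise_def using rs xy by blast+
      ultimately show "c \<in> two_gen ?L u ?f" unfolding two_gen_def by blast
    qed
    have "x \<in> max_ideal ?L" if "x \<in> q" for x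
    proof -
      have "x = x / 1" by simp
      then show ?thesis unfolding max_ideal_localise[OF sub_A q(1)]
        using that subring_one[OF sub_A] prime_ideal_one[OF q(1)] by blast
    qed
    then show "two_gen ?L u ?f \<subseteq> max_ideal ?L"
      using two_gen_least[OF local_max_ideal[OF LL]] q(2) f(3) by blast
  qed
  have fnot: "?f \<notin> extended_max D w"
    using monic_notin_polys_max[OF sub f(2)] extended_max_iff[OF loc w_transcendental f(1)] by blast
  have pe: "is_prime_ideal A (extended_max D w)" using extended_max_prime[OF loc w_transcendental] .
  have fA: "?f \<in> A" using poly_in_adjoin[OF f(1)] .
  \<comment> \<open>After clearing the denominator this takes place modulo \<open>u A\<close>, the
    prime \<open>extended_max D w\<close>, which contains neither \<open>f\<close> nor any
    denominator outside \<open>q\<close>.\<close>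
  have "?f ^ k \<notin> multiples ?L u" for k
  proof
    assume "?f ^ k \<in> multiples ?L u"
    then obtain c where c: "?f ^ k = u * c" "c \<in> ?L" by (auto simp: multiples_def)
    obtain x y where xy: "c = x / y" "x \<in> A" "y \<in> A" "y \<notin> q" "y \<noteq> 0" using localise_cases[OF q(1) c(2)] .
    have "?f ^ k * y = u * x" using c xy by simp
    then have "?f ^ k * y \<in> extended_max D w" unfolding extended_max_w multiples_def using xy by blast
    then have "?f ^ k \<in> extended_max D w"
      using prime_ideal_disj[OF pe subring_power[OF sub_A fA] xy(3)] sub_q xy(4) by blast
    then show False using fnot prime_ideal_power[OF sub_A pe fA] by blast
  qed
  then have "regular2 ?L u ?f"
    using LL max u_nonzero noetherian_localise[OF sub_A noetherian_adjoin[OF sub noeth] q(1)]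
    by unfold_locales auto
  moreover have "q' = q" if q': "is_prime_ideal A q'" "u \<in> q'" "?f \<in> q'" for q'
    using prime_over_extended_max_maximal[OF loc w_transcendental q(1) sub_q q'(1)]
      gen two_gen_least[OF prime_ideal_ideal[OF q'(1)] q'(2,3)] by blast
  ultimately show thesis using that[of ?f] f(3) by blast
qed

text \<open>\<open>D1\<close> is the localisation of \<open>A\<close> at the centre of
  \<open>R\<close>. If that centre were the generic point of the exceptional fibre, \<open>R\<close>
  would contain the order valuation ring without inverting \<open>u\<close>, hence equal it.\<close>

lemma quadratic_step:
  assumes F: "quotient_field_is_UNIV D" and R: "local_ring R" "dominates R D" "w \<in> R"
    and ne: "R \<noteq> gauss D w"
  obtains D1 f where "regular2 D1 u f" "dominates R D1" "dominates D1 D" "max_ideal D \<subseteq> multiples D1 u"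
    "\<And>\<alpha>. local_ring \<alpha> \<Longrightarrow> dominates \<alpha> D \<Longrightarrow> w \<in> \<alpha> \<Longrightarrow> f \<in> max_ideal \<alpha> \<Longrightarrow> D1 \<subseteq> \<alpha>"
    "f \<in> max_ideal R"
proof -
  have DR: "D \<subseteq> R" "max_ideal D \<subseteq> max_ideal R" using R(2) by (auto simp: dominates_def)
  have AR: "A \<subseteq> R" using adjoin_least[OF local_subring[OF R(1)] DR(1) R(3)] .
  have DA: "D \<subseteq> A" "w \<in> A" using adjoin_superset[OF sub] by blast+
  let ?q = "max_ideal R \<inter> A"
  have q: "is_prime_ideal A ?q" using center_prime[OF R(1) sub_A AR] .
  have uq: "u \<in> ?q" using params DR DA by blast
  have "?q \<noteq> extended_max D w"
  proof
    assume "?q = extended_max D w"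
    then have "gauss D w \<subseteq> R"
      using localise_center[OF R(1) sub_A AR] unfolding gauss_def dominates_def by simp
    moreover have "inverse u \<notin> R" using uq u_nonzero not_in_max_ideal by blast
    ultimately show False using gauss_w_overring[OF F local_subring[OF R(1)]] ne by blast
  qed
  then obtain f where f: "f \<in> ?q" "regular2 (localise A ?q) u f"
    "\<And>q'. is_prime_ideal A q' \<Longrightarrow> u \<in> q' \<Longrightarrow> f \<in> q' \<Longrightarrow> q' = ?q"
    using quadratic_regular[OF q uq] by blast
  let ?L = "localise A ?q"
  have AL: "A \<subseteq> ?L" using localise_superset[OF sub_A q] .
  have dom: "dominates R ?L" using localise_center[OF R(1) sub_A AR] .
  have "max_ideal D \<subseteq> max_ideal ?L"
    using dominates_inter[OF dom] DR DA AL max_ideal_subset[of D] by blast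
  then have dom2: "dominates ?L D" using DA AL unfolding dominates_def by blast
  have "max_ideal D \<subseteq> multiples ?L u"
  proof
    fix x assume "x \<in> max_ideal D"
    then obtain r s where rs: "x = r * u + s * v" "r \<in> D" "s \<in> D" unfolding max_eq two_gen_def by blast
    then have "x \<in> two_gen A u v" using DA unfolding two_gen_def by blast
    then have "x \<in> multiples A u" using two_gen_collapse[OF sub_A DA(2) v_eq] by simp
    then show "x \<in> multiples ?L u" using AL by (auto simp: multiples_def)
  qed
  moreover have "?L \<subseteq> \<alpha>" if \<alpha>: "local_ring \<alpha>" "dominates \<alpha> D" "w \<in> \<alpha>" "f \<in> max_ideal \<alpha>" for \<alpha>
  proof -
    have D\<alpha>: "D \<subseteq> \<alpha>" "max_ideal D \<subseteq> max_ideal \<alpha>" using \<alpha>(2) by (auto simp: dominates_def)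
    have A\<alpha>: "A \<subseteq> \<alpha>" using adjoin_least[OF local_subring[OF \<alpha>(1)] D\<alpha>(1) \<alpha>(3)] .
    have "max_ideal \<alpha> \<inter> A = ?q"
      using f(1) \<alpha>(4) params D\<alpha> DA by (intro f(3)[OF center_prime[OF \<alpha>(1) sub_A A\<alpha>]]) blast+
    then show ?thesis using localise_center[OF \<alpha>(1) sub_A A\<alpha>] unfolding dominates_def by simp
  qed
  ultimately show thesis using that[OF f(2) dom dom2] f(1) by blast
qed

text \<open>If neither \<open>v / u\<close> nor \<open>u / v\<close> lies in \<open>\<alpha>\<close>, then the Gauss extensions of \<open>D\<close> and \<open>\<alpha>\<close> by
  \<open>v / u\<close> coincide, so \<open>u\<close> and \<open>v\<close> remain coprime in \<open>\<alpha>\<close>; then a reduced fraction of \<open>D\<close> cannot lose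
  its denominator in \<open>\<alpha>\<close>.\<close>

lemma regular_overring_eq:
  assumes F: "quotient_field_is_UNIV D" and \<alpha>: "regular_local_dim2 \<alpha>" "dominates \<alpha> D"
    and bad: "v / u \<notin> \<alpha>" "u / v \<notin> \<alpha>"
  shows "\<alpha> = D"
proof
  have D\<alpha>: "D \<subseteq> \<alpha>" "max_ideal D \<subseteq> max_ideal \<alpha>" using \<alpha>(2) by (auto simp: dominates_def)
  then show "D \<subseteq> \<alpha>" by blast
  obtain s t where "regular2 \<alpha> s t" using regular_local_dim2_params[OF \<alpha>(1)] .
  then interpret E: regular2 \<alpha> s t .
  have F\<alpha>: "quotient_field_is_UNIV \<alpha>" using quotient_field_mono[OF F D\<alpha>(1)] .
  have "inverse w \<notin> \<alpha>" using bad by simp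
  then obtain a b where ab: "a \<in> max_ideal \<alpha>" "b \<in> max_ideal \<alpha>" "b \<noteq> 0" "w = a / b"
    and rt: "residually_transcendental \<alpha> w"
    and cop: "nonzerodivisor_mod \<alpha> b a"
    using E.bad_residually_transcendental[OF F\<alpha> bad(1)] by metis
  have ab\<alpha>: "a \<in> \<alpha>" "b \<in> \<alpha>" using ab max_ideal_subset by blast+
  have uv\<alpha>: "u \<in> \<alpha>" "v \<in> \<alpha>" "u \<in> max_ideal \<alpha>" using params D\<alpha> by blast+
  \<comment> \<open>A discrete valuation ring with uniformiser \<open>u\<close> has no proper
    overring in which \<open>u\<close> stays a nonunit.\<close>
  have "gauss D w \<subseteq> gauss \<alpha> w" using gauss_mono[OF loc w_transcendental E.loc rt \<alpha>(2)] .
  moreover have "inverse u \<notin> gauss \<alpha> w"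
    using max_ideal_gauss_base[OF E.loc rt uv\<alpha>(1)] uv\<alpha>(3) u_nonzero not_in_max_ideal by blast
  ultimately have G: "gauss \<alpha> w = gauss D w"
    using gauss_w_overring[OF F local_subring[OF gauss_local[OF E.loc rt]]] by blast
  have mG: "max_ideal \<alpha> \<subseteq> multiples (gauss D w) u"
  proof
    fix x assume x: "x \<in> max_ideal \<alpha>"
    then have "x \<in> \<alpha>" using max_ideal_subset by blast
    then have "x \<in> max_ideal (gauss \<alpha> w)" using max_ideal_gauss_base[OF E.loc rt] x by blast
    then show "x \<in> multiples (gauss D w) u" using max_gauss_w G by simp
  qed
  have "u * a = b * v" using ab(3,4) u_nonzero by (simp add: field_simps)
  then have "u \<in> multiples \<alpha> b" using cop uv\<alpha>(1,2) unfolding nonzerodivisor_mod_def by blast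
  then obtain d where d: "u = b * d" "d \<in> \<alpha>" by (auto simp: multiples_def)
  have vd: "v = a * d" using d ab(3,4) v_eq by simp
  \<comment> \<open>Both \<open>b\<close> and a nonunit \<open>d\<close> would be divisible by
    \<open>u\<close> in the order valuation ring, so \<open>u = b * d\<close> would be divisible by
    \<open>u\<close> twice.\<close>
  have "d \<notin> max_ideal \<alpha>"
  proof
    assume "d \<in> max_ideal \<alpha>"
    then have "b \<in> multiples (gauss D w) u" "d \<in> multiples (gauss D w) u" using mG ab(2) by blast+
    then obtain r r' where r: "b = u * r" "d = u * r'" "r \<in> gauss D w" "r' \<in> gauss D w"
      unfolding multiples_def by blast
    have "u = (u * r) * (u * r')" using d(1) unfolding r(1,2) .
    then have "u * (u * (r * r')) = u * 1" by (simp add: ac_simps)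
    then have "u * (r * r') = 1" using u_nonzero by simp
    moreover have "r * r' \<in> gauss D w" using r subring_mult[OF local_subring[OF gauss_w(1)]] by blast
    moreover have "u \<in> max_ideal (gauss D w)"
      using max_gauss_w multiples_self[OF local_subring[OF gauss_w(1)]] by simp
    ultimately show False using max_ideal_no_inverse by blast
  qed
  then have d1: "inverse d \<in> \<alpha>" "d \<noteq> 0" using inverse_in d(2) by blast+
  \<comment> \<open>The pair \<open>u, v\<close> is the pair \<open>b, a\<close> times the unit
    \<open>d\<close>.\<close>
  have cop_uv: "nonzerodivisor_mod \<alpha> u v"
    unfolding nonzerodivisor_mod_def
  proof (intro ballI impI)
    fix c e assume c: "c \<in> \<alpha>" "e \<in> \<alpha>" "c * v = u * e"
    have "(c * a) * d = (b * e) * d" using c(3) d(1) vd by (simp add: algebra_simps)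
    then have "c * a = b * e" using d1(2) by simp
    then have "c \<in> multiples \<alpha> b" using cop c(1,2) unfolding nonzerodivisor_mod_def by blast
    then obtain g where g: "c = b * g" "g \<in> \<alpha>" by (auto simp: multiples_def)
    then have "c = u * (inverse d * g)" using d d1(2) by simp
    then show "c \<in> multiples \<alpha> u" using g d1 subring_mult[OF E.sub] unfolding multiples_def by blast
  qed
  show "\<alpha> \<subseteq> D"
  proof
    fix c assume c: "c \<in> \<alpha>"
    obtain x y k where xy: "x \<in> D" "y \<in> D" "y \<noteq> 0" "c = x / y" "u ^ k \<in> two_gen D x y" "v ^ k \<in> two_gen D x y"
      using coprime_fraction[OF F] by blast
    show "c \<in> D"
    proof (cases "y \<in> max_ideal D")
      case False
      then have "x * inverse y \<in> D" using xy inverse_in subring_mult[OF sub] by blast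
      then show ?thesis using xy by (simp add: divide_inverse)
    next
      \<comment> \<open>Since \<open>x = y * c\<close> in \<alpha>, the element \<open>y\<close>
        divides \<open>u ^ k\<close> and \<open>v ^ k\<close> there. By regularity of
        \<open>u, v\<close> it divides 1, contradicting that \<open>y\<close> is a nonunit.\<close>
      case True
      have "\<exists>e\<in>\<alpha>. g = y * e" if g: "g \<in> two_gen D x y" for g
      proof -
        obtain r s where rs: "g = r * x + s * y" "r \<in> D" "s \<in> D" using g unfolding two_gen_def by blast
        then have "g = y * (r * c + s)" using xy by (simp add: algebra_simps)
        moreover have "r * c + s \<in> \<alpha>" using rs c D\<alpha> by (auto intro!: subring_closed E.sub)
        ultimately show ?thesis by blast
      qed
      then obtain e e' where e: "u ^ k = y * e" "e \<in> \<alpha>" "v ^ k = y * e'" "e' \<in> \<alpha>" using xy(5,6) by blast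
      have "e * v ^ k = e' * u ^ k" using e by simp
      then have "e \<in> multiples \<alpha> (u ^ k)" 
        using nonzerodivisor_mod_power_power[OF E.sub uv\<alpha>(2,1) u_nonzero cop_uv] e(2,4) by blast
      then obtain h where h: "e = u ^ k * h" "h \<in> \<alpha>" unfolding multiples_def by blast
      have "u ^ k * (y * h) = u ^ k * 1" using e(1) h(1) by (simp add: ac_simps)
      then have "y * h = 1" using u_nonzero by simp
      then show ?thesis using max_ideal_no_inverse[of y \<alpha> h] True D\<alpha>(2) h(2) by blast
    qed
  qed
qed

text \<open>A prime of height at most one of \<open>D\<close> contracted from \<open>\<alpha>\<close> would make \<open>\<alpha>\<close> a valuation ring.\<close>

lemma regular_overring_dominates:
  assumes F: "quotient_field_is_UNIV D" and \<alpha>: "regular_local_dim2 \<alpha>" "D \<subseteq> \<alpha>"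
  shows "dominates \<alpha> D"
proof (rule ccontr)
  assume nd: "\<not> dominates \<alpha> D"
  have l\<alpha>: "local_ring \<alpha>" using \<alpha>(1) by (simp add: regular_local_dim2_def)
  let ?p = "max_ideal \<alpha> \<inter> D"
  have p: "is_prime_ideal D ?p" using center_prime[OF l\<alpha> sub \<alpha>(2)] .
  have "?p \<noteq> max_ideal D" using nd \<alpha>(2) unfolding dominates_def by blast
  have "valuation_ring \<alpha>"
  \<comment> \<open>A zero centre makes \<alpha> the whole field. A centre generated by \<pi> gives
    a discrete valuation ring dominated by \<alpha> and hence equal to it.\<close>
  proof (cases "?p = {0}")
    case True
    have "x \<in> \<alpha>" for x
    proof -
      obtain a b where ab: "a \<in> D" "b \<in> D" "b \<noteq> 0" "x = a / b"
        using F unfolding quotient_field_is_UNIV_def by blast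
      then have "b \<notin> max_ideal \<alpha>" using True by blast
      then have "a * inverse b \<in> \<alpha>" using ab \<alpha>(2) inverse_in subring_mult[OF local_subring[OF l\<alpha>]] by blast
      then show ?thesis using ab by (simp add: divide_inverse)
    qed
    then show ?thesis using local_subring[OF l\<alpha>] by (simp add: valuation_ring_def)
  next
    case False
    then obtain \<pi> where \<pi>: "\<pi> \<in> D" "?p = multiples D \<pi>"
      using prime_principal[OF p _ \<open>?p \<noteq> max_ideal D\<close>] by blast
    let ?L = "localise D ?p"
    have DL: "D \<subseteq> ?L" using localise_superset[OF sub p] .
    have LL: "local_ring ?L" "noetherian ?L"
      using localise_local[OF sub p] noetherian_localise[OF sub noeth p] by blast+
    have FL: "quotient_field_is_UNIV ?L" using quotient_field_mono[OF F DL] .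
    have dom: "dominates \<alpha> ?L" using localise_center[OF l\<alpha> sub \<alpha>(2)] .
    have \<pi>p: "\<pi> \<in> ?p" using \<pi> multiples_self[OF sub] by blast
    have max: "max_ideal ?L = multiples ?L \<pi>"
    proof (intro equalityI subsetI)
      fix c assume "c \<in> max_ideal ?L"
      then obtain x y where xy: "c = x / y" "x \<in> ?p" "y \<in> D" "y \<notin> ?p"
        unfolding max_ideal_localise[OF sub p] by blast
      then obtain r where r: "x = \<pi> * r" "r \<in> D" using \<pi> by (auto simp: multiples_def)
      have "c = \<pi> * (r / y)" using xy r by simp
      moreover have "r / y \<in> ?L" unfolding localise_def using r xy by blast
      ultimately show "c \<in> multiples ?L \<pi>" unfolding multiples_def by blast
    next
      fix c assume "c \<in> multiples ?L \<pi>"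
      moreover have "\<pi> \<in> max_ideal ?L" using dominates_inter[OF dom] \<pi>p DL by blast
      ultimately show "c \<in> max_ideal ?L"
        using ideal_mult_right[OF local_max_ideal[OF LL(1)]] by (auto simp: multiples_def)
    qed
    have "inverse \<pi> \<notin> \<alpha>" if "\<pi> \<noteq> 0" using \<pi>p that not_in_max_ideal by blast
    then have "\<alpha> = ?L"
      using overring_of_dvr[OF LL max FL local_subring[OF l\<alpha>]] dom unfolding dominates_def by blast
    then show ?thesis using dvr_valuation[OF LL max FL] by simp
  qed
  then show False using regular_not_valuation[OF \<alpha>(1)] by blast
qed

end

text \<open>Suppose \<open>z\<close> and \<open>1 / z\<close> avoid the union, and write \<open>z = a / b\<close> over \<open>\<alpha>\<^sub>0\<close>. Numerator and
  denominator stay non-units, so both can be divided by \<open>t\<^sub>0\<close>, \<open>t\<^sub>1\<close>, \dots successively. The resulting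
  denominators generate a strictly ascending chain of ideals in the union of the Gauss extensions of
  the \<open>\<alpha>\<^sub>n\<close> by \<open>z\<close>, against the Krull--Akizuki finiteness.\<close>

lemma quadratic_sequence_union:
  assumes reg: "\<And>n. regular_local_dim2 (\<alpha> n)" and dom: "\<And>n. dominates (\<alpha> (Suc n)) (\<alpha> n)"
    and t: "\<And>n. t n \<noteq> 0" "\<And>n. t n \<in> max_ideal (\<alpha> n)" "\<And>n. max_ideal (\<alpha> n) \<subseteq> multiples (\<alpha> (Suc n)) (t n)"
    and F: "quotient_field_is_UNIV (\<alpha> 0)"
  shows "\<exists>n. z \<in> \<alpha> n \<or> inverse z \<in> \<alpha> n"
proof (rule ccontr)
  assume "\<not> ?thesis"
  then have bad: "z \<notin> \<alpha> n" "inverse z \<notin> \<alpha> n" for n by blast+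
  have loc: "local_ring (\<alpha> n)" for n using reg by (simp add: regular_local_dim2_def)
  have domle: "n \<le> m \<Longrightarrow> dominates (\<alpha> m) (\<alpha> n)" for n m
  proof (induction rule: dec_induct)
    case base show ?case by (simp add: dominates_def)
  next
    case (step m) then show ?case using dom dominates_trans by blast
  qed
  have Fn: "quotient_field_is_UNIV (\<alpha> n)" for n
    using quotient_field_mono[OF F] domle[of 0 n] by (auto simp: dominates_def)
  have rt: "residually_transcendental (\<alpha> n) z" for n
  proof -
    obtain u v where "regular2 (\<alpha> n) u v" using regular_local_dim2_params[OF reg] .
    then show ?thesis using regular2.bad_residually_transcendental[OF _ Fn bad] by metis
  qed
  obtain u v where "regular2 (\<alpha> 0) u v" using regular_local_dim2_params[OF reg] .
  then interpret E: regular2 "\<alpha> 0" u v .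
  obtain a b k where ab: "a \<in> max_ideal (\<alpha> 0)" "b \<in> max_ideal (\<alpha> 0)" "b \<noteq> 0" "z = a / b"
    "u ^ k \<in> two_gen (\<alpha> 0) a b" "v ^ k \<in> two_gen (\<alpha> 0) a b"
    using E.bad_residually_transcendental[OF F bad] by metis
  let ?T = "gauss (\<alpha> 0) z"
  have T: "local_ring ?T" "noetherian ?T" "max_ideal ?T = two_gen ?T u v"
    using gauss_local[OF E.loc rt] gauss_noetherian[OF E.loc E.noeth rt] max_ideal_gauss[OF E.loc rt E.max_eq] by blast+
  note sT = local_subring[OF T(1)]
  have 0: "\<alpha> 0 \<subseteq> ?T" "z \<in> ?T" using gauss_superset[OF E.loc rt] by blast+
  have bT: "b \<in> max_ideal ?T" using max_ideal_gauss_base[OF E.loc rt] ab max_ideal_subset by blast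
  \<comment> \<open>In \<open>?T\<close> the numerator is a multiple of the denominator, so
    \<open>b\<close> alone generates an ideal containing powers of both parameters, as
    \<open>overring_acc\<close> demands.\<close>
  have "two_gen (\<alpha> 0) a b \<subseteq> multiples ?T b"
  proof
    fix x assume "x \<in> two_gen (\<alpha> 0) a b"
    then obtain r s where rs: "x = r * a + s * b" "r \<in> \<alpha> 0" "s \<in> \<alpha> 0" by (auto simp: two_gen_def)
    then have "x = b * (r * z + s)" using ab(3,4) by (simp add: algebra_simps)
    moreover have "r * z + s \<in> ?T" using rs 0 by (auto intro!: subring_closed sT)
    ultimately show "x \<in> multiples ?T b" unfolding multiples_def by blast
  qed
  then have powT: "u ^ k \<in> multiples ?T b" "v ^ k \<in> multiples ?T b" using ab by blast+
  have FT: "quotient_field_is_UNIV ?T" using quotient_field_mono[OF F 0(1)] .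
  define S where "S = (\<Union>n. gauss (\<alpha> n) z)"
  have gmono: "n \<le> m \<Longrightarrow> gauss (\<alpha> n) z \<subseteq> gauss (\<alpha> m) z" for n m
    using gauss_mono[OF loc rt loc rt domle] .
  have sS: "is_subring S"
    unfolding is_subring_def
  proof (intro conjI ballI)
    show "0 \<in> S" "1 \<in> S" using subring_zero[OF sT] subring_one[OF sT] unfolding S_def by blast+
    fix x y assume "x \<in> S" "y \<in> S"
    then obtain n m where "x \<in> gauss (\<alpha> n) z" "y \<in> gauss (\<alpha> m) z" unfolding S_def by blast
    then have *: "x \<in> gauss (\<alpha> (max n m)) z" "y \<in> gauss (\<alpha> (max n m)) z"
      using gmono[of n "max n m"] gmono[of m "max n m"] by auto
    note sub = local_subring[OF gauss_local[OF loc rt]]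
    show "x + y \<in> S" using subring_add[OF sub *] unfolding S_def by blast
    show "x - y \<in> S" using subring_diff[OF sub *] unfolding S_def by blast
    show "x * y \<in> S" using subring_mult[OF sub *] unfolding S_def by blast
  qed
  have TS: "?T \<subseteq> S" unfolding S_def by blast
  have \<alpha>S: "\<alpha> n \<subseteq> S" for n using gauss_superset(2)[OF loc rt] unfolding S_def by blast
  \<comment> \<open>\<open>t n\<close> stays a nonunit in all later members, in their Gauss
    extensions, and so in the union.\<close>
  have tS: "inverse (t n) \<notin> S" for n
  proof
    assume "inverse (t n) \<in> S"
    then obtain m where "inverse (t n) \<in> gauss (\<alpha> m) z" unfolding S_def by blast
    then have inv: "inverse (t n) \<in> gauss (\<alpha> (max n m)) z" using gmono[of m "max n m"] by auto
    have "t n \<in> max_ideal (\<alpha> (max n m))" using domle[of n "max n m"] t(2)[of n] by (auto simp: dominates_def)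
    then have "t n \<in> max_ideal (gauss (\<alpha> (max n m)) z)"
      using max_ideal_gauss_base[OF loc rt] max_ideal_subset by blast
    then show False using inv t(1) not_in_max_ideal by blast
  qed
  \<comment> \<open>The \<open>n\<close>-th denominator: both sides of
    \<open>z = (z * c n) / c n\<close> are the original numerator and denominator divided by the
    first \<open>n\<close> elements \<open>t i\<close>.\<close>
  define c where "c n = b / (\<Prod>i<n. t i)" for n
  have pt: "(\<Prod>i<n. t i) \<noteq> 0" for n using t(1) by simp
  have c0: "c n \<noteq> 0" for n using ab(3) pt by (simp add: c_def)
  have cS: "c n = t n * c (Suc n)" for n using t(1) by (simp add: c_def)
  have cm: "c n \<in> max_ideal (\<alpha> n) \<and> z * c n \<in> max_ideal (\<alpha> n)" for n
  proof (induction n)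
    case 0
    then show ?case using ab by (simp add: c_def)
  next
    case (Suc n)
    note sn = local_subring[OF loc[of "Suc n"]]
    obtain r where r: "c n = t n * r" "r \<in> \<alpha> (Suc n)" using Suc t(3)[of n] by (auto simp: multiples_def)
    obtain r' where r': "z * c n = t n * r'" "r' \<in> \<alpha> (Suc n)" using Suc t(3)[of n] by (auto simp: multiples_def)
    have e: "c (Suc n) = r" using r cS[of n] t(1)[of n] by simp
    have "t n * (z * c (Suc n)) = t n * r'" using r'(1) cS[of n] by (simp add: ac_simps)
    then have e': "z * c (Suc n) = r'" using t(1)[of n] by simp
    \<comment> \<open>A unit as new denominator would put \<open>z\<close> into this member; a unit
      as new numerator, treated next, would put \<open>inverse z\<close> there.\<close>
    have "r \<in> max_ideal (\<alpha> (Suc n))"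
    proof (rule ccontr)
      assume "r \<notin> max_ideal (\<alpha> (Suc n))"
      then have "r' * inverse r \<in> \<alpha> (Suc n)" using r r' inverse_in subring_mult[OF sn] by blast
      moreover have "r' * inverse r = z" using e e' c0[of "Suc n"] by (simp add: field_simps)
      ultimately show False using bad by simp
    qed
    moreover have "r' \<in> max_ideal (\<alpha> (Suc n))"
    proof (rule ccontr)
      assume r'n: "r' \<notin> max_ideal (\<alpha> (Suc n))"
      then have "r * inverse r' \<in> \<alpha> (Suc n)" using r r' inverse_in subring_mult[OF sn] by blast
      moreover have "r' \<noteq> 0" using r'n r' inverse_in by blast
      then have "z \<noteq> 0" "r \<noteq> 0" using e e' by auto
      then have "r * inverse r' = inverse z" using e e' by (simp flip: e')
      ultimately show False using bad by simp
    qed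
    ultimately show ?case using e e' by simp
  qed
  have cinS: "c n \<in> S" for n using cm[of n] max_ideal_subset \<alpha>S by blast
  have chain: "multiples S (c n) \<subseteq> multiples S (c (Suc n))" for n
  proof
    fix x assume "x \<in> multiples S (c n)"
    then obtain r where "x = c n * r" "r \<in> S" by (auto simp: multiples_def)
    then have "x = c (Suc n) * (t n * r)" using cS[of n] by (simp add: ac_simps)
    moreover have "t n * r \<in> S" using \<open>r \<in> S\<close> t(2)[of n] max_ideal_subset \<alpha>S subring_mult[OF sS] by blast
    ultimately show "x \<in> multiples S (c (Suc n))" unfolding multiples_def by blast
  qed
  then have inc: "incseq (\<lambda>n. multiples S (c n))" by (intro incseq_SucI)
  have "b \<in> multiples S (c 0)" using multiples_self[OF sS] by (simp add: c_def)
  then have bc: "b \<in> multiples S (c n)" for n using incseqD[OF inc, of 0 n] by blast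
  obtain n where n: "multiples S (c (Suc n)) = multiples S (c n)"
    using overring_acc[OF T bT powT ab(3) FT sS TS multiples_ideal[OF sS cinS] bc inc] by blast
  then have "c (Suc n) \<in> multiples S (c n)" using multiples_self[OF sS] by blast
  then obtain r where r: "c (Suc n) = c n * r" "r \<in> S" by (auto simp: multiples_def)
  have "c (Suc n) * (t n * r) = c (Suc n) * 1" using r(1) cS[of n] by (simp add: ac_simps)
  then have "t n * r = 1" using c0 by simp
  then have "inverse (t n) = r" by (rule inverse_unique)
  then show False using tS r(2) by blast
qed

subsection \<open>Patch limits\<close>

lemma topspace_patch: "topspace (patch_topology D) = LD D"
proof -
  have "UD D [] = LD D" by (simp add: UD_def)
  then have "LD D \<subseteq> \<Union>({UD D xs | xs. True} \<union> {VD D xs | xs. True})" by blast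
  then show ?thesis unfolding patch_topology_def topspace_subtopology topology_generated_by_topspace by blast
qed

definition patch_basic :: "'a::field set \<Rightarrow> 'a set \<Rightarrow> 'a set \<Rightarrow> 'a set set" where
  "patch_basic D xs ys = {\<alpha> \<in> LD D. xs \<subseteq> \<alpha> \<and> ys \<inter> \<alpha> = {}}"

lemma openin_patch_basic:
  assumes "finite xs" "finite ys"
  shows "openin (patch_topology D) (patch_basic D xs ys)"
  using assms(2)
proof (induction ys)
  have gen: "openin (patch_topology D) (T \<inter> LD D)" if "T \<in> {UD D xs | xs. True} \<union> {VD D xs | xs. True}" for T
    unfolding patch_topology_def using topology_generated_by_Basis[OF that] by (auto simp: openin_subtopology)
  {
    case empty
    obtain l where l: "set l = xs" using finite_list[OF assms(1)] by blast
    have "patch_basic D xs {} = UD D l \<inter> LD D" using l by (auto simp: UD_def patch_basic_def)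
    then show ?case using gen[of "UD D l"] by auto
  next
    case (insert y ys)
    have "patch_basic D xs (insert y ys) = patch_basic D xs ys \<inter> (VD D [y] \<inter> LD D)"
      by (auto simp: VD_def UD_def patch_basic_def)
    then show ?case using gen[of "VD D [y]"] insert.IH by (auto intro: openin_Int)
  }
qed

lemma patch_neighbourhood:
  assumes "openin (patch_topology D) T" "R \<in> T"
  obtains xs ys where "finite xs" "finite ys" "R \<in> patch_basic D xs ys" "patch_basic D xs ys \<subseteq> T"
proof -
  obtain T' where T': "openin (topology_generated_by ({UD D xs | xs. True} \<union> {VD D xs | xs. True})) T'" "T = T' \<inter> LD D"
    using assms(1) unfolding patch_topology_def openin_subtopology by blast
  have RL: "R \<in> LD D" "R \<in> T'" using assms(2) T'(2) by blast+
  have "\<exists>xs ys. finite xs \<and> finite ys \<and> R \<in> patch_basic D xs ys \<and> patch_basic D xs ys \<subseteq> T'"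
    using T'(1) RL(2) unfolding openin_topology_generated_by_iff
  proof (induction rule: generate_topology_on.induct)
    case (Int a b)
    obtain xs ys where 1: "finite xs" "finite ys" "R \<in> patch_basic D xs ys" "patch_basic D xs ys \<subseteq> a"
      using Int.IH(1)[OF IntD1[OF Int.prems]] by blast
    obtain xs' ys' where 2: "finite xs'" "finite ys'" "R \<in> patch_basic D xs' ys'" "patch_basic D xs' ys' \<subseteq> b"
      using Int.IH(2)[OF IntD2[OF Int.prems]] by blast
    have "patch_basic D (xs \<union> xs') (ys \<union> ys') = patch_basic D xs ys \<inter> patch_basic D xs' ys'"
      by (auto simp: patch_basic_def)
    then show ?case using 1 2 by (intro exI[of _ "xs \<union> xs'"] exI[of _ "ys \<union> ys'"]) auto
  next
    case (UN K)
    then obtain k where k: "k \<in> K" "R \<in> k" by blast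
    then show ?case using UN.IH[OF k] by (meson Sup_upper order_trans)
  next
    case (Basis s)
    then consider l where "s = UD D l" | l where "s = VD D l" by blast
    then show ?case
    proof cases
      case 1
      then have "set l \<subseteq> R" using Basis.prems by (auto simp: UD_def)
      then show ?thesis using 1 RL(1)
        by (intro exI[of _ "set l"] exI[of _ "{}"]) (auto simp: UD_def patch_basic_def)
    next
      case 2
      then obtain y where "y \<in> set l" "y \<notin> R" using Basis.prems by (auto simp: VD_def UD_def)
      then show ?thesis using 2 RL(1)
        by (intro exI[of _ "{}"] exI[of _ "{y}"]) (auto simp: VD_def UD_def patch_basic_def)
    qed
  qed simp
  then obtain xs ys where "finite xs" "finite ys" "R \<in> patch_basic D xs ys" "patch_basic D xs ys \<subseteq> T'" by blast
  moreover have "patch_basic D xs ys \<subseteq> LD D" by (auto simp: patch_basic_def)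
  ultimately show thesis using that[of xs ys] T'(2) by blast
qed

text \<open>Being a limit point, tested on basic patch neighbourhoods, with
  \<open>\<alpha> \<noteq> R\<close> puncturing them. Only \<open>D \<subseteq> \<alpha>\<close>
  refers to the base ring, so the property can be moved between \<open>D\<close> and its quadratic
  transforms.\<close>

definition approximable :: "'a::field set \<Rightarrow> 'a set \<Rightarrow> bool" where
  "approximable D R \<longleftrightarrow> (\<forall>xs ys. finite xs \<longrightarrow> finite ys \<longrightarrow> xs \<subseteq> R \<longrightarrow> ys \<inter> R = {} \<longrightarrow>
     (\<exists>\<alpha>. regular_local_dim2 \<alpha> \<and> D \<subseteq> \<alpha> \<and> \<alpha> \<noteq> R \<and> xs \<subseteq> \<alpha> \<and> ys \<inter> \<alpha> = {}))"

lemma approximableD: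
  assumes "approximable D R" "finite xs" "finite ys" "xs \<subseteq> R" "ys \<inter> R = {}"
  obtains \<alpha> where "regular_local_dim2 \<alpha>" "D \<subseteq> \<alpha>" "\<alpha> \<noteq> R" "xs \<subseteq> \<alpha>" "ys \<inter> \<alpha> = {}"
  using assms unfolding approximable_def by metis

lemma approximable_mono: "D \<subseteq> E \<Longrightarrow> approximable E R \<Longrightarrow> approximable D R"
  unfolding approximable_def by (meson order_trans)

lemma QD_subset_LD:
  assumes "regular_local_dim2 D" "quotient_field_is_UNIV D"
  shows "QD D \<subseteq> LD D"
proof
  fix \<alpha> assume "\<alpha> \<in> QD D"
  then have \<alpha>: "regular_local_dim2 \<alpha>" "D \<subseteq> \<alpha>" by (auto simp: QD_def)
  obtain u v where "regular2 D u v" using regular_local_dim2_params[OF assms(1)] .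
  then have "dominates \<alpha> D" using regular2.regular_overring_dominates assms(2) \<alpha> by blast
  then show "\<alpha> \<in> LD D" using \<alpha>(1) by (simp add: dominates_iff regular_local_dim2_def)
qed

lemma derived_set_QD:
  assumes "regular_local_dim2 D" "quotient_field_is_UNIV D"
  shows "R \<in> patch_topology D derived_set_of QD D \<longleftrightarrow> R \<in> LD D \<and> approximable D R"
proof (intro iffI conjI)
  assume R: "R \<in> patch_topology D derived_set_of QD D"
  then show RL: "R \<in> LD D" unfolding derived_set_of_def topspace_patch by blast
  show "approximable D R"
    unfolding approximable_def
  proof (intro allI impI)
    fix xs ys :: "'a set" assume xy: "finite xs" "finite ys" "xs \<subseteq> R" "ys \<inter> R = {}"
    have "R \<in> patch_basic D xs ys" using xy RL by (simp add: patch_basic_def)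
    then obtain \<alpha> where "\<alpha> \<noteq> R" "\<alpha> \<in> QD D" "\<alpha> \<in> patch_basic D xs ys"
      using R openin_patch_basic[OF xy(1,2)] unfolding in_derived_set_of by blast
    then show "\<exists>\<alpha>. regular_local_dim2 \<alpha> \<and> D \<subseteq> \<alpha> \<and> \<alpha> \<noteq> R \<and> xs \<subseteq> \<alpha> \<and> ys \<inter> \<alpha> = {}"
      by (auto simp: QD_def patch_basic_def)
  qed
next
  assume R: "R \<in> LD D \<and> approximable D R"
  show "R \<in> patch_topology D derived_set_of QD D"
    unfolding derived_set_of_def topspace_patch
  proof (intro CollectI conjI allI impI)
    show "R \<in> LD D" using R by blast
    fix T assume "R \<in> T \<and> openin (patch_topology D) T"
    then have T: "openin (patch_topology D) T" "R \<in> T" by blast+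
    obtain xs ys where xy: "finite xs" "finite ys" "R \<in> patch_basic D xs ys" "patch_basic D xs ys \<subseteq> T"
      using patch_neighbourhood[OF T] .
    have xR: "xs \<subseteq> R" "ys \<inter> R = {}" using xy(3) by (auto simp: patch_basic_def)
    obtain \<alpha> where \<alpha>: "regular_local_dim2 \<alpha>" "D \<subseteq> \<alpha>" "\<alpha> \<noteq> R" "xs \<subseteq> \<alpha>" "ys \<inter> \<alpha> = {}"
      using approximableD[OF conjunct2[OF R] xy(1,2) xR] .
    have "\<alpha> \<in> QD D" using \<alpha> by (simp add: QD_def)
    moreover from this have "\<alpha> \<in> patch_basic D xs ys"
      using \<alpha>(4,5) QD_subset_LD[OF assms] by (auto simp: patch_basic_def)
    then have "\<alpha> \<in> T" using xy(4) by blast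
    ultimately show "\<exists>y. y \<noteq> R \<and> y \<in> QD D \<and> y \<in> T" using \<alpha>(3) by blast
  qed
qed

text \<open>Dependent choice combined with \<open>quadratic_sequence_union\<close>. The invariant
  \<open>P\<close> is left open because both inclusions of the theorem run the same construction
  with different invariants.\<close>

lemma quadratic_sequence_exists:
  assumes "P D" "quotient_field_is_UNIV D"
    and reg: "\<forall>E. P E \<longrightarrow> regular_local_dim2 E"
    and step: "\<forall>E. P E \<longrightarrow>
      (\<exists>E' t. P E' \<and> dominates E' E \<and> t \<noteq> 0 \<and> t \<in> max_ideal E \<and> max_ideal E \<subseteq> multiples E' t)"
  shows "\<exists>\<alpha> :: nat \<Rightarrow> 'a::field set. (\<forall>n. P (\<alpha> n)) \<and> (\<forall>n. dominates (\<alpha> (Suc n)) (\<alpha> n)) \<and>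
    (\<forall>z. \<exists>n. z \<in> \<alpha> n \<or> inverse z \<in> \<alpha> n)"
proof -
  let ?Q = "\<lambda>E E'. \<exists>t. dominates E' E \<and> t \<noteq> 0 \<and> t \<in> max_ideal E \<and> max_ideal E \<subseteq> multiples E' t"
  have "\<exists>f. \<forall>n. (P (f n) \<and> (n = 0 \<longrightarrow> f n = D)) \<and> ?Q (f n) (f (Suc n))"
  \<comment> \<open>The clause for \<open>n = 0\<close> pins the start to \<open>D\<close>, the ring
    whose quotient field is known to be everything.\<close>
  proof (rule dependent_nat_choice[of "\<lambda>n E. P E \<and> (n = 0 \<longrightarrow> E = D)" "\<lambda>n. ?Q"])
    show "\<exists>E. P E \<and> (0 = (0::nat) \<longrightarrow> E = D)" using assms(1) by blast
    fix E and n :: nat assume "P E \<and> (n = 0 \<longrightarrow> E = D)"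
    then have "P E" by blast
    from step[rule_format, OF this] obtain E' t where "P E'" "dominates E' E" "t \<noteq> 0" "t \<in> max_ideal E"
      "max_ideal E \<subseteq> multiples E' t" by (elim exE conjE)
    then show "\<exists>E'. (P E' \<and> (Suc n = 0 \<longrightarrow> E' = D)) \<and> ?Q E E'" by (intro exI[of _ E']) auto
  qed
  then obtain \<alpha> where "\<forall>n. (P (\<alpha> n) \<and> (n = 0 \<longrightarrow> \<alpha> n = D)) \<and> ?Q (\<alpha> n) (\<alpha> (Suc n))" by (elim exE)
  then have \<alpha>: "\<alpha> 0 = D" "\<And>n. P (\<alpha> n)" "\<And>n. ?Q (\<alpha> n) (\<alpha> (Suc n))" by simp_all
  obtain t where t: "\<And>n. dominates (\<alpha> (Suc n)) (\<alpha> n) \<and> t n \<noteq> 0 \<and> t n \<in> max_ideal (\<alpha> n) \<and>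
      max_ideal (\<alpha> n) \<subseteq> multiples (\<alpha> (Suc n)) (t n)" using \<alpha>(3) by metis
  have "\<exists>n. z \<in> \<alpha> n \<or> inverse z \<in> \<alpha> n" for z
    using quadratic_sequence_union[of \<alpha> t z] reg \<alpha>(1,2) t assms(2) by blast
  then show ?thesis using \<alpha>(2) t by blast
qed

section \<open>Limit points and quadratic transforms\<close>

context regular2
begin

text \<open>The given finite conditions are enlarged: \<open>w\<close> and \<open>f\<close> are
  demanded and \<open>inverse f\<close> is forbidden. A regular ring meeting them has
  \<open>f\<close> as a nonunit, so it contains \<open>D1\<close>.\<close>

lemma limit_step:
  assumes F: "quotient_field_is_UNIV D" and R: "local_ring R" "dominates R D" "w \<in> R" "\<not> valuation_ring R"
    and lim: "approximable D R"
  shows "\<exists>E t. regular_local_dim2 E \<and> dominates R E \<and> approximable E R \<and>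
    dominates E D \<and> t \<noteq> 0 \<and> t \<in> max_ideal D \<and> max_ideal D \<subseteq> multiples E t"
proof -
  have "R \<noteq> gauss D w" using gauss_w_valuation[OF F] R(4) by blast
  then obtain D1 f where D1: "regular2 D1 u f" "dominates R D1" "dominates D1 D" "max_ideal D \<subseteq> multiples D1 u"
    and over: "\<And>\<alpha>. local_ring \<alpha> \<Longrightarrow> dominates \<alpha> D \<Longrightarrow> w \<in> \<alpha> \<Longrightarrow> f \<in> max_ideal \<alpha> \<Longrightarrow> D1 \<subseteq> \<alpha>"
    and fR: "f \<in> max_ideal R"
    using quadratic_step[OF F R(1-3)] by metis
  interpret E: regular2 D1 u f by fact
  have f0: "f \<noteq> 0" using E.v_notin subring_zero[OF E.sub] by (force simp: multiples_def)
  have "inverse f \<notin> R" using fR f0 not_in_max_ideal by blast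
  have "approximable D1 R"
    unfolding approximable_def
  proof (intro allI impI)
    fix xs ys :: "'a set" assume xy: "finite xs" "finite ys" "xs \<subseteq> R" "ys \<inter> R = {}"
    have 1: "insert w (insert f xs) \<subseteq> R" using xy R(3) fR max_ideal_subset by blast
    have 2: "insert (inverse f) ys \<inter> R = {}" using xy \<open>inverse f \<notin> R\<close> by blast
    obtain \<alpha> where \<alpha>: "regular_local_dim2 \<alpha>" "D \<subseteq> \<alpha>" "\<alpha> \<noteq> R" "insert w (insert f xs) \<subseteq> \<alpha>" "insert (inverse f) ys \<inter> \<alpha> = {}"
      using approximableD[OF lim _ _ 1 2] xy by blast
    have l: "local_ring \<alpha>" using \<alpha>(1) by (simp add: regular_local_dim2_def)
    have "f \<in> max_ideal \<alpha>" using \<alpha>(4,5) by (auto simp: max_ideal_def)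
    then have "D1 \<subseteq> \<alpha>"
      using over[OF l regular_overring_dominates[OF F \<alpha>(1,2)]] \<alpha>(4) by blast
    then show "\<exists>\<alpha>. regular_local_dim2 \<alpha> \<and> D1 \<subseteq> \<alpha> \<and> \<alpha> \<noteq> R \<and> xs \<subseteq> \<alpha> \<and> ys \<inter> \<alpha> = {}"
      using \<alpha> by blast
  qed
  then show ?thesis using E.regular_local_dim2 D1(2-4) u_nonzero params(1) by blast
qed

text \<open>Forbidding both ratios leaves only \<open>D\<close> among the regular overrings, while
  the limit property supplies a ring different from \<open>D\<close>.\<close>

lemma limit_contains_ratio:
  assumes F: "quotient_field_is_UNIV D" and R: "D \<subseteq> R" and lim: "approximable D R"
  shows "v / u \<in> R \<or> u / v \<in> R"
proof (rule ccontr)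
  assume "\<not> ?thesis"
  then have ys: "{v / u, u / v} \<inter> R = {}" by blast
  \<comment> \<open>If \<open>R\<close> is larger than \<open>D\<close>, one element of
    \<open>R - D\<close> is demanded to exclude \<open>D\<close>; if \<open>R = D\<close>, the
    condition \<open>\<alpha> \<noteq> R\<close> already does so.\<close>
  define xs where "xs = (if R = D then {} else {SOME r. r \<in> R - D})"
  have xs: "xs \<subseteq> R" "finite xs" "R \<noteq> D \<Longrightarrow> \<not> xs \<subseteq> D"
    using R someI_ex[of "\<lambda>r. r \<in> R - D"] by (auto simp: xs_def)
  obtain \<alpha> where \<alpha>: "regular_local_dim2 \<alpha>" "D \<subseteq> \<alpha>" "\<alpha> \<noteq> R" "xs \<subseteq> \<alpha>" "{v / u, u / v} \<inter> \<alpha> = {}"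
    using approximableD[OF lim xs(2) _ xs(1) ys] by blast
  have "\<alpha> = D"
    using regular_overring_eq[OF F \<alpha>(1) regular_overring_dominates[OF F \<alpha>(1,2)]] \<alpha>(5) by blast
  then show False using \<alpha>(3,4) xs(3) by blast
qed

text \<open>For a denominator with monic reduction \<open>g\<close>, a prime containing \<open>u\<close> and \<open>1 + w g(w)\<close> avoids
  the denominator.\<close>

lemma approximable_gauss:
  assumes F: "quotient_field_is_UNIV D"
  shows "approximable D (gauss D w)"
  unfolding approximable_def
proof (intro allI impI)
  note rt = w_transcendental
  let ?m = "polys (max_ideal D)"
  fix xs ys :: "'a set" assume xy: "finite xs" "finite ys" "xs \<subseteq> gauss D w" "ys \<inter> gauss D w = {}"
  \<comment> \<open>A common denominator for the finitely many elements of \<open>xs\<close>, still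
    nonzero over the residue field.\<close>
  have "\<exists>g\<in>polys D. g \<notin> ?m \<and> (\<forall>x\<in>xs. \<exists>f\<in>polys D. x * poly g w = poly f w)"
    using xy(1,3)
  proof (induction xs)
    case empty
    have "1 \<notin> ?m" using monic_notin_polys_max[OF sub] by simp
    then show ?case using polys_one[OF sub] by blast
  next
    case (insert x xs)
    then obtain g where g: "g \<in> polys D" "g \<notin> ?m" "\<And>y. y \<in> xs \<Longrightarrow> \<exists>f\<in>polys D. y * poly g w = poly f w" by blast
    obtain f' g' where x: "x = poly f' w / poly g' w" "f' \<in> polys D" "g' \<in> polys D" "g' \<notin> ?m" "poly g' w \<noteq> 0"
      using gauss_cases[OF loc rt] insert.prems by (metis insert_subset)
    have "g * g' \<in> polys D" "g * g' \<notin> ?m" using g x polys_mult[OF sub] polys_max_prime[OF loc] by blast+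
    moreover have "\<exists>f\<in>polys D. y * poly (g * g') w = poly f w" if y: "y \<in> insert x xs" for y
    proof (cases "y = x")
      case True
      then have "y * poly (g * g') w = poly (g * f') w" using x by simp
      then show ?thesis using polys_mult[OF sub g(1) x(2)] by blast
    next
      case False
      then obtain f where f: "f \<in> polys D" "y * poly g w = poly f w" using g(3) y by blast
      then have "y * poly (g * g') w = poly (f * g') w" by (simp flip: f(2))
      then show ?thesis using polys_mult[OF sub f(1) x(3)] by blast
    qed
    ultimately show ?case by blast
  qed
  then obtain g where g: "g \<in> polys D" "g \<notin> ?m" "\<And>x. x \<in> xs \<Longrightarrow> \<exists>f\<in>polys D. x * poly g w = poly f w" by blast
  obtain h c where h: "h \<in> polys D" "lead_coeff h = 1" "c \<in> D" "c \<noteq> 0" "inverse c \<in> D" "g - smult c h \<in> ?m"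
    using monic_reduction[OF loc g(1,2)] by blast
  \<comment> \<open>The polynomial \<open>1 + X h\<close>, as in Euclid's proof that there are
    infinitely many primes. It is coprime to \<open>h\<close>, and the factor \<open>X\<close> gives
    it positive degree even if \<open>h = 1\<close>.\<close>
  let ?k = "pCons 1 h"
  have "h \<noteq> 0" using h(2) by auto
  have k: "?k \<in> polys D" "lead_coeff ?k = 1" "degree ?k = Suc (degree h)"
    using h(1,2) \<open>h \<noteq> 0\<close> subring_one[OF sub] by (auto simp: polys_pCons)
  have kA: "poly ?k w \<in> A" using poly_in_adjoin[OF k(1)] .
  have uA: "u \<in> A" using params adjoin_superset[OF sub] by blast
  have km: "?k \<notin> ?m" using monic_notin_polys_max[OF sub k(2)] .
  let ?I = "two_gen A u (poly ?k w)"
  \<comment> \<open>A monic polynomial of positive degree is no unit over the residue field: in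
    \<open>1 - s * ?k\<close>, with \<open>s\<close> reduced to \<open>d\<close> times a monic
    polynomial, the top coefficient is \<open>- d\<close>, a unit.\<close>
  have "1 \<notin> ?I"
  proof
    assume "1 \<in> ?I"
    then obtain r s where rs: "1 = r * u + poly s w * poly ?k w" "r \<in> A" "s \<in> polys D"
      unfolding two_gen_def adjoin_def by blast
    have "poly (1 - s * ?k) w = u * r" using rs(1) by (simp only: poly_diff poly_1 poly_mult) (simp add: algebra_simps)
    then have "poly (1 - s * ?k) w \<in> extended_max D w" using rs(2) unfolding extended_max_w multiples_def by blast
    then have sm: "1 - s * ?k \<in> ?m"
      using extended_max_iff[OF loc rt] polys_diff[OF sub polys_one[OF sub] polys_mult[OF sub rs(3) k(1)]] by blast
    have "s \<notin> ?m"
    proof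
      assume "s \<in> ?m"
      then have "(1 - s * ?k) + ?k * s \<in> ?m"
        using polys_ideal_add[OF sub im sm polys_ideal_mult[OF sub im k(1)]] by blast
      then have "1 \<in> ?m" by (simp add: algebra_simps)
      then show False using monic_notin_polys_max[OF sub, of 1] by simp
    qed
    then obtain s' d where s': "s' \<in> polys D" "lead_coeff s' = 1" "d \<in> D" "d \<noteq> 0" "inverse d \<in> D" "s - smult d s' \<in> ?m"
      using monic_reduction[OF loc rs(3)] by blast
    have "(1 - s * ?k) + ?k * (s - smult d s') \<in> ?m"
      using polys_ideal_add[OF sub im sm polys_ideal_mult[OF sub im k(1) s'(6)]] .
    moreover have "(1 - s * ?k) + ?k * (s - smult d s') = 1 - smult d (s' * ?k)"
      by (simp only: algebra_simps mult_smult_right)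
    ultimately have *: "1 - smult d (s' * ?k) \<in> ?m" by simp
    have "s' \<noteq> 0" using s'(2) by auto
    then have deg: "degree (s' * ?k) = degree s' + Suc (degree h)"
      using degree_mult_eq[of s' ?k] k(3) by auto
    have lc: "lead_coeff (s' * ?k) = 1" using lead_coeff_mult[of s' ?k] s'(2) k(2) by simp
    have "coeff (1 - smult d (s' * ?k)) (degree (s' * ?k)) = - d"
      unfolding coeff_diff coeff_smult lc unfolding deg by (simp add: coeff_1)
    then have "- d \<in> max_ideal D" using * unfolding polys_def by (metis (mono_tags, lifting) mem_Collect_eq)
    then have "d \<in> max_ideal D" using ideal_uminus[OF sub im, of "- d"] by simp
    then show False using s'(4,5) not_in_max_ideal by blast
  qed
  then obtain q where q: "is_prime_ideal A q" "?I \<subseteq> q"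
    using exists_prime_ideal[OF sub_A noetherian_adjoin[OF sub noeth] two_gen_ideal[OF sub_A uA kA], of "{1}"] by auto
  note iq = prime_ideal_ideal[OF q(1)]
  have uk: "u \<in> q" "poly ?k w \<in> q" using q(2) two_gen_self[OF sub_A] by blast+
  have ext: "extended_max D w \<subseteq> q"
    unfolding extended_max_w using uk(1) ideal_mult_right[OF iq] by (auto simp: multiples_def)
  have "poly ?k w \<notin> extended_max D w" using km extended_max_iff[OF loc rt k(1)] by blast
  then have ne: "q \<noteq> extended_max D w" using uk(2) by blast
  have gq: "poly g w \<notin> q"
  proof
    assume gq: "poly g w \<in> q"
    have "poly (g - smult c h) w \<in> q" using h(6) ext by (auto simp: extended_max_def)
    then have "poly g w - poly (g - smult c h) w \<in> q" using gq ideal_diff[OF sub_A iq] by blast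
    then have "c * poly h w \<in> q" by simp
    then have "inverse c * (c * poly h w) \<in> q" using h(5) adjoin_superset(1)[OF sub] ideal_mult[OF iq] by blast
    then have "poly h w \<in> q" using h(4) by (simp flip: mult.assoc)
    then have "w * poly h w \<in> q" using adjoin_superset(2)[OF sub] ideal_mult[OF iq] by blast
    then have "poly ?k w - w * poly h w \<in> q" using uk(2) ideal_diff[OF sub_A iq] by blast
    then have "1 \<in> q" by simp
    then show False using prime_ideal_one[OF q(1)] by blast
  qed
  let ?L = "localise A q"
  obtain f where "regular2 ?L u f" by (rule quadratic_regular[OF q(1) uk(1) ne])
  then have reg: "regular_local_dim2 ?L" by (rule regular2.regular_local_dim2)
  moreover have "D \<subseteq> ?L" using adjoin_superset(1)[OF sub] localise_superset[OF sub_A q(1)] by blast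
  moreover have "?L \<noteq> gauss D w" using regular_not_valuation[OF reg] gauss_w_valuation[OF F] by metis
  moreover have "xs \<subseteq> ?L"
  proof
    fix x assume "x \<in> xs"
    then obtain f where f: "f \<in> polys D" "x * poly g w = poly f w" using g(3) by blast
    have "poly g w \<noteq> 0" using gq ideal_zero[OF iq] by auto
    then have "x = poly f w / poly g w" using f(2) by (simp add: field_simps)
    then show "x \<in> ?L" unfolding localise_def using poly_in_adjoin f(1) g(1) gq by blast
  qed
  \<comment> \<open>The forbidden elements \<open>ys\<close> are avoided for free, because
    \<open>q\<close> contains the prime that defines the order valuation ring.\<close>
  moreover have "?L \<subseteq> gauss D w" unfolding gauss_def localise_def using ext by blast
  ultimately show "\<exists>\<alpha>. regular_local_dim2 \<alpha> \<and> D \<subseteq> \<alpha> \<and> \<alpha> \<noteq> gauss D w \<and> xs \<subseteq> \<alpha> \<and> ys \<inter> \<alpha> = {}"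
    using xy(4) by blast
qed

end

text \<open>If \<open>R\<close> were not a valuation ring, it would never equal an order valuation
  ring along the way, so the sequence of transforms would be infinite. Its union lies in
  \<open>R\<close> and contains \<open>z\<close> or \<open>inverse z\<close> for every
  \<open>z\<close>, which makes \<open>R\<close> a valuation ring after all.\<close>

lemma limit_valuation:
  assumes D: "regular_local_dim2 D" "quotient_field_is_UNIV D"
    and R: "local_ring R" "dominates R D" "approximable D R"
  shows "valuation_ring R"
proof (rule ccontr)
  assume nv: "\<not> valuation_ring R"
  let ?P = "\<lambda>E. regular_local_dim2 E \<and> dominates R E \<and> approximable E R \<and> D \<subseteq> E"
  have ex: "\<exists>E' t. ?P E' \<and> dominates E' E \<and> t \<noteq> 0 \<and> t \<in> max_ideal E \<and> max_ideal E \<subseteq> multiples E' t" if E: "?P E" for E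
  proof -
    have FE: "quotient_field_is_UNIV E" using E quotient_field_mono[OF D(2)] by blast
    have ER: "dominates R E" "E \<subseteq> R" using E unfolding dominates_def by blast+
    have lim: "approximable E R" using E by blast
    obtain u v where uv: "regular2 E u v" using regular_local_dim2_params E by blast
    have "v / u \<in> R \<or> u / v \<in> R" using regular2.limit_contains_ratio[OF uv FE ER(2) lim] .
    then obtain E' t where "regular_local_dim2 E'" "dominates R E'" "approximable E' R"
      "dominates E' E" "t \<noteq> 0" "t \<in> max_ideal E" "max_ideal E \<subseteq> multiples E' t"
      using regular2.limit_step[OF uv FE R(1) ER(1) _ nv lim]
        regular2.limit_step[OF regular2_commute[OF uv] FE R(1) ER(1) _ nv lim] by blast
    moreover from this have "D \<subseteq> E'" using E unfolding dominates_def by blast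
    ultimately show ?thesis by blast
  qed
  have PD: "?P D" using D R by blast
  have reg: "\<forall>E. ?P E \<longrightarrow> regular_local_dim2 E" by blast
  have "\<forall>E. ?P E \<longrightarrow>
    (\<exists>E' t. ?P E' \<and> dominates E' E \<and> t \<noteq> 0 \<and> t \<in> max_ideal E \<and> max_ideal E \<subseteq> multiples E' t)"
    by (intro allI impI ex)
  from quadratic_sequence_exists[of ?P, OF PD D(2) reg this] obtain \<alpha> where "\<forall>n. ?P (\<alpha> n)" "\<forall>n. dominates (\<alpha> (Suc n)) (\<alpha> n)"
    "\<forall>z. \<exists>n. z \<in> \<alpha> n \<or> inverse z \<in> \<alpha> n"
    by (elim exE conjE)
  then have \<alpha>: "\<And>n. ?P (\<alpha> n)" "\<And>n. dominates (\<alpha> (Suc n)) (\<alpha> n)"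
    "\<And>z. \<exists>n. z \<in> \<alpha> n \<or> inverse z \<in> \<alpha> n" by blast+
  then have "z \<in> R \<or> inverse z \<in> R" for z unfolding dominates_def by blast
  then show False using nv local_subring[OF R(1)] unfolding valuation_ring_def by blast
qed

text \<open>Assuming \<open>V\<close> is no limit keeps it apart from every order valuation ring met
  along the sequence, since those are limits. The sequence is then infinite, and its members
  themselves approximate \<open>V\<close>.\<close>

lemma valuation_approximable:
  assumes D: "regular_local_dim2 D" "quotient_field_is_UNIV D"
    and V: "local_ring V" "dominates V D" "valuation_ring V"
  shows "approximable D V"
proof (rule ccontr)
  assume na: "\<not> approximable D V"
  let ?P = "\<lambda>E. regular_local_dim2 E \<and> dominates V E \<and> D \<subseteq> E"
  have step: "\<exists>E' t. ?P E' \<and> dominates E' E \<and> t \<noteq> 0 \<and> t \<in> max_ideal E \<and> max_ideal E \<subseteq> multiples E' t"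
    if E: "?P E" and uv: "regular2 E u v" "v / u \<in> V" for E u v
  proof -
    have FE: "quotient_field_is_UNIV E" using E quotient_field_mono[OF D(2)] by blast
    have "V \<noteq> gauss E (v / u)"
      using regular2.approximable_gauss[OF uv(1) FE] approximable_mono na E by blast
    then obtain E' f where E': "regular2 E' u f" "dominates V E'" "dominates E' E" "max_ideal E \<subseteq> multiples E' u"
      using regular2.quadratic_step[OF uv(1) FE V(1) _ uv(2)] E by metis
    moreover have "D \<subseteq> E'" using E E'(3) unfolding dominates_def by blast
    ultimately show ?thesis
      using regular2.regular_local_dim2[OF E'(1)] regular2.u_nonzero[OF uv(1)] regular2.params(1)[OF uv(1)] by blast
  qed
  have ex: "\<exists>E' t. ?P E' \<and> dominates E' E \<and> t \<noteq> 0 \<and> t \<in> max_ideal E \<and> max_ideal E \<subseteq> multiples E' t" if E: "?P E" for E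
  proof -
    obtain u v where uv: "regular2 E u v" using regular_local_dim2_params E by blast
    have vu: "regular2 E v u" using regular2_commute[OF uv] .
    have "v / u \<noteq> 0" using regular2.u_nonzero[OF uv] regular2.u_nonzero[OF vu] by simp
    then have "v / u \<in> V \<or> inverse (v / u) \<in> V" using V(3) unfolding valuation_ring_def by blast
    then have "v / u \<in> V \<or> u / v \<in> V" by simp
    then show ?thesis using step[OF E uv] step[OF E vu] by blast
  qed
  have PD: "?P D" using D V by blast
  have reg: "\<forall>E. ?P E \<longrightarrow> regular_local_dim2 E" by blast
  have "\<forall>E. ?P E \<longrightarrow>
    (\<exists>E' t. ?P E' \<and> dominates E' E \<and> t \<noteq> 0 \<and> t \<in> max_ideal E \<and> max_ideal E \<subseteq> multiples E' t)"
    by (intro allI impI ex)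
  from quadratic_sequence_exists[of ?P, OF PD D(2) reg this] obtain \<alpha> where "\<forall>n. ?P (\<alpha> n)" "\<forall>n. dominates (\<alpha> (Suc n)) (\<alpha> n)"
    "\<forall>z. \<exists>n. z \<in> \<alpha> n \<or> inverse z \<in> \<alpha> n"
    by (elim exE conjE)
  then have \<alpha>: "\<And>n. ?P (\<alpha> n)" "\<And>n. dominates (\<alpha> (Suc n)) (\<alpha> n)"
    "\<And>z. \<exists>n. z \<in> \<alpha> n \<or> inverse z \<in> \<alpha> n" by blast+
  have inc: "incseq \<alpha>" using \<alpha>(2) unfolding dominates_def by (intro incseq_SucI) blast
  \<comment> \<open>If only \<open>inverse z\<close> is in \<open>\<alpha> n\<close>, it is a
    nonunit there and hence in \<open>V\<close>, which contradicts \<open>z\<close> being in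
    \<open>V\<close>.\<close>
  have cover: "\<exists>n. z \<in> \<alpha> n" if z: "z \<in> V" for z
  proof -
    obtain n where n: "z \<in> \<alpha> n \<or> inverse z \<in> \<alpha> n" using \<alpha>(3) by blast
    have "z \<in> \<alpha> n"
    proof (rule ccontr)
      assume zn: "z \<notin> \<alpha> n"
      then have "inverse z \<in> max_ideal (\<alpha> n)" using n by (simp add: max_ideal_def)
      then have "inverse z \<in> max_ideal V" using \<alpha>(1) unfolding dominates_def by blast
      then have "z = 0" using z by (simp add: max_ideal_def)
      moreover have "is_subring (\<alpha> n)" using \<alpha>(1) by (simp add: regular_local_dim2_def local_ring_def)
      ultimately show False using zn subring_zero by blast
    qed
    then show ?thesis by blast
  qed
  have "approximable D V"
    unfolding approximable_def
  proof (intro allI impI)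
    fix xs ys :: "'a set" assume xy: "finite xs" "finite ys" "xs \<subseteq> V" "ys \<inter> V = {}"
    have "\<exists>n. xs \<subseteq> \<alpha> n" using xy(1,3)
    proof (induction xs)
      case (insert x xs)
      then obtain n m where "xs \<subseteq> \<alpha> n" "x \<in> \<alpha> m" using cover by (meson insert_subset)
      moreover have "\<alpha> n \<subseteq> \<alpha> (max n m)" "\<alpha> m \<subseteq> \<alpha> (max n m)" using inc by (auto simp: incseq_def)
      ultimately show ?case by (meson insert_subset subset_iff)
    qed auto
    then obtain n where n: "xs \<subseteq> \<alpha> n" by blast
    \<comment> \<open>As the members lie inside \<open>V\<close>, elements missing from
      \<open>V\<close> are missing from them as well; they differ from \<open>V\<close> because a
      regular ring of dimension two is no valuation ring.\<close>
    have "\<alpha> n \<subseteq> V" using \<alpha>(1) unfolding dominates_def by blast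
    moreover have "\<alpha> n \<noteq> V" using regular_not_valuation \<alpha>(1) V(3) by blast
    ultimately show "\<exists>\<alpha>. regular_local_dim2 \<alpha> \<and> D \<subseteq> \<alpha> \<and> \<alpha> \<noteq> V \<and> xs \<subseteq> \<alpha> \<and> ys \<inter> \<alpha> = {}"
      using \<alpha>(1)[of n] n xy(4) by blast
  qed
  then show False using na by blast
qed

theorem theorem4p8:
  fixes D :: "'a::field set"
  assumes "is_subring D" and "quotient_field_is_UNIV D" and "regular_local_dim2 D"
  shows "patch_topology D derived_set_of QD D = {V \<in> LD D. valuation_ring V} \<and>
         patch_topology D closure_of QD D = QstarD D"
proof
  show der: "patch_topology D derived_set_of QD D = {V \<in> LD D. valuation_ring V}"
  proof (rule set_eqI)
    fix R
    show "R \<in> patch_topology D derived_set_of QD D \<longleftrightarrow> R \<in> {V \<in> LD D. valuation_ring V}"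
      unfolding derived_set_QD[OF assms(3,2)] mem_Collect_eq dominates_iff
      using limit_valuation[OF assms(3,2)] valuation_approximable[OF assms(3,2)] by blast
  qed
  show "patch_topology D closure_of QD D = QstarD D"
    unfolding closure_of der topspace_patch QstarD_def
    using QD_subset_LD[OF assms(3,2)] by blast
qed

end
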